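(* Let $\beta>0$ and $q\ge 0$ be fixed with $q\ne\frac12,\frac32,\frac52,\ldots$. Let $F_q^{(1)}(\eta,\beta)$, $F_q^{(2)}(\eta,\beta)$, $f_2$ and $\tau_{2n}$ be as defined in the context. (i) For all $\eta>0$, $$F_q^{(1)}(\eta,\beta)=\sum_{n=0}^\infty(-1)^n e^{-n\eta}\,{}_1F_1\left(q+1;\,q+\tfrac52;\,\frac{-2n}{\beta}\right),$$ the series being convergent for all $\eta>0$. (ii) $$F_q^{(2)}(\eta,\beta)\sim \eta^{q+\frac32}\sum_{n=0}^\infty\frac{1}{\Gamma\left(q+\frac52-n\right)}\frac{a_n}{\eta^n}+\sin(\pi q)\sum_{n=1}^\infty(-1)^n\frac{e^{-n\eta}}{n^{q+\frac32}}\,{}_1F_1\left(-\tfrac12;\,-q-\tfrac12;\,\frac{-2n}{\beta}\right),$$ where the first series is an asymptotic expansion for $\eta\to+\infty$ and the second series converges for all $\eta>0$. That is, denoting by $E(\eta)$ the second term (including the factor $\sin(\pi q)$), for every integer $N\ge 0$, $$F_q^{(2)}(\eta,\beta)=\eta^{q+\frac32}\sum_{n=0}^{N-1}\frac{1}{\Gamma(q+\frac52-n)}\frac{a_n}{\eta^n}+E(\eta)+\mathcal{O}\left(\eta^{q+\frac32-N}\right),\quad \eta\to+\infty.$$ Here the coefficients $a_n$ are defined by the expansion $f_2(s)=\sum_{n=0}^\infty a_n s^n$, $|s|<1$, and the first coefficients are $$a_0=1,\quad a_1=\frac{2}{\beta(1+2q)},\quad a_2=\frac{\tau_2\beta^2(4q^2-1)-2}{\beta^2(4q^2-1)},\quad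 a_3=2\,\frac{\beta^2\tau_2(2q-1)(2q-3)+2}{\beta^3(4q^2-1)(2q-3)}.$$
   Context: The relativistic Fermi-Dirac integral is $F_q(\eta,\beta)=\int_0^\infty \frac{x^q\sqrt{1+\beta x/2}}{e^{x-\eta}+1}\,dx$ ($\beta\ge 0$, $q\ge0$, $\eta\in\mathbb{R}$). Let ${}_1F_1(a;b;z)=\sum_{k\ge0}\frac{(a)_k}{(b)_k}\frac{z^k}{k!}$ be Kummer's function. For $\beta>0$ and $q\neq\frac12,\frac32,\ldots$ put $$f_1(s)=\frac{\pi s}{\sin(\pi s)}\,{}_1F_1\left(q+1;q+\tfrac52;\frac{2s}{\beta}\right),\qquad f_2(s)=\frac{\pi s}{\sin(\pi s)}\,{}_1F_1\left(-\tfrac12;-q-\tfrac12;\frac{2s}{\beta}\right),$$ and, with any $0<c<1$ and principal powers of $s$, $$F_q^{(1)}(\eta,\beta)=\frac{1}{2\pi i}\int_{c-i\infty}^{c+i\infty}e^{\eta s}f_1(s)\,\frac{ds}{s},\qquad F_q^{(2)}(\eta,\beta)=\frac{1}{2\pi i}\int_{c-i\infty}^{c+i\infty}e^{\eta s}f_2(s)\,\frac{ds}{s^{q+\frac52}}.$$ The relativistic Fermi-Dirac integral is written in terms of these functions as $$F_q(\eta,\beta)=\left(\frac{2}{\beta}\right)^{q+1}\frac{\Gamma(-q-\frac32)\Gamma(q+1)}{\Gamma(-\frac12)}F_q^{(1)}(\eta,\beta)+\left(\frac{2}{\beta}\right)^{-\frac12}\Gamma\left(q+\tfrac32\right)F_q^{(2)}(\eta,\beta).$$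 The numbers $\tau_{2n}$ are defined by $\frac{\pi s}{\sin(\pi s)}=\sum_{n=0}^\infty\tau_{2n}s^{2n}$, $|s|<1$; in particular $\tau_0=1$, $\tau_2=\frac16\pi^2$. *)

theory Defs
  imports "HOL-Complex_Analysis.Complex_Analysis" "HOL-Library.Landau_Symbols"
begin

definition kummer :: "complex \<Rightarrow> complex \<Rightarrow> complex \<Rightarrow> complex" where
  "kummer a b z = (\<Sum>k. pochhammer a k / pochhammer b k * z ^ k / fact k)"

text \<open>
  The function \<open>\<pi> s / sin (\<pi> s)\<close>, with its removable singularity at \<open>0\<close> filled in.
  (At nonzero integers it is a pole; there the value is the irrelevant \<open>0\<close>.)
\<close>
definition pi_sin :: "complex \<Rightarrow> complex" where
  "pi_sin s = (if s = 0 then 1 else of_real pi * s / sin (of_real pi * s))"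

definition f1 :: "real \<Rightarrow> real \<Rightarrow> complex \<Rightarrow> complex" where
  "f1 q \<beta> s = pi_sin s * kummer (of_real (q + 1)) (of_real (q + 5/2)) (2 * s / of_real \<beta>)"

definition f2 :: "real \<Rightarrow> real \<Rightarrow> complex \<Rightarrow> complex" where
  "f2 q \<beta> s = pi_sin s * kummer (- 1/2) (of_real (- q - 1/2)) (2 * s / of_real \<beta>)"

text \<open>
  The integral of \<open>g\<close> along the upward vertical line \<open>Re s = c\<close>, parametrised by
  \<open>s = c + \<i> t\<close>, as an absolutely convergent integral: here the factor \<open>1 / sin (\<pi> s)\<close>
  makes the integrands decay exponentially along the line.
\<close>
definition vertical_integral :: "real \<Rightarrow> (complex \<Rightarrow> complex) \<Rightarrow> complex" where
  "vertical_integral c g = (LINT t|lborel. g (Complex c t) * \<i>)"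

definition F1 :: "real \<Rightarrow> real \<Rightarrow> real \<Rightarrow> real \<Rightarrow> complex" where
  "F1 c q \<eta> \<beta> = 1 / (2 * of_real pi * \<i>) *
     vertical_integral c (\<lambda>s. exp (of_real \<eta> * s) * f1 q \<beta> s / s)"

definition F2 :: "real \<Rightarrow> real \<Rightarrow> real \<Rightarrow> real \<Rightarrow> complex" where
  "F2 c q \<eta> \<beta> = 1 / (2 * of_real pi * \<i>) *
     vertical_integral c (\<lambda>s. exp (of_real \<eta> * s) * f2 q \<beta> s / s powr of_real (q + 5/2))"

text \<open>
  \<open>tau m\<close> is the coefficient of \<open>s ^ m\<close> (not of \<open>s ^ (2 * m)\<close>).
\<close>
definition tau :: "nat \<Rightarrow> complex" where
  "tau m = fps_nth (fps_expansion pi_sin 0) m"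

definition a_coeff :: "real \<Rightarrow> real \<Rightarrow> nat \<Rightarrow> complex" where
  "a_coeff q \<beta> n = fps_nth (fps_expansion (f2 q \<beta>) 0) n"

definition exp_term :: "real \<Rightarrow> real \<Rightarrow> real \<Rightarrow> nat \<Rightarrow> complex" where
  "exp_term q \<beta> \<eta> n = (-1) ^ n * of_real (exp (- real n * \<eta>) / real n powr (q + 3/2))
     * kummer (- 1/2) (of_real (- q - 1/2)) (of_real (- 2 * real n / \<beta>))"

definition E :: "real \<Rightarrow> real \<Rightarrow> real \<Rightarrow> complex" where
  "E q \<beta> \<eta> = of_real (sin (pi * q)) * (\<Sum>n. exp_term q \<beta> \<eta> (Suc n))"

lemma sin_pi_nonzero:
  assumes "norm (s :: complex) < 1" "s \<noteq> 0"
  shows "sin (of_real pi * s) \<noteq> 0"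
proof
  assume "sin (of_real pi * s) = 0"
  then obtain n :: int where "of_real pi * s = of_real (of_int n * pi)"
    unfolding sin_eq_0 by (auto simp: mult.commute)
  hence s: "s = of_int n" by simp
  hence "norm s = of_int \<bar>n\<bar>" by simp
  with assms(1) have "\<bar>n\<bar> < 1" by simp
  with s assms(2) show False by simp
qed

lemma pi_sin_holomorphic: "pi_sin holomorphic_on ball 0 1"
proof (rule no_isolated_singularity'[where K = "{0}"])
  have "((\<lambda>s::complex. of_real pi * s / sin (of_real pi * s)) \<longlongrightarrow> 1) (at 0)"
  proof -
    have "((\<lambda>s::complex. sin (of_real pi * s)) has_field_derivative of_real pi) (at 0)"
      by (auto intro!: derivative_eq_intros)
    hence "((\<lambda>s::complex. sin (of_real pi * s) / s) \<longlongrightarrow> of_real pi) (at 0)"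
      by (simp add: has_field_derivative_iff)
    from tendsto_divide[OF tendsto_const[of "of_real pi"] this]
    have "((\<lambda>s::complex. of_real pi / (sin (of_real pi * s) / s)) \<longlongrightarrow> of_real pi / of_real pi) (at 0)"
      by simp
    thus ?thesis by simp
  qed
  hence "(pi_sin \<longlongrightarrow> 1) (at 0)"
    by (rule Lim_transform_eventually)
       (auto simp: pi_sin_def eventually_at_filter)
  thus "(pi_sin \<longlongrightarrow> pi_sin z) (at z within ball 0 1)" if "z \<in> {0}" for z
    using that by (simp add: pi_sin_def at_within_open[of 0 "ball 0 1"])
  have "(\<lambda>s. of_real pi * s / sin (of_real pi * s)) holomorphic_on (ball 0 1 - {0 :: complex})"
    by (intro holomorphic_intros) (simp add: sin_pi_nonzero)
  thus "pi_sin holomorphic_on (ball 0 1 - {0})"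
    by (rule holomorphic_transform) (auto simp: pi_sin_def)
qed auto

lemma tau_sums':
  assumes "norm s < 1"
  shows "(\<lambda>m. tau m * s ^ m) sums pi_sin s"
  using holomorphic_power_series[OF pi_sin_holomorphic, of s] assms
  by (simp add: tau_def fps_expansion_def)

lemma pi_sin_has_fps_expansion: "pi_sin has_fps_expansion Abs_fps tau"
proof -
  have "pi_sin has_fps_expansion fps_expansion pi_sin 0"
    using pi_sin_holomorphic by (intro has_fps_expansion_fps_expansion[of "ball 0 1"]) auto
  moreover have "Abs_fps tau = fps_expansion pi_sin 0"
    by (rule fps_ext) (simp add: tau_def)
  ultimately show ?thesis by simp
qed

lemma tau_fps: "Abs_fps tau * fps_sin (of_real pi) = fps_const (of_real pi) * fps_X"
proof -
  have 1: "(\<lambda>s. pi_sin s * sin (of_real pi * s)) has_fps_expansion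
             Abs_fps tau * fps_sin (of_real pi)"
    by (intro fps_expansion_intros pi_sin_has_fps_expansion)
  have 2: "(\<lambda>s :: complex. of_real pi * s) has_fps_expansion fps_const (of_real pi) * fps_X"
    by (intro fps_expansion_intros)
  have "eventually (\<lambda>s. s \<in> ball 0 (1 :: real)) (nhds (0 :: complex))"
    by (intro eventually_nhds_in_open) auto
  hence "eventually (\<lambda>s. pi_sin s * sin (of_real pi * s) = of_real pi * s) (nhds 0)"
    by eventually_elim (use sin_pi_nonzero in \<open>auto simp: pi_sin_def\<close>)
  hence "(\<lambda>s. of_real pi * s) has_fps_expansion Abs_fps tau * fps_sin (of_real pi)"
    using 1 by (subst (asm) has_fps_expansion_cong[OF _ refl])
  thus ?thesis using 2 by (rule fps_expansion_unique_complex)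
qed

lemma tau_0: "tau 0 = 1"
  using tau_sums'[of 0] by (simp add: pi_sin_def)

lemma tau_odd:
  assumes "odd m"
  shows "tau m = 0"
proof -
  have e: "pi_sin (- s) = pi_sin s" for s by (simp add: pi_sin_def)
  have 1: "(\<lambda>s. pi_sin (- s)) has_fps_expansion Abs_fps (\<lambda>m. (-1) ^ m * tau m)"
  proof -
    have "(\<lambda>s::complex. (-1) * s) has_fps_expansion fps_const (-1) * fps_X"
      by (intro fps_expansion_intros)
    hence "(\<lambda>s. pi_sin ((-1) * s)) has_fps_expansion
            fps_compose (Abs_fps tau) (fps_const (-1) * fps_X)"
      by (intro has_fps_expansion_compose[unfolded o_def, OF pi_sin_has_fps_expansion]) auto
    also have "fps_compose (Abs_fps tau) (fps_const (-1) * fps_X) =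
                 Abs_fps (\<lambda>m. (-1) ^ m * tau m)"
      by (subst fps_compose_linear) simp
    finally show ?thesis by simp
  qed
  have "Abs_fps (\<lambda>m. (-1) ^ m * tau m) = Abs_fps tau"
    using 1[unfolded e] pi_sin_has_fps_expansion by (rule fps_expansion_unique_complex)
  hence "(-1) ^ m * tau m = tau m" by (metis fps_nth_Abs_fps)
  thus ?thesis using assms by simp
qed

lemma tau_sums:
  assumes "norm s < 1"
  shows "(\<lambda>n. tau (2 * n) * s ^ (2 * n)) sums pi_sin s"
proof -
  have "strict_mono (\<lambda>n::nat. 2 * n)" by (simp add: strict_mono_def)
  hence "(\<lambda>n. tau (2 * n) * s ^ (2 * n)) sums pi_sin s \<longleftrightarrow> (\<lambda>m. tau m * s ^ m) sums pi_sin s"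
  proof (rule sums_mono_reindex)
    fix m :: nat
    assume "m \<notin> range (\<lambda>n. 2 * n)"
    hence "odd m" unfolding dvd_def by blast
    thus "tau m * s ^ m = 0" by (simp add: tau_odd)
  qed
  thus ?thesis using tau_sums'[OF assms] by simp
qed

lemma tau_2: "tau 2 = of_real (pi ^ 2 / 6)"
proof -
  define S :: "complex fps" where "S = fps_sin (of_real pi)"
  have S: "fps_nth S 0 = 0" "fps_nth S (Suc 0) = of_real pi" "fps_nth S 2 = 0"
          "fps_nth S 3 = - (of_real pi ^ 3 / 6)"
    by (simp_all add: S_def fps_sin_def fact_numeral)
  have "fps_nth (Abs_fps tau * S) 3 = 0"
    unfolding S_def tau_fps by (simp add: numeral_3_eq_3)
  also have "fps_nth (Abs_fps tau * S) 3 =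
      tau 0 * fps_nth S 3 + tau 1 * fps_nth S 2 + tau 2 * fps_nth S (Suc 0) + tau 3 * fps_nth S 0"
    by (simp add: fps_mult_nth numeral_3_eq_3 numeral_2_eq_2)
  finally have "tau 2 * of_real pi = of_real pi ^ 3 / 6"
    by (simp add: S tau_0 algebra_simps)
  thus ?thesis by (simp add: power3_eq_cube power2_eq_square field_simps)
qed

end

theory Submission
  imports Defs "HOL-Probability.Sinc_Integral" "HOL-Real_Asymp.Real_Asymp"
begin

text \<open>
  For part (i), moving the line of integration one unit to the left crosses one pole of
  \<open>\<pi> / sin (\<pi> s)\<close>, whose residue is one term of the series. After \<open>n\<close> such steps the substitution
  \<open>s \<mapsto> s - n\<close> brings the integral back to the original line, now with the factor \<open>exp (- n \<eta>)\<close>, since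
  Kummer's function stays bounded in left half-planes by Euler's integral.

  For part (ii), \<open>E(\<eta>)\<close> is exponentially small, so only the algebraic part has to be found. The line is
  deformed into the two rays \<open>1/\<eta> - |v| + i v\<close>, on which \<open>exp (\<eta> s)\<close> decays exponentially and
  \<open>f\<^sub>2(s)\<close> differs from the partial sum \<open>\<Sum>\<^sub>n\<^sub><\<^sub>N a\<^sub>n s\<^sup>n\<close> by at most \<open>C |s|\<^sup>N\<close>: near \<open>0\<close> by the power
  series, elsewhere since \<open>f\<^sub>2\<close> is bounded there. Scaling by \<open>\<eta>\<close> gives the remainder estimate, and the
  terms of the partial sum become Hankel's integral for \<open>1 / \<Gamma>(q + 5/2 - n)\<close>.
\<close>

subsection \<open>Kummer's function\<close>

text \<open>The negative real axis carries poles of \<open>pi_sin\<close> and the branch cut of the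
  power of \<open>s\<close>, so in part (ii) the contour is only bent, inside a half-plane slit
  along that axis. Rays of slope one keep \<open>|Im s|\<close> comparable with \<open>|s|\<close>,
  so the exponential decay of \<open>1 / sin (\<pi> s)\<close> absorbs any power of
  \<open>|s|\<close>. Such powers do occur: Euler's integral, which serves part (i), does not apply
  to the Kummer function of \<open>f2\<close>, whose parameters \<open>-1/2\<close> and
  \<open>- q - 1/2\<close> are both negative. Contiguous relations raise the parameters until it
  does; each costs a factor \<open>z\<close>, so that boundedness turns into polynomial growth. The
  exponents \<open>q + 5/2 - n\<close> in Hankel's integral become arbitrarily negative. The wedge
  integral converges for all of them, but its value is first found on a vertical line, for exponents
  at least 2, and then carried down by integration by parts. All infinite contours are Lebesgue
  integrals over a real parameter, compared through a primitive on a starlike domain or through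
  rectangles of growing height.\<close>

definition kummer_fps :: "complex \<Rightarrow> complex \<Rightarrow> complex fps" where
  "kummer_fps a b = Abs_fps (\<lambda>k. pochhammer a k / (pochhammer b k * fact k))"

lemma kummer_conv_eval_fps: "kummer a b z = eval_fps (kummer_fps a b) z"
  by (simp add: kummer_def kummer_fps_def eval_fps_def mult_ac)

lemma add_of_nat_nonzero: "(b :: complex) \<notin> \<int>\<^sub>\<le>\<^sub>0 \<Longrightarrow> b + of_nat k \<noteq> 0"
  by (metis add_eq_0_iff2 minus_of_nat_in_nonpos_Ints)

lemma add_of_nat_not_nonpos_Int: "(b :: complex) \<notin> \<int>\<^sub>\<le>\<^sub>0 \<Longrightarrow> b + of_nat k \<notin> \<int>\<^sub>\<le>\<^sub>0"
  using nonpos_Ints_diff_Nats[of "b + of_nat k" "of_nat k"] by auto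

lemma pochhammer_nonzero: "(b :: complex) \<notin> \<int>\<^sub>\<le>\<^sub>0 \<Longrightarrow> pochhammer b k \<noteq> 0"
  using add_of_nat_nonzero by (fastforce simp: pochhammer_eq_0_iff)

lemma kummer_fps_Suc:
  assumes "b \<notin> \<int>\<^sub>\<le>\<^sub>0"
  shows "fps_nth (kummer_fps a b) (Suc k) =
           (a + of_nat k) / (b + of_nat k) / of_nat (Suc k) * fps_nth (kummer_fps a b) k"
  by (simp add: kummer_fps_def pochhammer_Suc field_simps del: of_nat_Suc)

lemma conv_radius_kummer_fps:
  assumes "b \<notin> \<int>\<^sub>\<le>\<^sub>0"
  shows "fps_conv_radius (kummer_fps a b) = \<infinity>"
  unfolding fps_conv_radius_def
proof (rule conv_radius_inftyI'')
  fix z :: complex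
  let ?f = "\<lambda>k. fps_nth (kummer_fps a b) k * z ^ k"
  have "(\<lambda>k. (a + of_nat k) / (b + of_nat k) / of_nat (Suc k) * z) \<longlonglongrightarrow> 0"
  proof -
    have *: "(\<lambda>k. 1 / of_nat (Suc k) :: complex) \<longlonglongrightarrow> 0"
      using LIMSEQ_Suc[OF lim_1_over_n[where 'a = complex]] by simp
    have "(\<lambda>k. c / of_nat (Suc k) :: complex) \<longlonglongrightarrow> 0" for c
      using tendsto_mult[OF tendsto_const[of c] *] by simp
    hence c: "(\<lambda>k. c / of_nat (Suc k) + 1 :: complex) \<longlonglongrightarrow> 0 + 1" for c
      by (intro tendsto_intros)
    \<comment> \<open>Numerator and denominator of \<open>(a + k) / (b + k)\<close> are divided by
      \<open>k + 1\<close>, using \<open>a + k = (a - 1) + (k + 1)\<close>, so that only limits of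
      \<open>c / (k + 1)\<close> enter.\<close>
    have "(\<lambda>k. ((a - 1) / of_nat (Suc k) + 1) / ((b - 1) / of_nat (Suc k) + 1) * (1 / of_nat (Suc k)) * z)
            \<longlonglongrightarrow> (0 + 1) / (0 + 1) * 0 * z"
      by (intro tendsto_intros * c) auto
    moreover have "((a - 1) / of_nat (Suc k) + 1) / ((b - 1) / of_nat (Suc k) + 1) =
                   (a + of_nat k) / (b + of_nat k)" for k
    proof -
      have e: "(c - 1) / of_nat (Suc k) + 1 = (c + of_nat k) / of_nat (Suc k)" for c :: complex
      proof -
        have "(c - 1) / of_nat (Suc k) + 1 = (c - 1 + of_nat (Suc k)) / of_nat (Suc k)"
          by (simp add: add_divide_distrib del: of_nat_Suc)
        thus ?thesis by simp
      qed
      have "of_nat (Suc k) \<noteq> (0 :: complex)" by (simp del: of_nat_Suc)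
      thus ?thesis unfolding e by (simp del: of_nat_Suc)
    qed
    ultimately show ?thesis by (simp only: mult_zero_right mult_zero_left) (simp del: of_nat_Suc)
  qed
  from tendsto_norm[OF this]
  have "\<forall>\<^sub>F k in sequentially. norm ((a + of_nat k) / (b + of_nat k) / of_nat (Suc k) * z) < 1/2"
    by (intro order_tendstoD) auto
  then obtain N where N: "\<And>k. k \<ge> N \<Longrightarrow>
      norm ((a + of_nat k) / (b + of_nat k) / of_nat (Suc k) * z) < 1/2"
    by (auto simp: eventually_sequentially)
  show "summable ?f"
  proof (rule summable_ratio_test[of "1/2" N])
    fix k assume "N \<le> k"
    have "?f (Suc k) = ((a + of_nat k) / (b + of_nat k) / of_nat (Suc k) * z) * ?f k"
      by (simp add: kummer_fps_Suc[OF assms] mult_ac)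
    also have "norm \<dots> \<le> 1/2 * norm (?f k)"
      unfolding norm_mult[of "_ * z" "_ * z ^ k"] using N[OF \<open>N \<le> k\<close>] by (intro mult_right_mono) auto
    finally show "norm (?f (Suc k)) \<le> 1/2 * norm (?f k)" .
  qed auto
qed

lemma kummer_sums:
  assumes "b \<notin> \<int>\<^sub>\<le>\<^sub>0"
  shows "(\<lambda>k. fps_nth (kummer_fps a b) k * z ^ k) sums kummer a b z"
  unfolding kummer_conv_eval_fps using sums_eval_fps[of z "kummer_fps a b"] conv_radius_kummer_fps[OF assms] by simp

lemma holomorphic_on_kummer [holomorphic_intros]:
  assumes "b \<notin> \<int>\<^sub>\<le>\<^sub>0" "g holomorphic_on S"
  shows "(\<lambda>z. kummer a b (g z)) holomorphic_on S"
proof -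
  have "kummer a b holomorphic_on UNIV"
    unfolding kummer_conv_eval_fps[abs_def] using conv_radius_kummer_fps[OF assms(1)]
    by (intro holomorphic_intros) auto
  from holomorphic_on_compose_gen[OF assms(2) this] show ?thesis by (simp add: o_def)
qed

lemma kummer_has_fps_expansion:
  assumes "b \<notin> \<int>\<^sub>\<le>\<^sub>0"
  shows "(\<lambda>s. kummer a b (c * s)) has_fps_expansion
           Abs_fps (\<lambda>k. c ^ k * fps_nth (kummer_fps a b) k)"
proof -
  have 1: "kummer a b has_fps_expansion kummer_fps a b"
    unfolding kummer_conv_eval_fps[abs_def] using conv_radius_kummer_fps[OF assms]
    by (intro eval_fps_has_fps_expansion) simp
  have "(\<lambda>s::complex. c * s) has_fps_expansion fps_const c * fps_X"
    by (intro fps_expansion_intros)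
  hence "(\<lambda>s. kummer a b (c * s)) has_fps_expansion fps_compose (kummer_fps a b) (fps_const c * fps_X)"
    by (intro has_fps_expansion_compose[unfolded o_def, OF 1]) auto
  thus ?thesis by (simp add: fps_compose_linear)
qed

text \<open>Comparing coefficients of \<open>z ^ Suc k\<close> reduces this to
  \<open>(a)_(k+1) - (a-1)_(k+1) = (k+1) (a)_k\<close> for Pochhammer symbols. It trades the upper
  parameter -1/2 of \<open>f2\<close> for 1/2, which is positive.\<close>

lemma kummer_contiguous_a:
  assumes "b \<notin> \<int>\<^sub>\<le>\<^sub>0"
  shows "kummer (a - 1) b z = kummer a b z - z / b * kummer a (b + 1) z"
proof -
  have nz: "b \<noteq> 0" "b + 1 \<notin> \<int>\<^sub>\<le>\<^sub>0"
    using add_of_nat_nonzero[OF assms, of 0] add_of_nat_not_nonpos_Int[OF assms, of 1] by auto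
  have "(\<lambda>k. (z / b) * (fps_nth (kummer_fps a (b + 1)) k * z ^ k)) sums (z / b * kummer a (b + 1) z)"
    by (intro sums_mult kummer_sums nz)
  moreover have "(z / b) * (fps_nth (kummer_fps a (b + 1)) k * z ^ k) =
      fps_nth (kummer_fps a b) (Suc k) * z ^ Suc k - fps_nth (kummer_fps (a - 1) b) (Suc k) * z ^ Suc k" for k
  proof -
    have p: "pochhammer (b + 1) k \<noteq> 0" "of_nat (Suc k) \<noteq> (0 :: complex)"
      using pochhammer_nonzero[OF nz(2)] by (simp_all del: of_nat_Suc)
    have "fps_nth (kummer_fps a b) (Suc k) - fps_nth (kummer_fps (a - 1) b) (Suc k) =
       (pochhammer a (Suc k) - pochhammer (a - 1) (Suc k)) / (pochhammer b (Suc k) * fact (Suc k))"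
      by (simp add: kummer_fps_def diff_divide_distrib)
    also have "pochhammer a (Suc k) - pochhammer (a - 1) (Suc k) = of_nat (Suc k) * pochhammer a k"
      by (subst pochhammer_rec[of "a - 1"]) (simp add: pochhammer_Suc algebra_simps)
    also have "of_nat (Suc k) * pochhammer a k / (pochhammer b (Suc k) * fact (Suc k)) =
                 fps_nth (kummer_fps a (b + 1)) k / b"
      using nz p by (simp add: kummer_fps_def pochhammer_rec del: of_nat_Suc)
    finally show ?thesis by (simp add: algebra_simps diff_divide_distrib)
  qed
  ultimately have "(\<lambda>k. fps_nth (kummer_fps a b) (Suc k) * z ^ Suc k -
                      fps_nth (kummer_fps (a - 1) b) (Suc k) * z ^ Suc k)
      sums (z / b * kummer a (b + 1) z)" by (simp only:)
  \<comment> \<open>Both series have constant term 1, so term 0 of the difference vanishes and the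
    shifted sum is the full one.\<close>
  hence "(\<lambda>k. fps_nth (kummer_fps a b) k * z ^ k -  fps_nth (kummer_fps (a - 1) b) k * z ^ k)
      sums (z / b * kummer a (b + 1) z)"
    by (subst (asm) sums_Suc_iff) (simp add: kummer_fps_def)
  moreover have "(\<lambda>k. fps_nth (kummer_fps a b) k * z ^ k - fps_nth (kummer_fps (a - 1) b) k * z ^ k)
      sums (kummer a b z - kummer (a - 1) b z)"
    by (intro sums_diff kummer_sums assms)
  ultimately show ?thesis by (metis add_diff_cancel_left' diff_add_cancel sums_unique2)
qed

text \<open>Coefficientwise this is
  \<open>1 / (b)_(k+1) - 1 / (b+1)_(k+1) = (k+1) / (b)_(k+2)\<close>. In both functions on the right
  the gap between lower and upper parameter is larger by one than on the left, so finitely many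
  applications reach the range of Euler's integral.\<close>

lemma kummer_contiguous_b:
  assumes "b \<notin> \<int>\<^sub>\<le>\<^sub>0"
  shows "kummer a b z = kummer a (b + 1) z + a * z / (b * (b + 1)) * kummer (a + 1) (b + 2) z"
proof -
  have nz: "b \<noteq> 0" "b + 1 \<notin> \<int>\<^sub>\<le>\<^sub>0" "b + 1 \<noteq> 0" "b + 2 \<notin> \<int>\<^sub>\<le>\<^sub>0"
    using add_of_nat_nonzero[OF assms, of 0] add_of_nat_nonzero[OF assms, of 1]
      add_of_nat_not_nonpos_Int[OF assms, of 1] add_of_nat_not_nonpos_Int[OF assms, of 2] by auto
  let ?c = "a * z / (b * (b + 1))"
  have "(\<lambda>k. ?c * (fps_nth (kummer_fps (a + 1) (b + 2)) k * z ^ k)) sums (?c * kummer (a + 1) (b + 2) z)"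
    by (intro sums_mult kummer_sums nz)
  moreover have "?c * (fps_nth (kummer_fps (a + 1) (b + 2)) k * z ^ k) =
      fps_nth (kummer_fps a b) (Suc k) * z ^ Suc k - fps_nth (kummer_fps a (b + 1)) (Suc k) * z ^ Suc k" for k
  proof -
    define P where "P = pochhammer (b + 2) k"
    have p: "P \<noteq> 0" "of_nat (Suc k) \<noteq> (0 :: complex)" "b + 1 + of_nat k \<noteq> 0"
      using pochhammer_nonzero[OF nz(4)] add_of_nat_nonzero[OF nz(2)] by (simp_all add: P_def del: of_nat_Suc)
    have b1: "pochhammer (b + 1) (Suc k) = (b + 1) * P"
      by (simp add: pochhammer_rec P_def add.assoc)
    have "(b + 1 + of_nat k) * pochhammer b (Suc k) = b * pochhammer (b + 1) (Suc k)"
      by (simp add: pochhammer_rec[of b] pochhammer_Suc[of "b + 1"])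
    hence b0: "pochhammer b (Suc k) = b * (b + 1) * P / (b + 1 + of_nat k)"
      unfolding b1 using p by (simp add: field_simps)
    have "fps_nth (kummer_fps a b) (Suc k) - fps_nth (kummer_fps a (b + 1)) (Suc k) =
       pochhammer a (Suc k) / fact (Suc k) * (1 / pochhammer b (Suc k) - 1 / pochhammer (b + 1) (Suc k))"
      by (simp add: kummer_fps_def right_diff_distrib mult.commute del: fact_Suc)
    also have "1 / pochhammer b (Suc k) - 1 / pochhammer (b + 1) (Suc k) =
                 of_nat (Suc k) / (b * (b + 1) * P)"
    proof -
      have "1 / ((b + 1) * P) = b / (b * (b + 1) * P)" using nz by simp
      thus ?thesis unfolding b0 b1 divide_divide_eq_right by (simp only: diff_divide_distrib [symmetric]) simp
    qed
    also have "pochhammer a (Suc k) / fact (Suc k) * (of_nat (Suc k) / (b * (b + 1) * P)) =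
                 fps_nth (kummer_fps (a + 1) (b + 2)) k * a / (b * (b + 1))"
      using nz p by (simp add: kummer_fps_def pochhammer_rec P_def mult_ac del: of_nat_Suc)
    finally show ?thesis by (simp add: algebra_simps diff_divide_distrib)
  qed
  ultimately have "(\<lambda>k. fps_nth (kummer_fps a b) (Suc k) * z ^ Suc k -
                      fps_nth (kummer_fps a (b + 1)) (Suc k) * z ^ Suc k)
      sums (?c * kummer (a + 1) (b + 2) z)" by (simp only:)
  hence "(\<lambda>k. fps_nth (kummer_fps a b) k * z ^ k -  fps_nth (kummer_fps a (b + 1)) k * z ^ k)
      sums (?c * kummer (a + 1) (b + 2) z)"
    by (subst (asm) sums_Suc_iff) (simp add: kummer_fps_def)
  moreover have "(\<lambda>k. fps_nth (kummer_fps a b) k * z ^ k - fps_nth (kummer_fps a (b + 1)) k * z ^ k)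
      sums (kummer a b z - kummer a (b + 1) z)"
    by (intro sums_diff kummer_sums assms nz)
  ultimately have "?c * kummer (a + 1) (b + 2) z = kummer a b z - kummer a (b + 1) z"
    by (rule sums_unique2)
  thus ?thesis by (metis diff_add_cancel add.commute)
qed

section \<open>Bounds for Kummer's function in left half-planes\<close>

lemma Beta_add_of_nat_left:
  fixes a c :: real
  assumes "a > 0" "c > 0"
  shows "Beta (a + real k) c = pochhammer a k / pochhammer (a + c) k * Beta a c"
proof (induction k)
  case (Suc k)
  have "a + real k \<notin> \<int>\<^sub>\<le>\<^sub>0" using assms by (intro notI) (auto elim!: nonpos_Ints_cases)
  from Beta_plus1_left[OF this, of c] have "(a + real k + c) * Beta (a + real (Suc k)) c = (a + real k) * Beta (a + real k) c"
    by (simp add: add_ac)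
  hence "Beta (a + real (Suc k)) c = (a + real k) / (a + c + real k) * Beta (a + real k) c"
    using assms by (simp add: field_simps)
  thus ?case unfolding Suc.IH by (simp add: pochhammer_Suc mult_ac)
qed simp

text \<open>Euler's integral: \<open>Beta a (b - a)\<close> times the function is the integral of
  \<open>exp (z t)\<close> against the nonnegative weight \<open>t^(a-1) (1-t)^(b-a-1)\<close> on
  the unit interval. There the exponential has modulus at most \<open>exp (max 0 (Re z))\<close>,
  and the total mass of the weight is \<open>Beta a (b - a)\<close>, which cancels. The
  representation itself comes from expanding the exponential and integrating term by term.\<close>

lemma norm_kummer_le:
  fixes a b :: real
  assumes "0 < a" "a < b"
  shows "norm (kummer (of_real a) (of_real b) z) \<le> exp (max 0 (Re z))"
proof -
  define w where "w = (\<lambda>t::real. indicator {0..1} t * (t powr (a - 1) * (1 - t) powr (b - a - 1)))"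
  define f where "f = (\<lambda>k t. of_real (w t) * (z * of_real t) ^ k / fact k)"
  define B where "B = Beta a (b - a)"
  have w0: "w t \<ge> 0" for t by (simp add: w_def)
  have wz: "w t = 0" if "t \<notin> {0..1}" for t using that by (simp add: w_def)
  have meas [measurable]: "w \<in> borel_measurable borel" unfolding w_def by measurable
  \<comment> \<open>These moments of Euler's weight produce the quotient of Pochhammer symbols in
    the Kummer series.\<close>
  have moment: "integrable lborel (\<lambda>t. t ^ k * w t)" "(LINT t|lborel. t ^ k * w t) = Beta (a + real k) (b - a)" for k
  proof -
    have e: "t ^ k * w t = indicator {0..1} t *\<^sub>R (t powr (a + real k - 1) * (1 - t) powr (b - a - 1))" for t
    proof (cases "t > 0")
      case True
      have "t powr (a + real k - 1) = t powr (a - 1) * t ^ k"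
        using powr_add[of t "a - 1" "real k"] powr_realpow[OF True, of k] by (simp add: add_diff_eq add_ac)
      thus ?thesis by (simp add: w_def indicator_def)
    qed (auto simp: w_def indicator_def)
    have i: "set_integrable lborel {0..1} (\<lambda>t. t powr (a + real k - 1) * (1 - t) powr (b - a - 1))"
      by (rule integrable_Beta) (use assms in auto)
    show "integrable lborel (\<lambda>t. t ^ k * w t)"
      using i unfolding e set_integrable_def .
    have "(LINT t:{0..1}|lborel. t powr (a + real k - 1) * (1 - t) powr (b - a - 1)) =
             integral {0..1} (\<lambda>t. t powr (a + real k - 1) * (1 - t) powr (b - a - 1))"
      by (rule set_borel_integral_eq_integral(2)[OF i])
    also have "\<dots> = Beta (a + real k) (b - a)"
      by (intro integral_unique has_integral_Beta_real) (use assms in auto)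
    finally show "(LINT t|lborel. t ^ k * w t) = Beta (a + real k) (b - a)"
      unfolding e set_lebesgue_integral_def .
  qed
  have B: "integrable lborel w" "(LINT t|lborel. w t) = B" using moment[of 0] by (simp_all add: B_def)
  have Bpos: "B > 0" unfolding B_def Beta_def using assms by (intro divide_pos_pos mult_pos_pos) (auto intro!: Gamma_real_pos)
  have feq: "f k t = z ^ k / fact k * of_real (t ^ k * w t)" for k t
    by (simp add: f_def power_mult_distrib)
  have fi: "integrable lborel (f k)" for k
    unfolding feq by (intro integrable_mult_right integrable_of_real moment)
  \<comment> \<open>On the unit interval \<open>t ^ k\<close> is at most 1; this separates
    \<open>k\<close> from \<open>t\<close> in the majorant and justifies exchanging sum and
    integral.\<close>
  have nf: "norm (f k t) \<le> norm z ^ k / fact k * w t" for k t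
  proof (cases "t \<in> {0..1}")
    case True
    hence "t ^ k * w t \<le> 1 * w t" by (intro mult_right_mono power_le_one w0) auto
    hence "norm z ^ k / fact k * (t ^ k * w t) \<le> norm z ^ k / fact k * w t"
      by (intro mult_left_mono) auto
    thus ?thesis using True w0[of t]
      by (simp add: feq norm_mult norm_power norm_divide abs_mult del: of_real_mult of_real_power)
  qed (simp add: feq wz)
  have suf: "(\<lambda>k. f k t) sums (of_real (w t) * exp (z * of_real t))" for t
    using sums_mult[OF exp_converges[of "z * of_real t"], of "of_real (w t)"]
    by (simp add: f_def scaleR_conv_of_real divide_simps mult_ac)
  have sn: "summable (\<lambda>k. norm z ^ k / fact k)" using summable_exp[of "norm z"] by (simp add: divide_simps mult_ac)
  have "(\<lambda>k. LINT t|lborel. f k t) sums (LINT t|lborel. (\<Sum>k. f k t))"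
  proof (rule sums_integral[OF fi])
    show "AE t in lborel. summable (\<lambda>k. norm (f k t))"
    proof (intro always_eventually allI)
      fix t show "summable (\<lambda>k. norm (f k t))"
        by (rule summable_comparison_test'[where g = "\<lambda>k. norm z ^ k / fact k * w t" and N = 0])
           (simp_all only: real_norm_def abs_norm_cancel nf summable_mult2[OF sn])
    qed
    show "summable (\<lambda>k. LINT t|lborel. norm (f k t))"
    proof (rule summable_comparison_test'[where g = "\<lambda>k. norm z ^ k / fact k * B" and N = 0])
      show "summable (\<lambda>k. norm z ^ k / fact k * B)" by (intro summable_mult2 sn)
      fix k :: nat
      have "(LINT t|lborel. norm (f k t)) \<le> (LINT t|lborel. norm z ^ k / fact k * w t)"
        by (intro integral_mono integrable_norm fi integrable_mult_right B nf)
      thus "norm (LINT t|lborel. norm (f k t)) \<le> norm z ^ k / fact k * B"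
        by (simp add: B)
    qed
  qed
  also have "(\<lambda>k. LINT t|lborel. f k t) = (\<lambda>k. of_real B * (fps_nth (kummer_fps (of_real a) (of_real b)) k * z ^ k))"
  proof
    fix k
    have "(LINT t|lborel. f k t) = z ^ k / fact k * of_real (LINT t|lborel. t ^ k * w t)"
      unfolding feq by (simp del: of_real_mult)
    also have "(LINT t|lborel. t ^ k * w t) = pochhammer a k / pochhammer b k * B"
      unfolding moment B_def using assms by (subst Beta_add_of_nat_left) auto
    finally show "(LINT t|lborel. f k t) = of_real B * (fps_nth (kummer_fps (of_real a) (of_real b)) k * z ^ k)"
      by (simp add: kummer_fps_def pochhammer_of_real mult_ac)
  qed
  finally have "(\<lambda>k. of_real B * (fps_nth (kummer_fps (of_real a) (of_real b)) k * z ^ k)) sums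
                  (LINT t|lborel. of_real (w t) * exp (z * of_real t))"
    using suf by (simp add: sums_iff)
  moreover have "(of_real b :: complex) \<notin> \<int>\<^sub>\<le>\<^sub>0"
    using assms by (auto simp: of_real_in_nonpos_Ints_iff dest!: nonpos_Ints_nonpos)
  hence "(\<lambda>k. of_real B * (fps_nth (kummer_fps (of_real a) (of_real b)) k * z ^ k)) sums
                  (of_real B * kummer (of_real a) (of_real b) z)"
    by (intro sums_mult kummer_sums)
  ultimately have eq: "of_real B * kummer (of_real a) (of_real b) z = (LINT t|lborel. of_real (w t) * exp (z * of_real t))"
    by (rule sums_unique2[symmetric])
  have bd: "norm (of_real (w t) * exp (z * of_real t)) \<le> w t * exp (max 0 (Re z))" for t
  proof (cases "t \<in> {0..1}")
    case True
    have "Re z * t \<le> max 0 (Re z) * t" using True by (intro mult_right_mono) auto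
    also have "\<dots> \<le> max 0 (Re z) * 1" using True by (intro mult_left_mono) auto
    finally show ?thesis using w0[of t] by (auto simp: norm_mult intro!: mult_left_mono)
  qed (simp add: wz)
  have "B * norm (kummer (of_real a) (of_real b) z) = norm (LINT t|lborel. of_real (w t) * exp (z * of_real t))"
    using Bpos by (simp add: eq[symmetric] norm_mult)
  also have "\<dots> \<le> (LINT t|lborel. norm (of_real (w t) * exp (z * of_real t)))"
    by (rule integral_norm_bound)
  also have "\<dots> \<le> (LINT t|lborel. w t * exp (max 0 (Re z)))"
  proof (rule integral_mono)
    show "integrable lborel (\<lambda>t. w t * exp (max 0 (Re z)))" by (intro integrable_mult_left B)
    show "integrable lborel (\<lambda>t. norm (of_real (w t) * exp (z * of_real t)))"
      by (rule Bochner_Integration.integrable_bound[OF \<open>integrable lborel (\<lambda>t. w t * exp (max 0 (Re z)))\<close>])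
         (use bd w0 in \<open>auto simp: abs_mult\<close>)
  qed (rule bd)
  also have "\<dots> = B * exp (max 0 (Re z))" by (simp add: B)
  finally show ?thesis using Bpos by simp
qed

text \<open>The induction variable \<open>m\<close> bounds how often
  \<open>kummer_contiguous_b\<close> has to be applied before \<open>a < b\<close> holds and Euler's
  integral gives a bound; every application may raise the degree through its factor
  \<open>z\<close>.\<close>

lemma kummer_poly_bound_pos:
  fixes a b R :: real
  assumes "a > 0" "of_real b \<notin> (\<int>\<^sub>\<le>\<^sub>0 :: complex set)" "a < b + real m"
  shows "\<exists>C n. \<forall>z. Re z \<le> R \<longrightarrow> norm (kummer (of_real a) (of_real b) z) \<le> C * (1 + norm z) ^ n"
  using assms
proof (induction m arbitrary: a b)
  case 0
  have "norm (kummer (of_real a) (of_real b) z) \<le> exp (max 0 R) * (1 + norm z) ^ 0" if "Re z \<le> R" for z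
    using norm_kummer_le[of a b z] 0 that by (auto intro: order_trans)
  thus ?case by blast
next
  case (Suc m)
  have nz: "of_real (b + 1) \<notin> (\<int>\<^sub>\<le>\<^sub>0 :: complex set)" "of_real (b + 2) \<notin> (\<int>\<^sub>\<le>\<^sub>0 :: complex set)"
    using add_of_nat_not_nonpos_Int[OF Suc.prems(2), of 1] add_of_nat_not_nonpos_Int[OF Suc.prems(2), of 2] by auto
  obtain C1 n1 where 1: "\<And>z. Re z \<le> R \<Longrightarrow> norm (kummer (of_real a) (of_real (b + 1)) z) \<le> C1 * (1 + norm z) ^ n1"
    using Suc.IH[of a "b + 1"] Suc.prems nz by auto
  obtain C2 n2 where 2: "\<And>z. Re z \<le> R \<Longrightarrow> norm (kummer (of_real (a + 1)) (of_real (b + 2)) z) \<le> C2 * (1 + norm z) ^ n2"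
    using Suc.IH[of "a + 1" "b + 2"] Suc.prems nz by auto
  define D where "D = norm (of_real a / (of_real b * (of_real b + 1)) :: complex)"
  have "norm (kummer (of_real a) (of_real b) z) \<le> (\<bar>C1\<bar> + D * \<bar>C2\<bar>) * (1 + norm z) ^ (n1 + n2 + 1)" if "Re z \<le> R" for z
  proof -
    have le: "(1 + norm z) ^ i \<le> (1 + norm z) ^ j" if "i \<le> j" for i j
      using that by (intro power_increasing) auto
    have "kummer (of_real a) (of_real b) z = kummer (of_real a) (of_real (b + 1)) z +
       of_real a / (of_real b * (of_real b + 1)) * z * kummer (of_real (a + 1)) (of_real (b + 2)) z"
      using kummer_contiguous_b[OF Suc.prems(2), of "of_real a" z] by simp
    also have "norm \<dots> \<le> norm (kummer (of_real a) (of_real (b + 1)) z) +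
         D * (norm z * norm (kummer (of_real (a + 1)) (of_real (b + 2)) z))"
      unfolding D_def by (rule order_trans[OF norm_triangle_ineq]) (simp only: norm_mult mult.assoc order_refl)
    also have "\<dots> \<le> \<bar>C1\<bar> * (1 + norm z) ^ n1 + D * ((1 + norm z) * (\<bar>C2\<bar> * (1 + norm z) ^ n2))"
    proof (intro add_mono mult_left_mono mult_mono)
      show "norm (kummer (of_real a) (of_real (b + 1)) z) \<le> \<bar>C1\<bar> * (1 + norm z) ^ n1"
        using 1[OF that] by (rule order_trans) (auto intro!: mult_right_mono)
      show "norm (kummer (of_real (a + 1)) (of_real (b + 2)) z) \<le> \<bar>C2\<bar> * (1 + norm z) ^ n2"
        using 2[OF that] by (rule order_trans) (auto intro!: mult_right_mono)
    qed (auto simp: D_def)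
    also have "\<dots> = \<bar>C1\<bar> * (1 + norm z) ^ n1 + D * \<bar>C2\<bar> * (1 + norm z) ^ (Suc n2)"
      by (simp add: algebra_simps)
    also have "\<dots> \<le> \<bar>C1\<bar> * (1 + norm z) ^ (n1 + n2 + 1) + D * \<bar>C2\<bar> * (1 + norm z) ^ (n1 + n2 + 1)"
      by (intro add_mono mult_left_mono le) (auto simp: D_def)
    finally show ?thesis by (simp add: algebra_simps)
  qed
  thus ?case by blast
qed

text \<open>Meant for \<open>a = 1/2\<close>: the upper parameter -1/2 is lifted once, and both
  resulting functions have a positive upper parameter.\<close>

lemma kummer_poly_bound_lower:
  fixes a b R :: real
  assumes "a > 0" "of_real b \<notin> (\<int>\<^sub>\<le>\<^sub>0 :: complex set)"
  shows "\<exists>C n. \<forall>z. Re z \<le> R \<longrightarrow> norm (kummer (of_real (a - 1)) (of_real b) z) \<le> C * (1 + norm z) ^ n"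
proof -
  have nz: "of_real (b + 1) \<notin> (\<int>\<^sub>\<le>\<^sub>0 :: complex set)"
    using add_of_nat_not_nonpos_Int[OF assms(2), of 1] by auto
  obtain m :: nat where m: "a - b < real m" using reals_Archimedean2 by blast
  obtain C1 n1 where 1: "\<And>z. Re z \<le> R \<Longrightarrow> norm (kummer (of_real a) (of_real b) z) \<le> C1 * (1 + norm z) ^ n1"
    using kummer_poly_bound_pos[of a b m] assms nz m by fastforce
  obtain C2 n2 where 2: "\<And>z. Re z \<le> R \<Longrightarrow> norm (kummer (of_real a) (of_real (b + 1)) z) \<le> C2 * (1 + norm z) ^ n2"
    using kummer_poly_bound_pos[of a "b + 1" m] assms nz m by fastforce
  define D where "D = norm (1 / of_real b :: complex)"
  have "norm (kummer (of_real (a - 1)) (of_real b) z) \<le> (\<bar>C1\<bar> + D * \<bar>C2\<bar>) * (1 + norm z) ^ (n1 + n2 + 1)" if "Re z \<le> R" for z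
  proof -
    have le: "(1 + norm z) ^ i \<le> (1 + norm z) ^ j" if "i \<le> j" for i j
      using that by (intro power_increasing) auto
    have "kummer (of_real (a - 1)) (of_real b) z = kummer (of_real a) (of_real b) z -
       1 / of_real b * z * kummer (of_real a) (of_real (b + 1)) z"
      using kummer_contiguous_a[OF assms(2), of "of_real a" z] by simp
    also have "norm \<dots> \<le> norm (kummer (of_real a) (of_real b) z) +
         D * (norm z * norm (kummer (of_real a) (of_real (b + 1)) z))"
      unfolding D_def by (rule order_trans[OF norm_triangle_ineq4]) (simp only: norm_mult mult.assoc order_refl)
    also have "\<dots> \<le> \<bar>C1\<bar> * (1 + norm z) ^ n1 + D * ((1 + norm z) * (\<bar>C2\<bar> * (1 + norm z) ^ n2))"
    proof (intro add_mono mult_left_mono mult_mono)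
      show "norm (kummer (of_real a) (of_real b) z) \<le> \<bar>C1\<bar> * (1 + norm z) ^ n1"
        using 1[OF that] by (rule order_trans) (auto intro!: mult_right_mono)
      show "norm (kummer (of_real a) (of_real (b + 1)) z) \<le> \<bar>C2\<bar> * (1 + norm z) ^ n2"
        using 2[OF that] by (rule order_trans) (auto intro!: mult_right_mono)
    qed (auto simp: D_def)
    also have "\<dots> = \<bar>C1\<bar> * (1 + norm z) ^ n1 + D * \<bar>C2\<bar> * (1 + norm z) ^ (Suc n2)"
      by (simp add: algebra_simps)
    also have "\<dots> \<le> \<bar>C1\<bar> * (1 + norm z) ^ (n1 + n2 + 1) + D * \<bar>C2\<bar> * (1 + norm z) ^ (n1 + n2 + 1)"
      by (intro add_mono mult_left_mono le) (auto simp: D_def)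
    finally show ?thesis by (simp add: algebra_simps)
  qed
  thus ?thesis by blast
qed

subsection \<open>Integrals along infinite curves\<close>

lemma integrable_inverse_1_plus_square': "integrable lborel (\<lambda>t::real. C / (1 + t ^ 2))"
  using integrable_mult_right[OF integrable_inverse_1_plus_square[unfolded set_integrable_def], of C]
  by (simp add: divide_inverse)

lemma integrable_inverse_square_bound:
  fixes f :: "real \<Rightarrow> complex"
  assumes "f \<in> borel_measurable lborel" "\<And>t. norm (f t) \<le> C / (1 + t ^ 2)"
  shows "integrable lborel f"
  using integrable_inverse_1_plus_square'[of C] assms(1)
proof (rule Bochner_Integration.integrable_bound, intro AE_I2)
  fix t show "norm (f t) \<le> norm (C / (1 + t\<^sup>2))"
    using assms(2)[of t] by (rule order_trans) (simp only: real_norm_def abs_ge_self)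
qed

text \<open>The bridge from Lebesgue integrals over the whole line to gauge integrals over compact
  intervals, where the fundamental theorem of calculus and the rectangle formula are
  available.\<close>

lemma tendsto_integral_symmetric:
  fixes f :: "real \<Rightarrow> complex"
  assumes "integrable lborel f"
  shows "((\<lambda>T. integral {-T..T} f) \<longlongrightarrow> (LINT t|lborel. f t)) at_top"
proof -
  have m [measurable]: "f \<in> borel_measurable lborel" using assms by auto
  have "((\<lambda>T. LINT t|lborel. indicator {-T..T} t *\<^sub>R f t) \<longlongrightarrow> (LINT t|lborel. f t)) at_top"
  proof (rule integral_dominated_convergence_at_top[where w = "\<lambda>t. norm (f t)"])
    show "integrable lborel (\<lambda>t. norm (f t))" using assms by (rule integrable_norm)
    have "((\<lambda>T. indicator {-T..T} t *\<^sub>R f t) \<longlongrightarrow> f t) at_top" for t :: real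
      by (rule tendsto_eventually, rule eventually_mono[OF eventually_ge_at_top[of "\<bar>t\<bar>"]])
         (auto simp: indicator_def)
    thus "AE t in lborel. ((\<lambda>T. indicator {-T..T} t *\<^sub>R f t) \<longlongrightarrow> f t) at_top" by simp
  qed (auto simp: indicator_def)
  moreover have "(LINT t|lborel. indicator {-T..T} t *\<^sub>R f t) = integral {-T..T} f" for T
  proof -
    have "set_integrable lborel {-T..T} f"
      unfolding set_integrable_def by (intro integrable_mult_indicator assms) auto
    from set_borel_integral_eq_integral(2)[OF this] show ?thesis
      by (simp add: set_lebesgue_integral_def)
  qed
  ultimately show ?thesis by simp
qed

text \<open>The finite set \<open>K\<close> allows for corners, such as the tip of the wedge: the
  strong form of the fundamental theorem asks there only for continuity.\<close>

lemma curve_integral_primitive: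
  fixes \<gamma> \<gamma>' :: "real \<Rightarrow> complex"
  assumes P: "\<And>z. z \<in> S \<Longrightarrow> (P has_field_derivative g z) (at z)"
    and \<gamma>: "continuous_on UNIV \<gamma>" "\<And>t. \<gamma> t \<in> S" "finite K"
      "\<And>t. t \<notin> K \<Longrightarrow> (\<gamma> has_vector_derivative \<gamma>' t) (at t)"
    and int: "integrable lborel (\<lambda>t. g (\<gamma> t) * \<gamma>' t)"
  shows "((\<lambda>T. P (\<gamma> T) - P (\<gamma> (-T))) \<longlongrightarrow> (LINT t|lborel. g (\<gamma> t) * \<gamma>' t)) at_top"
proof -
  have "continuous_on S P"
    by (intro continuous_at_imp_continuous_on ballI DERIV_isCont[OF P])
  hence cont: "continuous_on A (\<lambda>t. P (\<gamma> t))" for A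
    by (rule continuous_on_compose2[of S P, OF _ continuous_on_subset[OF \<gamma>(1)]]) (use \<gamma>(2) in auto)
  have "integral {-T..T} (\<lambda>t. g (\<gamma> t) * \<gamma>' t) = P (\<gamma> T) - P (\<gamma> (-T))" if "T \<ge> 0" for T
  proof (rule integral_unique, rule fundamental_theorem_of_calculus_strong[OF \<gamma>(3)])
    fix t assume "t \<in> {-T..T} - K"
    hence "(\<gamma> has_vector_derivative \<gamma>' t) (at t)" using \<gamma>(4) by auto
    from field_vector_diff_chain_at[OF this P[OF \<gamma>(2)]]
    show "((\<lambda>t. P (\<gamma> t)) has_vector_derivative g (\<gamma> t) * \<gamma>' t) (at t)"
      by (simp add: o_def mult.commute)
  qed (use that cont in auto)
  hence "eventually (\<lambda>T. integral {-T..T} (\<lambda>t. g (\<gamma> t) * \<gamma>' t) = P (\<gamma> T) - P (\<gamma> (-T))) at_top"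
    by (intro eventually_mono[OF eventually_ge_at_top[of 0]]) auto
  thus ?thesis by (rule Lim_transform_eventually[OF tendsto_integral_symmetric[OF int]])
qed

text \<open>Both integrals are limits of differences of the same primitive \<open>P\<close>. Ends
  with equal parameter are joined by a segment along which \<open>P\<close> changes by at most the
  supremum of \<open>|g|\<close> times the length, and \<open>e\<close> makes this product tend to
  zero.\<close>

lemma curve_integral_deform:
  fixes \<gamma> \<gamma>' \<delta> \<delta>' :: "real \<Rightarrow> complex"
  assumes P: "\<And>z. z \<in> S \<Longrightarrow> (P has_field_derivative g z) (at z)"
    and \<gamma>: "continuous_on UNIV \<gamma>" "\<And>t. \<gamma> t \<in> S" "finite K"
      "\<And>t. t \<notin> K \<Longrightarrow> (\<gamma> has_vector_derivative \<gamma>' t) (at t)"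
      "integrable lborel (\<lambda>t. g (\<gamma> t) * \<gamma>' t)"
    and \<delta>: "continuous_on UNIV \<delta>" "\<And>t. \<delta> t \<in> S" "finite L"
      "\<And>t. t \<notin> L \<Longrightarrow> (\<delta> has_vector_derivative \<delta>' t) (at t)"
      "integrable lborel (\<lambda>t. g (\<delta> t) * \<delta>' t)"
    and seg: "\<And>t. \<bar>t\<bar> \<ge> 1 \<Longrightarrow> closed_segment (\<delta> t) (\<gamma> t) \<subseteq> S"
    and bound: "\<And>t z. \<bar>t\<bar> \<ge> 1 \<Longrightarrow> z \<in> closed_segment (\<delta> t) (\<gamma> t) \<Longrightarrow> norm (g z) * norm (\<gamma> t - \<delta> t) \<le> e \<bar>t\<bar>"
    and e: "(e \<longlongrightarrow> 0) at_top"
  shows "(LINT t|lborel. g (\<gamma> t) * \<gamma>' t) = (LINT t|lborel. g (\<delta> t) * \<delta>' t)"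
proof -
  have b: "norm (P (\<gamma> t) - P (\<delta> t)) \<le> e \<bar>t\<bar>" if "\<bar>t\<bar> \<ge> 1" for t
  proof (cases "\<gamma> t = \<delta> t")
    case True
    thus ?thesis using bound[OF that, of "\<gamma> t"] by simp
  next
    case False
    hence pos: "norm (\<gamma> t - \<delta> t) > 0" by simp
    have "norm (P (\<gamma> t) - P (\<delta> t)) \<le> (e \<bar>t\<bar> / norm (\<gamma> t - \<delta> t)) * norm (\<gamma> t - \<delta> t)"
    proof (rule field_differentiable_bound[of "closed_segment (\<delta> t) (\<gamma> t)" P g])
      fix z assume z: "z \<in> closed_segment (\<delta> t) (\<gamma> t)"
      show "(P has_field_derivative g z) (at z within closed_segment (\<delta> t) (\<gamma> t))"
        using P seg[OF that] z by (blast intro: has_field_derivative_at_within)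
      show "norm (g z) \<le> e \<bar>t\<bar> / norm (\<gamma> t - \<delta> t)"
        using bound[OF that z] pos by (simp add: field_simps)
    qed auto
    thus ?thesis using pos by simp
  qed
  have "((\<lambda>T. (P (\<gamma> T) - P (\<gamma> (-T))) - (P (\<delta> T) - P (\<delta> (-T)))) \<longlongrightarrow>
         (LINT t|lborel. g (\<gamma> t) * \<gamma>' t) - (LINT t|lborel. g (\<delta> t) * \<delta>' t)) at_top"
    by (intro tendsto_diff curve_integral_primitive[OF P \<gamma>] curve_integral_primitive[OF P \<delta>])
  moreover have "((\<lambda>T. (P (\<gamma> T) - P (\<gamma> (-T))) - (P (\<delta> T) - P (\<delta> (-T)))) \<longlongrightarrow> 0) at_top"
  proof (rule Lim_null_comparison)
    show "((\<lambda>T. e T + e T) \<longlongrightarrow> 0) at_top" using tendsto_add[OF e e] by simp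
    show "\<forall>\<^sub>F T in at_top. norm ((P (\<gamma> T) - P (\<gamma> (-T))) - (P (\<delta> T) - P (\<delta> (-T)))) \<le> e T + e T"
    proof (rule eventually_mono[OF eventually_ge_at_top[of 1]])
      fix T :: real assume T: "T \<ge> 1"
      have "norm ((P (\<gamma> T) - P (\<gamma> (-T))) - (P (\<delta> T) - P (\<delta> (-T)))) =
            norm ((P (\<gamma> T) - P (\<delta> T)) - (P (\<gamma> (-T)) - P (\<delta> (-T))))" by (simp add: algebra_simps)
      also have "\<dots> \<le> norm (P (\<gamma> T) - P (\<delta> T)) + norm (P (\<gamma> (-T)) - P (\<delta> (-T)))"
        by (rule norm_triangle_ineq4)
      also have "\<dots> \<le> e T + e T" using b[of T] b[of "-T"] T by (intro add_mono) auto
      finally show "norm ((P (\<gamma> T) - P (\<gamma> (-T))) - (P (\<delta> T) - P (\<delta> (-T)))) \<le> e T + e T" .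
    qed
  qed
  ultimately show ?thesis using tendsto_unique[OF trivial_limit_at_top_linorder] by fastforce
qed

lemma nonpos_Reals_complex_eq: "(\<real>\<^sub>\<le>\<^sub>0 :: complex set) = complex_of_real ` {..0}"
  by (auto simp: nonpos_Reals_def)

text \<open>The slit half-plane is starlike about the point \<open>R/2\<close>: a segment from a
  positive real point meets the nonpositive axis only if its other end lies on it.\<close>

lemma slit_half_plane_primitive:
  assumes "R > 0" and "g holomorphic_on {z. Re z < R} - \<real>\<^sub>\<le>\<^sub>0"
  shows "\<exists>P. \<forall>z \<in> {z. Re z < R} - \<real>\<^sub>\<le>\<^sub>0. (P has_field_derivative g z) (at z)"
proof (rule holomorphic_starlike_primitive[where k = "{}"])
  let ?S = "{z. Re z < R} - \<real>\<^sub>\<le>\<^sub>0 :: complex set"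
  show op: "open ?S"
    by (intro open_Diff open_halfspace_Re_lt closed_nonpos_Reals_complex)
  show "continuous_on ?S g" using assms(2) by (rule holomorphic_on_imp_continuous_on)
  show "g field_differentiable at x" if "x \<in> ?S - {}" for x
    using assms(2) op that by (auto simp: holomorphic_on_open field_differentiable_def)
  show "starlike ?S" unfolding starlike_def
  proof (rule bexI[of _ "of_real (R/2)"], intro ballI)
    show "of_real (R/2) \<in> ?S" using assms(1) by (simp add: complex_nonpos_Reals_iff)
  next
    fix z assume z: "z \<in> ?S"
    have "closed_segment (of_real (R/2)) z \<subseteq> {z. Re z < R}"
      using assms z by (intro closed_segment_subset convex_halfspace_Re_lt) auto
    moreover have "closed_segment (of_real (R/2)) z \<subseteq> - \<real>\<^sub>\<le>\<^sub>0"
      using starlike_slotted_complex_plane_left_aux[of z 0 "R/2"] assms z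
      by (simp add: nonpos_Reals_complex_eq)
    ultimately show "closed_segment (of_real (R/2)) z \<subseteq> ?S" by blast
  qed
qed auto

text \<open>Vertical sides appear as integrals over a real interval, ready for
  \<open>tendsto_integral_symmetric\<close>; horizontal sides stay contour integrals, because they
  will only be estimated, for which the two integrability claims are recorded.\<close>

lemma rectangle_Cauchy_formula:
  fixes x1 x2 y1 y2 :: real
  assumes "convex S" "open S" "h holomorphic_on S" "cbox (Complex x1 y1) (Complex x2 y2) \<subseteq> S"
    and z: "z \<in> box (Complex x1 y1) (Complex x2 y2)" and f_def: "f = (\<lambda>s. h s / (s - z))"
  shows "contour_integral (linepath (Complex x1 y1) (Complex x2 y1)) f
       + \<i> * integral {y1..y2} (\<lambda>t. f (Complex x2 t))
       + contour_integral (linepath (Complex x2 y2) (Complex x1 y2)) f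
       - \<i> * integral {y1..y2} (\<lambda>t. f (Complex x1 t)) = 2 * of_real pi * \<i> * h z"
    and "f contour_integrable_on linepath (Complex x1 y1) (Complex x2 y1)"
    and "f contour_integrable_on linepath (Complex x2 y2) (Complex x1 y2)"
proof -
  let ?a1 = "Complex x1 y1" and ?a2 = "Complex x2 y1" and ?a3 = "Complex x2 y2" and ?a4 = "Complex x1 y2"
  have less: "x1 < x2" "y1 < y2" using z by (auto simp: in_box_complex_iff)
  have pim: "path_image (rectpath ?a1 ?a3) \<subseteq> cbox ?a1 ?a3 - {z}"
    using path_image_rectpath_cbox_minus_box[of ?a1 ?a3] less z by auto
  have img: "path_image (rectpath ?a1 ?a3) =
      closed_segment ?a1 ?a2 \<union> closed_segment ?a2 ?a3 \<union> closed_segment ?a3 ?a4 \<union> closed_segment ?a4 ?a1"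
    by (simp add: rectpath_def Let_def path_image_join Un_assoc)
  have "(f has_contour_integral (2 * pi * \<i> * winding_number (rectpath ?a1 ?a3) z * h z)) (rectpath ?a1 ?a3)"
    unfolding f_def using assms(1-5) pim box_subset_cbox[of ?a1 ?a3]
    by (intro Cauchy_integral_formula_convex_simple[of S]) (auto simp: interior_open)
  also have "winding_number (rectpath ?a1 ?a3) z = 1" using z by (rule winding_number_rectpath)
  finally have 1: "contour_integral (rectpath ?a1 ?a3) f = 2 * pi * \<i> * h z"
    by (simp add: contour_integral_unique)
  have cont: "continuous_on (cbox ?a1 ?a3 - {z}) f"
    unfolding f_def using assms(3,4)
    by (intro continuous_intros holomorphic_on_imp_continuous_on[OF holomorphic_on_subset[OF assms(3)]]) auto
  have ci: "f contour_integrable_on linepath a b" if "closed_segment a b \<subseteq> cbox ?a1 ?a3 - {z}" for a b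
    using that by (intro contour_integrable_continuous_linepath continuous_on_subset[OF cont])
  have ci': "f contour_integrable_on linepath ?a1 ?a2" "f contour_integrable_on linepath ?a2 ?a3"
      "f contour_integrable_on linepath ?a3 ?a4" "f contour_integrable_on linepath ?a4 ?a1"
    using pim unfolding img by (auto intro!: ci)
  thus "f contour_integrable_on linepath ?a1 ?a2" "f contour_integrable_on linepath ?a3 ?a4" by auto
  have "contour_integral (rectpath ?a1 ?a3) f = contour_integral (linepath ?a1 ?a2) f +
      contour_integral (linepath ?a2 ?a3) f + contour_integral (linepath ?a3 ?a4) f +
      contour_integral (linepath ?a4 ?a1) f"
    unfolding rectpath_def Let_def using ci' by (simp add: contour_integrable_joinI add_ac)
  also have "contour_integral (linepath ?a2 ?a3) f = \<i> * integral {y1..y2} (\<lambda>t. f (Complex x2 t))"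
    using less by (intro contour_integral_linepath_same_Re) auto
  also have "contour_integral (linepath ?a4 ?a1) f = - contour_integral (linepath ?a1 ?a4) f"
    by (subst contour_integral_reversepath[symmetric]) auto
  also have "contour_integral (linepath ?a1 ?a4) f = \<i> * integral {y1..y2} (\<lambda>t. f (Complex x1 t))"
    using less by (intro contour_integral_linepath_same_Re) auto
  finally show "contour_integral (linepath ?a1 ?a2) f
       + \<i> * integral {y1..y2} (\<lambda>t. f (Complex x2 t))
       + contour_integral (linepath ?a3 ?a4) f
       - \<i> * integral {y1..y2} (\<lambda>t. f (Complex x1 t)) = 2 * of_real pi * \<i> * h z"
    using 1 by simp
qed

text \<open>The horizontal sides of the rectangle keep the fixed length \<open>b - a\<close>, so
  plain decay of \<open>f\<close> in the height suffices to discard them. The bound is demanded only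
  above the height of the pole, which lets \<open>e\<close> be singular there.\<close>

lemma vertical_integral_cross_pole:
  assumes "convex S" "open S" "h holomorphic_on S" "{s. a \<le> Re s \<and> Re s \<le> b} \<subseteq> S"
    and z: "a < Re z" "Re z < b" and f_def: "f = (\<lambda>s. h s / (s - z))"
    and int: "integrable lborel (\<lambda>t. f (Complex a t))" "integrable lborel (\<lambda>t. f (Complex b t))"
    and bound: "\<And>s. a \<le> Re s \<Longrightarrow> Re s \<le> b \<Longrightarrow> \<bar>Im s\<bar> > \<bar>Im z\<bar> \<Longrightarrow> norm (f s) \<le> e \<bar>Im s\<bar>"
    and e: "(e \<longlongrightarrow> 0) at_top"
  shows "vertical_integral b f - vertical_integral a f = 2 * of_real pi * \<i> * h z"
proof -
  have vi: "vertical_integral x f = \<i> * (LINT t|lborel. f (Complex x t))" for x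
    by (simp add: vertical_integral_def mult.commute)
  let ?H = "\<lambda>T. contour_integral (linepath (Complex a (-T)) (Complex b (-T))) f +
                contour_integral (linepath (Complex b T) (Complex a T)) f"
  let ?V = "\<lambda>T. \<i> * integral {-T..T} (\<lambda>t. f (Complex b t)) - \<i> * integral {-T..T} (\<lambda>t. f (Complex a t))"
  have sub: "cbox (Complex a (-T)) (Complex b T) \<subseteq> S" for T
    using assms(4) by (auto simp: in_cbox_complex_iff)
  have zb: "z \<in> box (Complex a (-T)) (Complex b T)" if "T > \<bar>Im z\<bar>" for T
    using z that by (auto simp: in_box_complex_iff)
  note rect = rectangle_Cauchy_formula[OF assms(1-3) sub zb f_def]
  have "(?V \<longlongrightarrow> vertical_integral b f - vertical_integral a f) at_top"
    unfolding vi by (intro tendsto_intros tendsto_integral_symmetric int)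
  moreover have "(?H \<longlongrightarrow> 0) at_top"
  proof (rule Lim_null_comparison)
    show "((\<lambda>T. e T * (b - a) + e T * (b - a)) \<longlongrightarrow> 0) at_top"
      by (rule tendsto_eq_intros e | simp)+
    show "\<forall>\<^sub>F T in at_top. norm (?H T) \<le> e T * (b - a) + e T * (b - a)"
    proof (rule eventually_mono[OF eventually_gt_at_top[of "\<bar>Im z\<bar>"]])
      fix T assume T: "T > \<bar>Im z\<bar>"
      hence T0: "T > 0" by linarith
      have "norm (f (Complex a T)) \<le> e T" using bound[of "Complex a T"] T z by simp
      hence e0: "e T \<ge> 0" by (rule order_trans[OF norm_ge_zero])
      have le: "norm (f s) \<le> e T" if "a \<le> Re s" "Re s \<le> b" "\<bar>Im s\<bar> = T" for s
        using bound[of s] that T by simp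
      have lo: "norm (f s) \<le> e T" if "s \<in> closed_segment (Complex a (-T)) (Complex b (-T))" for s
        using that z T0 by (intro le) (auto simp: closed_segment_same_Im closed_segment_eq_real_ivl)
      have hi: "norm (f s) \<le> e T" if "s \<in> closed_segment (Complex b T) (Complex a T)" for s
        using that z T0 by (intro le) (auto simp: closed_segment_same_Im closed_segment_eq_real_ivl)
      have "norm (contour_integral (linepath (Complex a (-T)) (Complex b (-T))) f) \<le>
              e T * norm (Complex b (-T) - Complex a (-T))"
        by (intro contour_integral_bound_linepath rect e0 T lo)
      moreover have "norm (contour_integral (linepath (Complex b T) (Complex a T)) f) \<le>
              e T * norm (Complex a T - Complex b T)"
        by (intro contour_integral_bound_linepath rect e0 T hi)
      moreover have "norm (Complex b (-T) - Complex a (-T)) = b - a" "norm (Complex a T - Complex b T) = b - a"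
        using z by (simp_all add: cmod_eq_Re)
      ultimately show "norm (?H T) \<le> e T * (b - a) + e T * (b - a)"
        by (intro order_trans[OF norm_triangle_ineq] add_mono) simp_all
    qed
  qed
  ultimately have "((\<lambda>T. ?V T + ?H T) \<longlongrightarrow> vertical_integral b f - vertical_integral a f + 0) at_top"
    by (rule tendsto_add)
  moreover have "\<forall>\<^sub>F T in at_top. ?V T + ?H T = 2 * of_real pi * \<i> * h z"
  proof (rule eventually_mono[OF eventually_gt_at_top[of "\<bar>Im z\<bar>"]])
    fix T assume "T > \<bar>Im z\<bar>"
    from rect(1)[OF this] show "?V T + ?H T = 2 * of_real pi * \<i> * h z" by (simp add: algebra_simps)
  qed
  hence "((\<lambda>T. ?V T + ?H T) \<longlongrightarrow> 2 * of_real pi * \<i> * h z) at_top"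
    by (rule tendsto_eventually)
  ultimately have "vertical_integral b f - vertical_integral a f + 0 = 2 * of_real pi * \<i> * h z"
    by (rule tendsto_unique[OF trivial_limit_at_top_linorder])
  thus ?thesis by simp
qed

subsection \<open>The poles of the cosecant kernel\<close>

lemma sin_pi_eq_0_imp_Ints:
  assumes "sin (of_real pi * s) = (0 :: complex)"
  shows "s \<in> \<int>"
proof -
  obtain n :: int where "of_real pi * s = of_real (of_int n * pi)"
    using assms unfolding sin_eq_0 by (auto simp: mult.commute)
  hence "s = of_int n" by simp
  thus ?thesis by simp
qed

text \<open>The reverse triangle inequality for the two exponentials of the sine, whose moduli are
  \<open>exp (- Im z)\<close> and \<open>exp (Im z)\<close>.\<close>

lemma norm_sin_ge:
  "norm (sin z :: complex) \<ge> (exp \<bar>Im z\<bar> - exp (-\<bar>Im z\<bar>)) / 2"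
proof -
  have "norm (sin z) = norm (exp (\<i> * z) - exp (- (\<i> * z))) / 2"
    by (simp add: sin_exp_eq norm_divide norm_mult)
  moreover have "\<bar>norm (exp (\<i> * z)) - norm (exp (- (\<i> * z)))\<bar> \<le> norm (exp (\<i> * z) - exp (- (\<i> * z)))"
    by (rule norm_triangle_ineq3)
  ultimately show ?thesis by (cases "Im z \<ge> 0") auto
qed

lemma pi_sin_div: "s \<notin> \<int> \<Longrightarrow> pi_sin s / s = of_real pi / sin (of_real pi * s)"
  by (auto simp: pi_sin_def)

lemma pi_sin_holomorphic_on:
  assumes "open S" "S \<inter> \<int> \<subseteq> {0}"
  shows "pi_sin holomorphic_on S"
proof -
  have "(\<lambda>s. of_real pi * s / sin (of_real pi * s)) holomorphic_on (S - {0})"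
    using assms(2) by (intro holomorphic_intros) (auto dest!: sin_pi_eq_0_imp_Ints)
  hence "pi_sin holomorphic_on (S - {0})"
    by (rule holomorphic_transform) (auto simp: pi_sin_def)
  hence "pi_sin holomorphic_on (S - {0}) \<union> ball 0 1"
    using assms(1) by (intro holomorphic_on_Un pi_sin_holomorphic) auto
  thus ?thesis by (rule holomorphic_on_subset) auto
qed

lemma exp_neg_pi_le: "exp (- pi * \<bar>t\<bar>) \<le> 1 / (1 + t ^ 2)"
proof -
  have "1 * \<bar>t\<bar>\<^sup>2 \<le> pi ^ 2 / 2 * \<bar>t\<bar>\<^sup>2"
    using power_mono[of 3 pi 2] pi_gt3 by (intro mult_right_mono) auto
  also have "1 + \<dots> \<le> 1 + pi * \<bar>t\<bar> + (pi * \<bar>t\<bar>)\<^sup>2 / 2"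
    by (simp add: power_mult_distrib)
  also have "\<dots> \<le> exp (pi * \<bar>t\<bar>)" by (rule exp_lower_Taylor_quadratic) simp
  finally have "1 + t ^ 2 \<le> exp (pi * \<bar>t\<bar>)" by simp
  moreover have "0 < 1 + t ^ 2" by (simp add: add_pos_nonneg)
  ultimately have "inverse (exp (pi * \<bar>t\<bar>)) \<le> inverse (1 + t ^ 2)" by (rule le_imp_inverse_le)
  thus ?thesis by (simp add: exp_minus divide_inverse)
qed

text \<open>The threshold 1/2 ensures that \<open>y = \<pi> |Im s|\<close> is at least 1, hence
  \<open>exp (-y)\<close> is at most half of \<open>exp y\<close>; this turns the bound
  \<open>(exp y - exp (-y)) / 2\<close> into \<open>exp y / 4\<close>.\<close>

lemma norm_sin_pi_ge:
  assumes "\<bar>Im s\<bar> \<ge> 1/2"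
  shows "norm (sin (of_real pi * s)) \<ge> exp (pi * \<bar>Im s\<bar>) / 4"
proof -
  let ?y = "pi * \<bar>Im s\<bar>"
  have y: "?y \<ge> 1" using mult_mono[of 2 pi "1/2" "\<bar>Im s\<bar>"] assms pi_gt3 by simp
  have "exp (- ?y) * 2 \<le> exp (-?y) * exp 1" using exp_ge_add_one_self[of 1] by (intro mult_left_mono) auto
  also have "\<dots> \<le> exp ?y" using y by (simp flip: exp_add)
  finally have "exp (-?y) \<le> exp ?y / 2" by simp
  thus ?thesis using norm_sin_ge[of "of_real pi * s"] by (simp add: abs_mult)
qed

lemma norm_pi_sin_le:
  assumes "\<bar>Im s\<bar> \<ge> 1/2"
  shows "norm (pi_sin s) \<le> 4 * pi * norm s * exp (- pi * \<bar>Im s\<bar>)"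
proof -
  have "s \<noteq> 0" using assms by auto
  hence "norm (pi_sin s) = pi * norm s / norm (sin (of_real pi * s))"
    by (simp add: pi_sin_def norm_mult norm_divide)
  also have "\<dots> \<le> pi * norm s / (exp (pi * \<bar>Im s\<bar>) / 4)"
  proof (intro divide_left_mono mult_pos_pos)
    show "0 < norm (sin (of_real pi * s))"
      by (rule less_le_trans[OF _ norm_sin_pi_ge[OF assms]]) simp
  qed (use norm_sin_pi_ge[OF assms] in auto)
  finally show ?thesis by (simp add: exp_minus field_simps)
qed

lemma integrable_line:
  fixes f :: "real \<Rightarrow> complex"
  assumes cont: "continuous_on UNIV f" and bound: "\<And>t. \<bar>t\<bar> \<ge> 1/2 \<Longrightarrow> norm (f t) \<le> D / (1 + t ^ 2)"
  shows "integrable lborel f"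
proof -
  have "compact (f ` {-1/2..1/2})"
    by (intro compact_continuous_image continuous_on_subset[OF cont]) auto
  hence "bounded (f ` {-1/2..1/2})" by (rule compact_imp_bounded)
  then obtain K where K': "\<forall>t\<in>{-1/2..1/2}. norm (f t) \<le> K" by (auto simp: bounded_iff)
  have K: "norm (f t) \<le> K" if "\<bar>t\<bar> \<le> 1/2" for t
    using that by (intro bspec[OF K']) (simp, linarith)
  show ?thesis
  proof (rule integrable_inverse_square_bound)
    show "f \<in> borel_measurable lborel" using cont by (simp add: borel_measurable_continuous_onI)
    fix t :: real
    have p: "1 + t ^ 2 > 0" by (simp add: add_pos_nonneg)
    \<comment> \<open>For \<open>|t| < 1/2\<close> the denominator \<open>1 + t ^ 2\<close> is at
      most 2, so the bound \<open>K\<close> on the compact middle piece becomes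
      \<open>2 * \<bar>K\<bar> / (1 + t ^ 2)\<close>.\<close>
    show "norm (f t) \<le> (2 * \<bar>K\<bar> + \<bar>D\<bar>) / (1 + t ^ 2)"
    proof (cases "\<bar>t\<bar> \<ge> 1/2")
      case True
      have "norm (f t) \<le> D / (1 + t ^ 2)" using bound[OF True] .
      also have "\<dots> \<le> (2 * \<bar>K\<bar> + \<bar>D\<bar>) / (1 + t ^ 2)" using p by (intro divide_right_mono) auto
      finally show ?thesis .
    next
      case False
      hence "t ^ 2 \<le> (1/2) ^ 2" by (subst abs_le_square_iff[symmetric]) auto
      hence "\<bar>K\<bar> * (1 + t ^ 2) \<le> \<bar>K\<bar> * 2" by (intro mult_left_mono) (auto simp: power2_eq_square)
      hence "\<bar>K\<bar> \<le> (2 * \<bar>K\<bar> + \<bar>D\<bar>) / (1 + t ^ 2)" using p by (simp add: field_simps)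
      thus ?thesis using K[of t] False by linarith
    qed
  qed
qed

lemma continuous_on_Complex_line:
  assumes "continuous_on S g" "\<And>t. Complex x t \<in> S"
  shows "continuous_on UNIV (\<lambda>t. g (Complex x t))"
proof -
  have "continuous_on UNIV (\<lambda>t. Complex x t)"
    unfolding Complex_eq by (intro continuous_intros)
  from continuous_on_compose2[OF assms(1) this] assms(2) show ?thesis by auto
qed

text \<open>All shifts in part (i) are reduced to this one strip, where the only pole of
  \<open>pi_sin s / s\<close> is at 0, with residue \<open>pi_sin 0 = 1\<close>. What varies from
  shift to shift is the entire factor \<open>H\<close>, bounded on the strip.\<close>

lemma pi_sin_step:
  fixes H :: "complex \<Rightarrow> complex" and c :: real
  assumes c: "0 < c" "c < 1" and H: "H holomorphic_on UNIV"
    and B: "\<And>s. c - 1 \<le> Re s \<Longrightarrow> Re s \<le> c \<Longrightarrow> norm (H s) \<le> B"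
  defines "f \<equiv> \<lambda>s. pi_sin s * H s / s"
  shows "integrable lborel (\<lambda>t. f (Complex c t))"
    and "vertical_integral c f - vertical_integral (c - 1) f = 2 * of_real pi * \<i> * H 0"
proof -
  define S where "S = {s. -1 < Re s} \<inter> {s. Re s < 1}"
  have S: "open S" "convex S"
    unfolding S_def by (auto intro!: open_Int open_halfspace_Re_gt open_halfspace_Re_lt convex_Int
        convex_halfspace_Re_gt convex_halfspace_Re_lt)
  have ints: "S \<inter> \<int> \<subseteq> {0}" by (auto simp: S_def elim!: Ints_cases)
  have hol: "(\<lambda>s. pi_sin s * H s) holomorphic_on S"
    by (intro holomorphic_intros pi_sin_holomorphic_on S ints holomorphic_on_subset[OF H]) auto
  have "B \<ge> 0" by (rule order_trans[OF norm_ge_zero B[of "of_real c"]]) auto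
  have fhol: "f holomorphic_on S - {0}"
    unfolding f_def by (intro holomorphic_on_divide holomorphic_on_subset[OF hol] holomorphic_on_ident) auto
  have int: "integrable lborel (\<lambda>t. f (Complex x t))" if x: "x \<in> {c - 1, c}" for x
  proof (rule integrable_line)
    show "continuous_on UNIV (\<lambda>t. f (Complex x t))"
      by (rule continuous_on_Complex_line[OF holomorphic_on_imp_continuous_on[OF fhol]])
         (use c x in \<open>auto simp: S_def complex_eq_iff\<close>)
    fix t :: real assume t: "\<bar>t\<bar> \<ge> 1/2"
    let ?s = "Complex x t"
    have s0: "norm ?s > 0" using t by (auto simp: complex_eq_iff)
    have "norm (f ?s) = norm (pi_sin ?s) * norm (H ?s) / norm ?s" by (simp add: f_def norm_mult norm_divide)
    also have "\<dots> \<le> (4 * pi * norm ?s * exp (- pi * \<bar>t\<bar>)) * B / norm ?s"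
      using norm_pi_sin_le[of ?s] B[of ?s] x t s0 by (intro divide_right_mono mult_mono) auto
    also have "\<dots> = 4 * pi * B * exp (- pi * \<bar>t\<bar>)" using s0 by (simp add: field_simps)
    also have "\<dots> \<le> 4 * pi * B * (1 / (1 + t ^ 2))"
      using \<open>B \<ge> 0\<close> exp_neg_pi_le[of t] by (intro mult_left_mono) auto
    finally show "norm (f ?s) \<le> 4 * pi * B / (1 + t ^ 2)" by simp
  qed
  show "integrable lborel (\<lambda>t. f (Complex c t))" by (rule int) simp
  \<comment> \<open>This is \<open>\<pi> B / sinh (\<pi> T)\<close>, from
    \<open>norm_sin_ge\<close>. It holds at every positive height, while the estimate
    \<open>norm_pi_sin_le\<close> requires height at least 1/2.\<close>
  define e where "e = (\<lambda>T. pi * B / ((exp (pi * T) - exp (- (pi * T))) / 2))"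
  have "vertical_integral c f - vertical_integral (c - 1) f = 2 * of_real pi * \<i> * (pi_sin 0 * H 0)"
  proof (rule vertical_integral_cross_pole[where S = S and e = e and f = f and z = 0 and h = "\<lambda>s. pi_sin s * H s"])
    show "(e \<longlongrightarrow> 0) at_top"
    proof -
      have "((\<lambda>T::real. 1 / ((exp (pi * T) - exp (- (pi * T))) / 2)) \<longlongrightarrow> 0) at_top"
        using pi_gt_zero by real_asymp
      from tendsto_mult[OF tendsto_const[of "pi * B"] this] show ?thesis by (simp add: e_def)
    qed
    fix s assume s: "c - 1 \<le> Re s" "Re s \<le> c" "\<bar>Im (0::complex)\<bar> < \<bar>Im s\<bar>"
    let ?d = "(exp (pi * \<bar>Im s\<bar>) - exp (- (pi * \<bar>Im s\<bar>))) / 2"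
    have "s \<notin> \<int>" using s by (auto elim!: Ints_cases)
    hence "f s = of_real pi / sin (of_real pi * s) * H s"
      unfolding pi_sin_div[OF \<open>s \<notin> \<int>\<close>, symmetric] by (simp add: f_def)
    hence "norm (f s) = pi * norm (H s) / norm (sin (of_real pi * s))"
      by (simp add: norm_mult norm_divide)
    also have "\<dots> \<le> pi * B / ?d"
    proof (intro frac_le mult_left_mono B s)
      show "?d \<le> norm (sin (of_real pi * s))" using norm_sin_ge[of "of_real pi * s"] by (simp add: abs_mult)
      show "0 < ?d" using s by (simp add: mult_less_0_iff)
    qed (use \<open>B \<ge> 0\<close> in auto)
    finally show "norm (f s) \<le> e \<bar>Im s\<bar>" by (simp add: e_def)
  qed (use c S hol in \<open>auto simp: f_def S_def intro: int[unfolded f_def]\<close>)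
  thus "vertical_integral c f - vertical_integral (c - 1) f = 2 * of_real pi * \<i> * H 0"
    by (simp add: pi_sin_def)
qed

text \<open>The sine changes sign under a shift by \<pi>; this is the source of the alternating
  signs in the series of part (i).\<close>

lemma pi_sin_shift:
  assumes "s \<notin> \<int>"
  shows "pi_sin (s - of_nat n) / (s - of_nat n) = (-1) ^ n * (pi_sin s / s)"
proof -
  have s': "s - of_nat n \<notin> \<int>" using assms by (metis Ints_add Ints_of_nat diff_add_cancel)
  have sn: "sin (of_nat n * of_real pi :: complex) = 0"
    by (metis of_real_0 of_real_mult of_real_of_nat_eq sin_npi sin_of_real)
  have cn: "cos (of_nat n * of_real pi :: complex) = (-1) ^ n"
    by (metis cos_npi cos_of_real of_real_1 of_real_minus of_real_mult of_real_of_nat_eq of_real_power)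
  have "sin (of_real pi * (s - of_nat n)) = sin (of_real pi * s - of_nat n * of_real pi)"
    by (simp add: algebra_simps)
  also have "\<dots> = (-1) ^ n * sin (of_real pi * s)"
    unfolding sin_diff sn cn by simp
  finally show ?thesis
    unfolding pi_sin_div[OF assms] pi_sin_div[OF s'] by (cases "even n") auto
qed

lemma vertical_integral_shift:
  "vertical_integral (c - real n) g = vertical_integral c (\<lambda>s. g (s - of_nat n))"
proof -
  have "Complex (c - real n) t = Complex c t - of_nat n" for t by (simp add: complex_eq_iff)
  thus ?thesis by (simp add: vertical_integral_def)
qed

lemma Complex_not_Ints: "x \<notin> \<int> \<Longrightarrow> Complex x t \<notin> \<int>"
  by (auto elim!: Ints_cases simp: complex_eq_iff)

lemma vertical_integral_cong:
  "(\<And>t. f (Complex c t) = g (Complex c t)) \<Longrightarrow> vertical_integral c f = vertical_integral c g"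
  by (simp add: vertical_integral_def)

lemma F1_sums:
  fixes q \<beta> c \<eta> :: real
  assumes "\<beta> > 0" and "q \<ge> 0" and c: "0 < c" "c < 1" and "\<eta> > 0"
  shows "(\<lambda>n. (-1) ^ n * of_real (exp (- real n * \<eta>))
          * kummer (of_real (q + 1)) (of_real (q + 5/2)) (of_real (- 2 * real n / \<beta>)))
        sums F1 c q \<eta> \<beta>"
proof -
  define K where "K = kummer (of_real (q + 1)) (of_real (q + 5/2))"
  define g where "g = (\<lambda>s. exp (of_real \<eta> * s) * f1 q \<beta> s / s)"
  \<comment> \<open>The entire factor of the integrand at \<open>s - n\<close>, together with the
    sign that \<open>pi_sin_shift\<close> splits off from the kernel.\<close>
  define H where "H = (\<lambda>n s. (-1) ^ n * exp (of_real \<eta> * (s - of_nat n)) * K (2 * (s - of_nat n) / of_real \<beta>))"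
  define V where "V = (\<lambda>n. vertical_integral (c - real n) g)"
  define tm where "tm = (\<lambda>n. (-1) ^ n * of_real (exp (- real n * \<eta>)) * K (of_real (- 2 * real n / \<beta>)))"
  have b: "of_real (q + 5/2) \<notin> (\<int>\<^sub>\<le>\<^sub>0 :: complex set)"
    using assms(2) unfolding of_real_in_nonpos_Ints_iff by (auto dest: nonpos_Ints_nonpos)
  have holH: "H n holomorphic_on UNIV" for n
    unfolding H_def K_def using assms(1) by (intro holomorphic_intros b) auto
  have boundK: "norm (K (2 * (s - of_nat n) / of_real \<beta>)) \<le> exp (2 * c / \<beta>)" if "Re s \<le> c" for s n
  proof -
    have "norm (K (2 * (s - of_nat n) / of_real \<beta>)) \<le> exp (max 0 (Re (2 * (s - of_nat n) / of_real \<beta>)))"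
      unfolding K_def using assms(2) by (intro norm_kummer_le) auto
    also have "Re (2 * (s - of_nat n) / of_real \<beta>) = 2 * (Re s - real n) / \<beta>" by simp
    also have "max 0 (2 * (Re s - real n) / \<beta>) \<le> 2 * c / \<beta>"
      using assms(1) c that by (auto simp: max_def divide_right_mono)
    finally show ?thesis by simp
  qed
  have boundH: "norm (H n s) \<le> exp (\<eta> * (c - real n)) * exp (2 * c / \<beta>)" if "Re s \<le> c" for s n
  proof -
    have "norm (H n s) = exp (\<eta> * (Re s - real n)) * norm (K (2 * (s - of_nat n) / of_real \<beta>))"
      by (simp add: H_def norm_mult norm_power)
    also have "\<dots> \<le> exp (\<eta> * (c - real n)) * exp (2 * c / \<beta>)"
      using that \<open>\<eta> > 0\<close> by (intro mult_mono boundK) auto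
    finally show ?thesis .
  qed
  have gH: "g (s - of_nat n) = pi_sin s * H n s / s" if "s \<notin> \<int>" for s n
  proof -
    have "g (s - of_nat n) = pi_sin (s - of_nat n) / (s - of_nat n) *
            (exp (of_real \<eta> * (s - of_nat n)) * K (2 * (s - of_nat n) / of_real \<beta>))"
      by (simp add: g_def f1_def K_def)
    thus ?thesis unfolding pi_sin_shift[OF that] H_def by simp
  qed
  have nint: "c \<notin> \<int>" "c - 1 \<notin> \<int>" using c by (auto elim!: Ints_cases)
  have Vn: "V n = vertical_integral c (\<lambda>s. pi_sin s * H n s / s)" for n
    unfolding V_def vertical_integral_shift
    by (rule vertical_integral_cong) (simp add: gH Complex_not_Ints nint)
  \<comment> \<open>The line at \<open>c - (n + 1)\<close> is read as a shift of
    \<open>c - 1\<close> by \<open>n\<close>, not of \<open>c\<close> by \<open>n + 1\<close>, so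
    that the same \<open>H n\<close> occurs on both sides of one step.\<close>
  have V1: "V (Suc n) = vertical_integral (c - 1) (\<lambda>s. pi_sin s * H n s / s)" for n
  proof -
    have "V (Suc n) = vertical_integral (c - 1 - real n) g" by (simp add: V_def algebra_simps)
    thus ?thesis unfolding vertical_integral_shift
      by (simp add: gH Complex_not_Ints nint cong: vertical_integral_cong)
  qed
  have step: "V n - V (Suc n) = 2 * of_real pi * \<i> * tm n" for n
  proof -
    have "V n - V (Suc n) = 2 * of_real pi * \<i> * H n 0"
      unfolding V1 Vn[of n] by (rule pi_sin_step(2)[OF c holH boundH])
    also have "H n 0 = tm n" by (simp add: H_def tm_def exp_of_real[symmetric] mult.commute)
    finally show ?thesis .
  qed
  have "V \<longlonglongrightarrow> 0"
  proof (rule Lim_null_comparison)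
    \<comment> \<open>On the fixed line at \<open>c\<close> the kernel is independent of
      \<open>n\<close>, and \<open>H n\<close> contributes the factor
      \<open>exp (\<eta> * (c - real n))\<close>; one integral \<open>J\<close> therefore serves all
      \<open>n\<close>.\<close>
    define J where "J = (LINT t|lborel. norm (pi_sin (Complex c t) / Complex c t))"
    have int1: "integrable lborel (\<lambda>t. pi_sin (Complex c t) / Complex c t)"
      using pi_sin_step(1)[OF c, of "\<lambda>_. 1" 1] by simp
    have "norm (V n) \<le> exp (\<eta> * (c - real n)) * exp (2 * c / \<beta>) * J" for n
    proof -
      have "norm (V n) = norm (LINT t|lborel. pi_sin (Complex c t) * H n (Complex c t) / Complex c t * \<i>)"
        by (simp add: Vn vertical_integral_def)
      also have "\<dots> \<le> (LINT t|lborel. exp (\<eta> * (c - real n)) * exp (2 * c / \<beta>) * norm (pi_sin (Complex c t) / Complex c t))"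
      proof (rule Bochner_Integration.integral_norm_bound_integral)
        show "integrable lborel (\<lambda>t. pi_sin (Complex c t) * H n (Complex c t) / Complex c t * \<i>)"
          using pi_sin_step(1)[OF c holH boundH] by (intro integrable_mult_left) auto
        show "integrable lborel (\<lambda>t. exp (\<eta> * (c - real n)) * exp (2 * c / \<beta>) * norm (pi_sin (Complex c t) / Complex c t))"
          by (intro integrable_mult_right integrable_norm int1)
        fix t
        have "norm (pi_sin (Complex c t) * H n (Complex c t) / Complex c t * \<i>) =
                norm (H n (Complex c t)) * norm (pi_sin (Complex c t) / Complex c t)"
          by (simp add: norm_mult norm_divide mult_ac)
        also have "\<dots> \<le> exp (\<eta> * (c - real n)) * exp (2 * c / \<beta>) * norm (pi_sin (Complex c t) / Complex c t)"
          by (intro mult_right_mono boundH) auto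
        finally show "norm (pi_sin (Complex c t) * H n (Complex c t) / Complex c t * \<i>) \<le> \<dots>" .
      qed
      finally show ?thesis by (simp add: J_def)
    qed
    thus "\<forall>\<^sub>F n in sequentially. norm (V n) \<le> exp (\<eta> * (c - real n)) * exp (2 * c / \<beta>) * J"
      by simp
    have "(\<lambda>n. exp (\<eta> * (c - real n))) \<longlonglongrightarrow> 0" using \<open>\<eta> > 0\<close> by real_asymp
    from tendsto_mult_left_zero[OF tendsto_mult_left_zero[OF this]]
    show "(\<lambda>n. exp (\<eta> * (c - real n)) * exp (2 * c / \<beta>) * J) \<longlonglongrightarrow> 0" .
  qed
  hence "(\<lambda>n. V n - V (Suc n)) sums (V 0 - 0)" by (rule telescope_sums')
  hence "(\<lambda>n. 1 / (2 * of_real pi * \<i>) * (2 * of_real pi * \<i> * tm n)) sums (1 / (2 * of_real pi * \<i>) * V 0)"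
    unfolding step by (intro sums_mult) simp
  hence "tm sums (1 / (2 * of_real pi * \<i>) * V 0)" by simp
  also have "1 / (2 * of_real pi * \<i>) * V 0 = F1 c q \<eta> \<beta>"
    by (simp add: F1_def V_def g_def)
  finally show ?thesis by (simp add: tm_def[abs_def] K_def)
qed

subsection \<open>Hankel's integral\<close>

text \<open>The parameter is the imaginary part, so points of the wedge and of a vertical line with
  the same parameter lie at the same height and are joined by a horizontal segment.\<close>

definition wedge :: "real \<Rightarrow> real \<Rightarrow> complex" where
  "wedge x v = Complex (x - \<bar>v\<bar>) v"

definition wedge' :: "real \<Rightarrow> complex" where
  "wedge' v = Complex (- sgn v) 1"

text \<open>The slit removes the branch cut of the principal power and also the poles of
  \<open>pi_sin\<close> at the negative integers; with \<open>R = 1\<close> the positive poles are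
  excluded as well.\<close>

abbreviation slit_half_plane :: "real \<Rightarrow> complex set" where
  "slit_half_plane R \<equiv> {z. Re z < R} - \<real>\<^sub>\<le>\<^sub>0"

lemma wedge_in_slit: "0 < x \<Longrightarrow> x < R \<Longrightarrow> wedge x v \<in> slit_half_plane R"
  by (auto simp: wedge_def complex_nonpos_Reals_iff)

lemma line_in_slit: "0 < x \<Longrightarrow> x < R \<Longrightarrow> Complex x v \<in> slit_half_plane R"
  by (auto simp: complex_nonpos_Reals_iff)

lemma continuous_wedge: "continuous_on UNIV (wedge x)"
  unfolding wedge_def[abs_def] Complex_eq by (intro continuous_intros)

lemma has_vector_derivative_wedge:
  assumes "v \<notin> {0}"
  shows "(wedge x has_vector_derivative wedge' v) (at v)"
proof -
  have "(abs has_real_derivative sgn v) (at v)"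
  proof (cases "v > 0")
    case True
    have "((\<lambda>v. v) has_real_derivative sgn v) (at v)" using True by (auto intro!: derivative_eq_intros)
    thus ?thesis
      by (rule has_field_derivative_transform_within_open[where S = "{0<..}"]) (use True in auto)
  next
    case False
    have "((\<lambda>v. -v) has_real_derivative sgn v) (at v)" using False assms by (auto intro!: derivative_eq_intros)
    thus ?thesis
      by (rule has_field_derivative_transform_within_open[where S = "{..<0}"]) (use False assms in auto)
  qed
  hence "((\<lambda>v. x - \<bar>v\<bar>) has_real_derivative (- sgn v)) (at v)"
    by (auto intro!: derivative_eq_intros)
  hence "((\<lambda>v. of_real (x - \<bar>v\<bar>) + \<i> * of_real v :: complex) has_vector_derivative (of_real (- sgn v) + \<i> * of_real 1)) (at v)"
    by (intro has_vector_derivative_add has_vector_derivative_mult_right has_vector_derivative_of_real)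
       (auto intro!: derivative_eq_intros simp: has_real_derivative_iff_has_vector_derivative)
  thus ?thesis by (simp add: wedge_def[abs_def] wedge'_def Complex_eq del: of_real_diff)
qed

lemma has_vector_derivative_line: "((\<lambda>t. Complex x t) has_vector_derivative \<i>) (at t)"
  unfolding Complex_eq by (auto intro!: derivative_eq_intros)

lemma continuous_line: "continuous_on UNIV (\<lambda>t. Complex x t)"
  unfolding Complex_eq by (intro continuous_intros)

lemma measurable_wedge' [measurable]: "wedge' \<in> borel_measurable borel"
  unfolding wedge'_def[abs_def] Complex_eq by measurable

lemma norm_wedge'_le: "norm (wedge' v) \<le> 2"
  using cmod_le[of "wedge' v"] by (auto simp: wedge'_def sgn_if split: if_splits)

text \<open>The lower bound holds because \<open>|v|\<close> and \<open>|1 - |v||\<close> cannot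
  both be less than 1/2. It keeps negative powers under control at the tip of the wedge.\<close>

lemma norm_wedge_bounds:
  "norm (wedge 1 v) \<ge> 1/2" "norm (wedge 1 v) \<le> 2 + 2 * \<bar>v\<bar>"
proof -
  show "norm (wedge 1 v) \<ge> 1/2"
    using abs_Re_le_cmod[of "wedge 1 v"] abs_Im_le_cmod[of "wedge 1 v"] by (auto simp: wedge_def)
  show "norm (wedge 1 v) \<le> 2 + 2 * \<bar>v\<bar>"
    using cmod_le[of "wedge 1 v"] by (auto simp: wedge_def)
qed

text \<open>Bounding \<open>y\<close> both from below and from above handles exponents of either
  sign at once; on the wedge the exponent \<open>real N - p\<close> changes sign with
  \<open>N\<close>.\<close>

lemma powr_le_of_bounds:
  fixes y B x :: real
  assumes "1 / B \<le> y" "y \<le> B" "B \<ge> 1"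
  shows "y powr x \<le> B powr \<bar>x\<bar>"
proof (cases "x \<ge> 0")
  case True
  thus ?thesis using assms by (auto intro!: powr_mono2 intro: order_trans[of 0 "1 / B"])
next
  case False
  have "y powr x \<le> (1 / B) powr x" using assms False by (intro powr_mono2') auto
  also have "\<dots> = B powr \<bar>x\<bar>" using assms False by (simp add: powr_divide powr_minus_divide)
  finally show ?thesis .
qed

lemma norm_wedge_powr_le: "norm (wedge 1 v) powr x \<le> (2 + 2 * \<bar>v\<bar>) powr \<bar>x\<bar>"
proof (rule powr_le_of_bounds)
  have "1 / (2 + 2 * \<bar>v\<bar>) \<le> 1 / 2" by (intro divide_left_mono) auto
  thus "1 / (2 + 2 * \<bar>v\<bar>) \<le> norm (wedge 1 v)" using norm_wedge_bounds(1)[of v] by linarith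
qed (use norm_wedge_bounds(2)[of v] in auto)

lemma exp_weight_bound: "\<exists>C. \<forall>v::real. exp (1 - \<bar>v\<bar>) * (2 + 2 * \<bar>v\<bar>) powr k \<le> C / (1 + v ^ 2)"
proof -
  define f where "f = (\<lambda>y::real. (1 + y ^ 2) * (exp (1 - y) * (2 + 2 * y) powr k))"
  have "(f \<longlongrightarrow> 0) at_top" unfolding f_def by real_asymp
  hence "\<forall>\<^sub>F y in at_top. f y < 1" by (rule order_tendstoD) auto
  then obtain Y where Y: "\<And>y. y \<ge> Y \<Longrightarrow> f y < 1" by (auto simp: eventually_at_top_linorder)
  have "continuous_on {0..max 0 Y} f" unfolding f_def by (intro continuous_intros) auto
  hence "bounded (f ` {0..max 0 Y})" by (intro compact_imp_bounded compact_continuous_image) auto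
  then obtain K where K: "\<And>y. y \<in> {0..max 0 Y} \<Longrightarrow> \<bar>f y\<bar> \<le> K"
    unfolding bounded_iff by (metis imageI real_norm_def)
  have "exp (1 - \<bar>v\<bar>) * (2 + 2 * \<bar>v\<bar>) powr k \<le> (max 1 K) / (1 + v ^ 2)" for v
  proof -
    have "f \<bar>v\<bar> \<le> max 1 K"
    proof (cases "\<bar>v\<bar> \<ge> Y")
      case True thus ?thesis using Y[of "\<bar>v\<bar>"] by auto
    next
      case False thus ?thesis using K[of "\<bar>v\<bar>"] by auto
    qed
    moreover have "1 + v ^ 2 > 0" by (simp add: add_pos_nonneg)
    ultimately show ?thesis by (simp add: f_def field_simps)
  qed
  thus ?thesis by blast
qed

lemma integrable_exp_powr_weight: "integrable lborel (\<lambda>v::real. exp (1 - \<bar>v\<bar>) * (2 + 2 * \<bar>v\<bar>) powr k)"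
proof -
  obtain C where C: "\<And>v::real. exp (1 - \<bar>v\<bar>) * (2 + 2 * \<bar>v\<bar>) powr k \<le> C / (1 + v ^ 2)"
    using exp_weight_bound by blast
  show ?thesis
  proof (rule Bochner_Integration.integrable_bound[OF integrable_inverse_1_plus_square'[of C] _ AE_I2])
    fix v :: real
    have "norm (exp (1 - \<bar>v\<bar>) * (2 + 2 * \<bar>v\<bar>) powr k) = exp (1 - \<bar>v\<bar>) * (2 + 2 * \<bar>v\<bar>) powr k" by simp
    also note C[of v]
    also have "C / (1 + v ^ 2) \<le> norm (C / (1 + v ^ 2))" by (simp only: real_norm_def abs_ge_self)
    finally show "norm (exp (1 - \<bar>v\<bar>) * (2 + 2 * \<bar>v\<bar>) powr k) \<le> norm (C / (1 + v ^ 2))" .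
  qed measurable
qed

lemma norm_exp_wedge: "norm (exp (wedge 1 v)) = exp (1 - \<bar>v\<bar>)"
  by (simp add: wedge_def)

lemma integrable_exp_wedge:
  assumes "continuous_on UNIV \<phi>" "\<And>v. norm (\<phi> v :: complex) \<le> C * (2 + 2 * \<bar>v\<bar>) powr k"
  shows "integrable lborel (\<lambda>v. exp (wedge 1 v) * \<phi> v * wedge' v)"
proof (rule Bochner_Integration.integrable_bound[OF integrable_mult_right[OF integrable_exp_powr_weight[of k], of "2 * C"]])
  have "continuous_on UNIV (\<lambda>v. exp (wedge 1 v) * \<phi> v)"
    by (intro continuous_intros continuous_wedge assms)
  hence [measurable]: "(\<lambda>v. exp (wedge 1 v) * \<phi> v) \<in> borel_measurable borel"
    by (rule borel_measurable_continuous_onI)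
  show "(\<lambda>v. exp (wedge 1 v) * \<phi> v * wedge' v) \<in> borel_measurable lborel" by measurable
  show "AE v in lborel. norm (exp (wedge 1 v) * \<phi> v * wedge' v) \<le>
          norm (2 * C * (exp (1 - \<bar>v\<bar>) * (2 + 2 * \<bar>v\<bar>) powr k))"
  proof (intro AE_I2)
    fix v
    have "norm (exp (wedge 1 v) * \<phi> v * wedge' v) \<le> exp (1 - \<bar>v\<bar>) * (C * (2 + 2 * \<bar>v\<bar>) powr k) * 2"
      unfolding norm_mult norm_exp_wedge
      by (intro mult_mono assms norm_wedge'_le mult_nonneg_nonneg order_trans[OF norm_ge_zero assms(2)]) auto
    also have "\<dots> = 2 * C * (exp (1 - \<bar>v\<bar>) * (2 + 2 * \<bar>v\<bar>) powr k)" by simp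
    also have "\<dots> \<le> norm \<dots>" by (simp only: real_norm_def abs_ge_self)
    finally show "norm (exp (wedge 1 v) * \<phi> v * wedge' v) \<le>
          norm (2 * C * (exp (1 - \<bar>v\<bar>) * (2 + 2 * \<bar>v\<bar>) powr k))" .
  qed
qed

text \<open>Hankel's loop integral for \<open>2 \<pi> \<i> / \<Gamma>(r)\<close>. Along the rays
  \<open>exp\<close> decays exponentially, so it converges absolutely for every real
  \<open>r\<close>; on a vertical line this would require \<open>r > 1\<close>.\<close>

definition hankel_integral :: "real \<Rightarrow> complex" where
  "hankel_integral r = (LINT v|lborel. exp (wedge 1 v) * wedge 1 v powr (- of_real r) * wedge' v)"

lemma norm_powr_of_real: "norm ((z :: complex) powr of_real r) = norm z powr r"
  by (simp add: norm_powr_real_powr')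

lemma norm_powr_minus_of_real: "norm ((z :: complex) powr (- of_real r)) = norm z powr (- r)"
  using norm_powr_of_real[of z "-r"] by simp

lemma continuous_wedge_powr:
  assumes "x > 0"
  shows "continuous_on UNIV (\<lambda>v. wedge x v powr r)"
proof -
  have "wedge x v \<notin> \<real>\<^sub>\<le>\<^sub>0" for v using wedge_in_slit[of x "x + 1" v] assms by auto
  moreover have "(\<lambda>z. z powr r) holomorphic_on - \<real>\<^sub>\<le>\<^sub>0" by (intro holomorphic_intros) auto
  ultimately show ?thesis
    by (intro continuous_on_compose2[OF holomorphic_on_imp_continuous_on continuous_wedge]) auto
qed

lemma integrable_hankel:
  "integrable lborel (\<lambda>v. exp (wedge 1 v) * wedge 1 v powr (- of_real r) * wedge' v)"
  by (rule integrable_exp_wedge[where C = 1 and k = "\<bar>r\<bar>"])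
     (use norm_wedge_powr_le[of _ "-r"] in \<open>auto intro!: continuous_wedge_powr simp: norm_powr_minus_of_real\<close>)

text \<open>Integration by parts: the derivative of \<open>exp s * s powr (- r)\<close> is the
  difference of the two integrands, and this function vanishes at both ends of the wedge. It mirrors
  \<open>1 / \<Gamma>(r) = r / \<Gamma>(r + 1)\<close>.\<close>

lemma hankel_integral_rec: "hankel_integral r = of_real r * hankel_integral (r + 1)"
proof -
  let ?S = "slit_half_plane 2"
  define P where "P = (\<lambda>s::complex. exp s * s powr (- of_real r))"
  define g where "g = (\<lambda>s::complex. exp s * s powr (- of_real r) - of_real r * (exp s * s powr (- of_real (r + 1))))"
  have P: "(P has_field_derivative g z) (at z)" if "z \<in> ?S" for z
    using that unfolding P_def g_def
    by (auto intro!: derivative_eq_intros simp: algebra_simps minus_diff_commute)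
  have geq: "g (wedge 1 v) * wedge' v = exp (wedge 1 v) * wedge 1 v powr (- of_real r) * wedge' v -
         of_real r * (exp (wedge 1 v) * wedge 1 v powr (- of_real (r + 1)) * wedge' v)" for v
    by (simp add: g_def algebra_simps)
  have int: "integrable lborel (\<lambda>v. g (wedge 1 v) * wedge' v)"
    unfolding geq by (intro Bochner_Integration.integrable_diff integrable_mult_right integrable_hankel)
  have 1: "((\<lambda>T. P (wedge 1 T) - P (wedge 1 (-T))) \<longlongrightarrow> (LINT v|lborel. g (wedge 1 v) * wedge' v)) at_top"
    by (rule curve_integral_primitive[OF P continuous_wedge wedge_in_slit[of 1 2] _ has_vector_derivative_wedge int, where K = "{0}"]) simp_all
  have "((\<lambda>T. P (wedge 1 T) - P (wedge 1 (-T))) \<longlongrightarrow> 0) at_top"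
  proof (rule Lim_null_comparison)
    let ?e = "\<lambda>T. exp (1 - T) * (2 + 2 * T) powr \<bar>r\<bar>"
    show "((\<lambda>T::real. ?e T + ?e T) \<longlongrightarrow> 0) at_top" by real_asymp
    show "\<forall>\<^sub>F T in at_top. norm (P (wedge 1 T) - P (wedge 1 (-T))) \<le> ?e T + ?e T"
    proof (rule eventually_mono[OF eventually_ge_at_top[of 0]])
      fix T :: real assume T: "T \<ge> 0"
      have "norm (P (wedge 1 v)) \<le> exp (1 - \<bar>v\<bar>) * (2 + 2 * \<bar>v\<bar>) powr \<bar>r\<bar>" for v
        unfolding P_def norm_mult norm_exp_wedge norm_powr_minus_of_real
        using norm_wedge_powr_le[of v "-r"] by (intro mult_left_mono) auto
      from this[of T] this[of "-T"] T show "norm (P (wedge 1 T) - P (wedge 1 (-T))) \<le> ?e T + ?e T"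
        by (intro order_trans[OF norm_triangle_ineq4] add_mono) auto
    qed
  qed
  from tendsto_unique[OF trivial_limit_at_top_linorder 1 this]
  have "0 = (LINT v|lborel. g (wedge 1 v) * wedge' v)" by simp
  also have "\<dots> = hankel_integral r - of_real r * hankel_integral (r + 1)"
    unfolding geq hankel_integral_def
    by (subst Bochner_Integration.integral_diff) (use integrable_hankel[of r] integrable_hankel[of "r + 1"] in auto)
  finally show ?thesis by simp
qed

lemma exp_powr_holomorphic:
  "(\<lambda>s. exp s * s powr (- of_real p)) holomorphic_on slit_half_plane R"
  by (intro holomorphic_intros) auto

lemma powr_minus_le_inverse_square:
  assumes "p \<ge> 2" "norm (s :: complex) \<ge> 1"
  shows "norm (s powr (- of_real p)) \<le> 1 / norm s ^ 2"
proof -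
  have "norm s powr (- p) \<le> norm s powr (- 2)" using assms by (intro powr_mono) auto
  also have "\<dots> = 1 / norm s ^ 2" using assms by (simp add: powr_minus_divide)
  finally show ?thesis by (simp add: norm_powr_minus_of_real)
qed

text \<open>Boundedness of \<open>g\<close> on the segment joining the line to the wedge would not suffice: that
  segment grows linearly with the height, hence the quadratic decay.\<close>
lemma line_to_wedge:
  assumes x: "0 < x" "x < R" "0 < y" "y < R"
    and g: "g holomorphic_on slit_half_plane R"
    and bound: "\<And>s. \<bar>Im s\<bar> \<ge> 1 \<Longrightarrow> Re s \<le> max x y \<Longrightarrow> Re s \<ge> - \<bar>Im s\<bar> \<Longrightarrow> norm (g s) \<le> D / \<bar>Im s\<bar> ^ 2"
    and int: "integrable lborel (\<lambda>v. g (wedge y v) * wedge' v)" "integrable lborel (\<lambda>t. g (Complex x t) * \<i>)"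
  shows "(LINT v|lborel. g (wedge y v) * wedge' v) = vertical_integral x g"
proof -
  obtain P where P: "\<And>z. z \<in> slit_half_plane R \<Longrightarrow> (P has_field_derivative g z) (at z)"
    using slit_half_plane_primitive[of R g] x g by force
  define e where "e = (\<lambda>T. \<bar>D\<bar> * (T + x + y) / T ^ 2)"
  have seg: "Im z = t \<and> Re z \<le> max x y \<and> Re z \<ge> - \<bar>t\<bar>" if "z \<in> closed_segment (Complex x t) (wedge y t)" for z t
    using that x by (auto simp: wedge_def closed_segment_same_Im closed_segment_eq_real_ivl split: if_splits)
  show ?thesis unfolding vertical_integral_def
  proof (rule curve_integral_deform[OF P continuous_wedge _ _ _ _ continuous_line, where K = "{0}" and L = "{}" and e = e])
    have "((\<lambda>T::real. (T + x + y) / T ^ 2) \<longlongrightarrow> 0) at_top" by real_asymp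
    from tendsto_mult[OF tendsto_const[of "\<bar>D\<bar>"] this] show "(e \<longlongrightarrow> 0) at_top" by (simp add: e_def)
  next
    fix t :: real assume t: "\<bar>t\<bar> \<ge> 1"
    show "closed_segment (Complex x t) (wedge y t) \<subseteq> slit_half_plane R"
    proof
      fix z assume "z \<in> closed_segment (Complex x t) (wedge y t)"
      from seg[OF this] x t show "z \<in> slit_half_plane R" by (auto simp: complex_nonpos_Reals_iff)
    qed
    fix z assume z: "z \<in> closed_segment (Complex x t) (wedge y t)"
    have "norm (g z) \<le> D / \<bar>t\<bar> ^ 2" using seg[OF z] t bound[of z] by auto
    also have "\<dots> \<le> \<bar>D\<bar> / \<bar>t\<bar> ^ 2" by (intro divide_right_mono) auto
    finally have 1: "norm (g z) \<le> \<bar>D\<bar> / \<bar>t\<bar> ^ 2" .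
    have "norm (wedge y t - Complex x t) = \<bar>y - \<bar>t\<bar> - x\<bar>"
      by (simp add: wedge_def cmod_eq_Re)
    also have "\<dots> \<le> \<bar>t\<bar> + x + y" using x by linarith
    finally have "norm (g z) * norm (wedge y t - Complex x t) \<le> (\<bar>D\<bar> / \<bar>t\<bar> ^ 2) * (\<bar>t\<bar> + x + y)"
      using 1 by (intro mult_mono) auto
    thus "norm (g z) * norm (wedge y t - Complex x t) \<le> e \<bar>t\<bar>" by (simp add: e_def)
  qed (use x int has_vector_derivative_wedge has_vector_derivative_line wedge_in_slit line_in_slit in simp_all)
qed

lemma norm_line_powr_le:
  assumes "p \<ge> 2" and t: "\<bar>t\<bar> \<ge> 1/2"
  shows "norm (Complex x t powr (- of_real p)) \<le> 5 * 2 powr p / (1 + t ^ 2)"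
proof -
  have n: "norm (Complex x t) \<ge> \<bar>t\<bar>" using abs_Im_le_cmod[of "Complex x t"] by simp
  have "norm (Complex x t powr (- of_real p)) \<le> \<bar>t\<bar> powr (-p)"
    unfolding norm_powr_minus_of_real using n t assms by (intro powr_mono2') auto
  \<comment> \<open>Doubling makes the base at least 1, so that the exponent \<open>-p\<close> may
    be replaced by -2; the price is the factor \<open>2 powr p\<close>.\<close>
  also have "\<bar>t\<bar> powr (-p) = (2 * \<bar>t\<bar>) powr (-p) * 2 powr p"
    using t by (simp add: powr_mult powr_minus field_simps)
  also have "(2 * \<bar>t\<bar>) powr (-p) \<le> (2 * \<bar>t\<bar>) powr (-2)"
    using t assms by (intro powr_mono) auto
  also have "(2 * \<bar>t\<bar>) powr (-2) = 1 / (4 * t ^ 2)" using t by (simp add: powr_minus_divide power_mult_distrib)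
  also have "\<dots> \<le> 5 / (1 + t ^ 2)"
  proof -
    have "1 / 4 \<le> t ^ 2" using power_mono[OF t, of 2] by (simp add: power2_eq_square)
    hence "5 / (20 * t ^ 2) \<le> 5 / (1 + t ^ 2)"
      by (intro divide_left_mono mult_pos_pos) (auto simp: add_pos_nonneg)
    thus ?thesis by simp
  qed
  finally show ?thesis by simp
qed

lemma integrable_exp_powr_line:
  assumes "p \<ge> 2" "x > 0"
  shows "integrable lborel (\<lambda>t. exp (Complex x t) * Complex x t powr (- of_real p) * \<i>)"
proof (rule integrable_line)
  have "continuous_on UNIV (\<lambda>t. exp (Complex x t) * Complex x t powr (- of_real p))"
    by (rule continuous_on_Complex_line[OF holomorphic_on_imp_continuous_on[OF exp_powr_holomorphic[of _ "x + 1"]]])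
       (use assms in \<open>auto simp: complex_nonpos_Reals_iff\<close>)
  thus "continuous_on UNIV (\<lambda>t. exp (Complex x t) * Complex x t powr (- of_real p) * \<i>)"
    by (rule continuous_on_mult_right)
  fix t :: real assume t: "\<bar>t\<bar> \<ge> 1/2"
  have "norm (exp (Complex x t) * Complex x t powr (- of_real p) * \<i>) \<le> exp x * (5 * 2 powr p / (1 + t ^ 2))"
    using mult_left_mono[OF norm_line_powr_le[OF assms(1) t, of x], of "exp x"] by (simp only: norm_mult norm_ii mult_1_right norm_exp_eq_Re complex.sel) simp
  thus "norm (exp (Complex x t) * Complex x t powr (- of_real p) * \<i>) \<le> (exp x * 5 * 2 powr p) / (1 + t ^ 2)"
    by (simp add: mult_ac)
qed

lemma vertical_exp_powr_eq_hankel: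
  assumes "p \<ge> 2" "x > 0"
  shows "vertical_integral x (\<lambda>s. exp s * s powr (- of_real p)) = hankel_integral p"
  unfolding hankel_integral_def
proof (rule line_to_wedge[symmetric, where R = "x + 2" and D = "exp (max x 1)"])
  fix s :: complex assume s: "\<bar>Im s\<bar> \<ge> 1" "Re s \<le> max x 1" "- \<bar>Im s\<bar> \<le> Re s"
  have n: "norm s \<ge> \<bar>Im s\<bar>" by (rule abs_Im_le_cmod)
  have "norm (exp s * s powr (- of_real p)) = exp (Re s) * norm (s powr (- of_real p))" by (simp add: norm_mult)
  also have "\<dots> \<le> exp (max x 1) * (1 / norm s ^ 2)"
    using s n assms by (intro mult_mono powr_minus_le_inverse_square) auto
  also have "1 / norm s ^ 2 \<le> 1 / \<bar>Im s\<bar> ^ 2" using s n by (intro divide_left_mono power_mono mult_pos_pos) auto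
  finally show "norm (exp s * s powr (- of_real p)) \<le> exp (max x 1) / \<bar>Im s\<bar> ^ 2" by simp
qed (use assms exp_powr_holomorphic integrable_hankel integrable_exp_powr_line in simp_all)

text \<open>Scaling by \<eta> moves the line from \<open>x\<close> to \<open>\<eta> * x\<close>. By
  \<open>vertical_exp_powr_eq_hankel\<close> the integral of \<open>exp s * s powr (- p)\<close> has
  the same value on every such line, so \<open>x\<close> disappears from the result.\<close>

lemma vertical_exp_powr_scale:
  assumes p: "p \<ge> 2" and "x > 0" "\<eta> > 0"
  shows "vertical_integral x (\<lambda>s. exp (of_real \<eta> * s) * s powr (- of_real p)) =
           of_real (\<eta> powr (p - 1)) * hankel_integral p"
proof -
  have C: "Complex (\<eta> * x) (\<eta> * t) = of_real \<eta> * Complex x t" for t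
    by (simp add: complex_eq_iff)
  \<comment> \<open>The summand 0 is there to match the affine substitution
    \<open>lborel_integral_real_affine\<close>.\<close>
  have scale: "exp (Complex (\<eta> * x) (0 + \<eta> * t)) * Complex (\<eta> * x) (0 + \<eta> * t) powr (- of_real p) * \<i> =
      of_real (\<eta> powr (- p)) * (exp (of_real \<eta> * Complex x t) * Complex x t powr (- of_real p) * \<i>)" for t
    using assms powr_of_real[of \<eta> "-p"] by (simp add: C powr_times_real_left)
  have "hankel_integral p = vertical_integral (\<eta> * x) (\<lambda>s. exp s * s powr (- of_real p))"
    using assms by (intro vertical_exp_powr_eq_hankel[symmetric]) auto
  also have "\<dots> = \<bar>\<eta>\<bar> *\<^sub>R (LINT t|lborel. exp (Complex (\<eta> * x) (0 + \<eta> * t)) *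
                Complex (\<eta> * x) (0 + \<eta> * t) powr (- of_real p) * \<i>)"
    unfolding vertical_integral_def using assms by (intro lborel_integral_real_affine) auto
  also have "\<dots> = of_real \<eta> * (LINT t|lborel. of_real (\<eta> powr (- p)) *
                (exp (of_real \<eta> * Complex x t) * Complex x t powr (- of_real p) * \<i>))"
    unfolding scale using assms by (simp add: scaleR_conv_of_real)
  also have "\<dots> = of_real (\<eta> * \<eta> powr (-p)) * vertical_integral x (\<lambda>s. exp (of_real \<eta> * s) * s powr (- of_real p))"
    by (simp add: vertical_integral_def)
  also have "\<eta> * \<eta> powr (-p) = \<eta> powr (1 - p)"
    using assms by (simp add: powr_diff powr_minus divide_inverse)
  finally have "of_real (\<eta> powr (p - 1)) * hankel_integral p =
      of_real (\<eta> powr (p - 1) * \<eta> powr (1 - p)) * vertical_integral x (\<lambda>s. exp (of_real \<eta> * s) * s powr (- of_real p))"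
    by simp
  also have "\<eta> powr (p - 1) * \<eta> powr (1 - p) = 1" using assms by (simp flip: powr_add)
  finally show ?thesis by simp
qed

section \<open>Evaluating Hankel's integral by a Laplace transform\<close>

lemma integral_exp_half_line:
  fixes z :: complex
  assumes "Re z < 0"
  shows "(LINT \<eta>|lborel. indicator {0<..} \<eta> *\<^sub>R exp (of_real \<eta> * z)) = - 1 / z"
    and "integrable lborel (\<lambda>\<eta>. indicator {0<..} \<eta> *\<^sub>R exp (of_real \<eta> * z))"
proof -
  let ?f = "\<lambda>\<eta>::real. indicator {0<..} \<eta> *\<^sub>R exp (of_real \<eta> * z)"
  have "z \<noteq> 0" using assms by auto
  show int: "integrable lborel ?f"
  proof (rule integrable_inverse_square_bound)
    have "continuous_on UNIV (\<lambda>\<eta>. exp (of_real \<eta> * z))" by (intro continuous_intros)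
    hence [measurable]: "(\<lambda>\<eta>. exp (of_real \<eta> * z)) \<in> borel_measurable borel"
      by (rule borel_measurable_continuous_onI)
    show "?f \<in> borel_measurable lborel" by measurable
    fix t :: real
    define a where "a = - Re z"
    have a: "a > 0" using assms by (simp add: a_def)
    have p: "1 + t ^ 2 > 0" by (simp add: add_pos_nonneg)
    \<comment> \<open>The constant comes from the quadratic Taylor bound for
      \<open>exp (a t)\<close>, which gives both \<open>1 \<le> exp (a t)\<close> and
      \<open>t\<^sup>2 \<le> 2 / a\<^sup>2 * exp (a t)\<close>.\<close>
    show "norm (?f t) \<le> (1 + 2 / a ^ 2) / (1 + t ^ 2)"
    proof (cases "t > 0")
      case True
      have l: "1 + a * t + (a * t) ^ 2 / 2 \<le> exp (a * t)"
        using a True by (intro exp_lower_Taylor_quadratic) auto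
      have "t ^ 2 = 2 / a ^ 2 * ((a * t) ^ 2 / 2)" using a by (simp add: power_mult_distrib)
      also have "\<dots> \<le> 2 / a ^ 2 * exp (a * t)"
        using l mult_pos_pos[OF a True] by (intro mult_left_mono) (linarith, simp)
      finally have "1 + t ^ 2 \<le> (1 + 2 / a ^ 2) * exp (a * t)"
        using a True by (simp add: algebra_simps add_mono)
      hence "exp (- (a * t)) \<le> (1 + 2 / a ^ 2) / (1 + t ^ 2)"
        using p by (simp add: exp_minus field_simps)
      thus ?thesis using True by (simp add: a_def mult.commute)
    qed (use p in auto)
  qed
  have "integral {-T..T} ?f = (exp (of_real T * z) - 1) / z" if "T \<ge> 0" for T
  proof -
    have "((\<lambda>\<eta>. exp (of_real \<eta> * z)) has_integral exp (of_real T * z) / z - exp (of_real 0 * z) / z) {0..T}"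
    proof (rule fundamental_theorem_of_calculus[OF that])
      fix t assume "t \<in> {0..T}"
      have "((\<lambda>w. exp (w * z) / z) has_field_derivative exp (of_real t * z)) (at (of_real t))"
        using \<open>z \<noteq> 0\<close> by (auto intro!: derivative_eq_intros)
      from has_vector_derivative_real_field[OF this]
      show "((\<lambda>\<eta>. exp (of_real \<eta> * z) / z) has_vector_derivative exp (of_real t * z)) (at t within {0..T})" .
    qed
    hence "((\<lambda>\<eta>. exp (of_real \<eta> * z)) has_integral exp (of_real T * z) / z - 1 / z) {0..T}" by simp
    hence "(?f has_integral exp (of_real T * z) / z - 1 / z) {0..T}"
      by (rule has_integral_spike_finite[where S = "{0}", rotated 2]) auto
    moreover have "(?f has_integral 0) {-T..0}" by (rule has_integral_is_0) auto
    ultimately have "(?f has_integral 0 + (exp (of_real T * z) / z - 1 / z)) {-T..T}"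
      using that by (intro has_integral_combine[of "-T" 0 T]) auto
    thus ?thesis by (simp add: integral_unique diff_divide_distrib)
  qed
  hence "\<forall>\<^sub>F T in at_top. integral {-T..T} ?f = (exp (of_real T * z) - 1) / z"
    by (intro eventually_mono[OF eventually_ge_at_top[of 0]]) auto
  from Lim_transform_eventually[OF tendsto_integral_symmetric[OF int] this]
  have "((\<lambda>T. (exp (of_real T * z) - 1) / z) \<longlongrightarrow> (LINT \<eta>|lborel. ?f \<eta>)) at_top" .
  moreover have "((\<lambda>T. (exp (of_real T * z) - 1) / z) \<longlongrightarrow> (0 - 1) / z) at_top"
  proof (intro tendsto_intros)
    have "((\<lambda>T. exp (T * Re z)) \<longlongrightarrow> 0) at_top" using assms by real_asymp
    thus "((\<lambda>T. exp (of_real T * z)) \<longlongrightarrow> 0) at_top"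
      by (rule Lim_null_comparison[rotated]) simp
  qed (use \<open>z \<noteq> 0\<close> in auto)
  ultimately show "(LINT \<eta>|lborel. ?f \<eta>) = - 1 / z"
    using tendsto_unique[OF trivial_limit_at_top_linorder] by fastforce
qed

text \<open>On the line \<open>Re s = 1/2\<close> the exponential has the constant modulus
  \<open>exp (1/2)\<close>, so it can be divided out of
  \<open>integrable_exp_powr_line\<close>.\<close>

lemma integrable_powr_line:
  assumes "p \<ge> 2"
  shows "integrable lborel (\<lambda>t. Complex (1/2) t powr (- of_real p))"
proof -
  have "integrable lborel (\<lambda>t. exp (-1/2) * norm (exp (Complex (1/2) t) * Complex (1/2) t powr (- of_real p) * \<i>))"
    by (intro integrable_mult_right integrable_norm integrable_exp_powr_line assms) simp
  also have "(\<lambda>t. exp (-1/2) * norm (exp (Complex (1/2) t) * Complex (1/2) t powr (- of_real p) * \<i>)) =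
               (\<lambda>t. norm (Complex (1/2) t powr (- of_real p)))"
    by (simp add: norm_mult exp_minus field_simps)
  finally have "integrable lborel (\<lambda>t. norm (Complex (1/2) t powr (- of_real p)))" .
  moreover have "continuous_on UNIV (\<lambda>t. Complex (1/2) t powr (- of_real p))"
  proof (rule continuous_on_Complex_line[where S = "- \<real>\<^sub>\<le>\<^sub>0"])
    have "(\<lambda>z. z powr (- of_real p)) holomorphic_on - \<real>\<^sub>\<le>\<^sub>0" by (intro holomorphic_intros) auto
    thus "continuous_on (- \<real>\<^sub>\<le>\<^sub>0) (\<lambda>z. z powr (- complex_of_real p))"
      by (rule holomorphic_on_imp_continuous_on)
  qed (auto simp: complex_nonpos_Reals_iff)
  ultimately show ?thesis
    by (subst (asm) integrable_norm_iff) (auto intro: borel_measurable_continuous_onI)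
qed

text \<open>The line is pushed to the right, to infinity. The only pole crossed is
  \<open>s = 1\<close>, with residue -1, and on \<open>Re s = b\<close> the integral is at most
  \<open>K / (b - 1)\<close>, since \<open>|s|\<^sup>2 \<ge> 1 + t\<^sup>2\<close> and
  \<open>|s - 1| \<ge> b - 1\<close> there.\<close>

lemma vertical_Cauchy_kernel:
  assumes p: "p \<ge> 2"
  shows "vertical_integral (1/2) (\<lambda>s. s powr (- of_real p) / (1 - s)) = 2 * of_real pi * \<i>"
proof -
  define f where "f = (\<lambda>s. - (s powr (- of_real p)) / (s - 1) :: complex)"
  define S where "S = {s::complex. Re s > 0}"
  have S: "S \<subseteq> - \<real>\<^sub>\<le>\<^sub>0" by (auto simp: S_def complex_nonpos_Reals_iff)
  have hol: "(\<lambda>s. - (s powr (- of_real p))) holomorphic_on S"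
    using S by (intro holomorphic_intros) auto
  have fhol: "f holomorphic_on S - {1}"
    unfolding f_def by (intro holomorphic_on_divide holomorphic_on_subset[OF hol] holomorphic_intros) auto
  have fnorm: "norm (f s) = norm s powr (-p) / norm (s - 1)" for s
    by (simp add: f_def norm_divide norm_powr_minus_of_real)
  have line: "integrable lborel (\<lambda>t. f (Complex x t))" if "x > 0" "x \<noteq> 1" for x
  proof (rule integrable_line)
    show "continuous_on UNIV (\<lambda>t. f (Complex x t))"
      by (rule continuous_on_Complex_line[OF holomorphic_on_imp_continuous_on[OF fhol]])
         (use that in \<open>auto simp: S_def complex_eq_iff\<close>)
    fix t :: real assume t: "\<bar>t\<bar> \<ge> 1/2"
    show "norm (f (Complex x t)) \<le> (2 powr p * 10) / (1 + t ^ 2)"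
    proof -
      have n: "norm (Complex x t) \<ge> \<bar>t\<bar>" "norm (Complex x t - 1) \<ge> \<bar>t\<bar>"
        using abs_Im_le_cmod[of "Complex x t"] abs_Im_le_cmod[of "Complex x t - 1"] by simp_all
      have "norm (f (Complex x t)) \<le> norm (Complex x t) powr (-p) / (1/2)"
        unfolding fnorm using n t by (intro divide_left_mono) (auto intro!: mult_pos_pos)
      also have "\<dots> = 2 * norm (Complex x t powr (- of_real p))" by (simp add: norm_powr_minus_of_real)
      also have "\<dots> \<le> 2 * (5 * 2 powr p / (1 + t ^ 2))"
        using norm_line_powr_le[OF p t, of x] by (intro mult_left_mono) auto
      finally show ?thesis by (simp add: mult_ac)
    qed
  qed
  define K where "K = (LINT t|lborel. 1 / (1 + t ^ 2) :: real)"
  have diff: "vertical_integral b f - vertical_integral (1/2) f = - 2 * of_real pi * \<i>" if "b > 1" for b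
  proof -
    have "vertical_integral b f - vertical_integral (1/2) f = 2 * of_real pi * \<i> * - (1 powr (- of_real p))"
    proof (rule vertical_integral_cross_pole[where S = S and f = f and z = 1 and e = "\<lambda>T. T powr (-p) / T" and h = "\<lambda>s. - (s powr (- of_real p))"])
      show "((\<lambda>T. T powr (- p) / T) \<longlongrightarrow> 0) at_top" using p by real_asymp
      show "convex S" "open S" unfolding S_def by (auto intro: convex_halfspace_Re_gt open_halfspace_Re_gt)
      fix s :: complex assume s: "1/2 \<le> Re s" "Re s \<le> b" "\<bar>Im 1\<bar> < \<bar>Im s\<bar>"
      have n: "norm s \<ge> \<bar>Im s\<bar>" "norm (s - 1) \<ge> \<bar>Im s\<bar>"
        using abs_Im_le_cmod[of s] abs_Im_le_cmod[of "s - 1"] by simp_all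
      show "norm (f s) \<le> \<bar>Im s\<bar> powr (- p) / \<bar>Im s\<bar>"
        unfolding fnorm using n s p by (intro frac_le powr_mono2') auto
    qed (use hol line[of "1/2"] line[of b] that in \<open>auto simp: S_def f_def\<close>)
    thus ?thesis by simp
  qed
  have small: "norm (vertical_integral b f) \<le> K / (b - 1)" if b: "b > 1" for b
  proof -
    have "norm (vertical_integral b f) \<le> (LINT t|lborel. 1 / (1 + t ^ 2) * (1 / (b - 1)))"
      unfolding vertical_integral_def
    proof (rule Bochner_Integration.integral_norm_bound_integral)
      show "integrable lborel (\<lambda>t. f (Complex b t) * \<i>)"
        using line[of b] b by (intro integrable_mult_left) auto
      show "integrable lborel (\<lambda>t. 1 / (1 + t ^ 2) * (1 / (b - 1)))"
        by (intro integrable_mult_left integrable_inverse_1_plus_square')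
      fix t :: real
      have pos: "1 + t ^ 2 > 0" by (simp add: add_pos_nonneg)
      have sq: "norm (Complex b t) ^ 2 = b ^ 2 + t ^ 2" by (simp add: cmod_power2)
      have b1: "b ^ 2 \<ge> 1" using b by simp
      have n1: "norm (Complex b t) \<ge> 1" using abs_Re_le_cmod[of "Complex b t"] b by simp
      have n2: "norm (Complex b t - 1) \<ge> b - 1" using abs_Re_le_cmod[of "Complex b t - 1"] b by simp
      have n3: "norm (Complex b t - 1) > 0" using n2 b by linarith
      have "norm (f (Complex b t) * \<i>) = norm (Complex b t powr (- of_real p)) * (1 / norm (Complex b t - 1))"
        by (simp add: norm_mult f_def norm_divide)
      also have "\<dots> \<le> (1 / norm (Complex b t) ^ 2) * (1 / (b - 1))"
        using n2 b by (intro mult_mono powr_minus_le_inverse_square p n1 divide_left_mono mult_pos_pos n3) auto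
      also have "\<dots> \<le> 1 / (1 + t ^ 2) * (1 / (b - 1))"
        unfolding sq using pos b1 b by (intro mult_right_mono divide_left_mono mult_pos_pos) (auto simp: add_pos_nonneg)
      finally show "norm (f (Complex b t) * \<i>) \<le> 1 / (1 + t ^ 2) * (1 / (b - 1))" .
    qed
    also have "\<dots> = K * (1 / (b - 1))" unfolding K_def by (rule integral_mult_left_zero)
    finally show ?thesis by simp
  qed
  have "((\<lambda>b. vertical_integral b f) \<longlongrightarrow> 0) at_top"
  proof (rule Lim_null_comparison)
    show "\<forall>\<^sub>F b in at_top. norm (vertical_integral b f) \<le> K / (b - 1)"
      using small by (intro eventually_mono[OF eventually_gt_at_top[of 1]]) auto
    show "((\<lambda>b. K / (b - 1)) \<longlongrightarrow> 0) at_top" by real_asymp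
  qed
  moreover have "((\<lambda>b. vertical_integral b f) \<longlongrightarrow> vertical_integral (1/2) f - 2 * of_real pi * \<i>) at_top"
  proof (rule tendsto_eventually, rule eventually_mono[OF eventually_gt_at_top[of 1]])
    fix b :: real assume "b > 1"
    from diff[OF this] show "vertical_integral b f = vertical_integral (1/2) f - 2 * of_real pi * \<i>"
      by (simp add: diff_eq_eq)
  qed
  ultimately have "0 = vertical_integral (1/2) f - 2 * of_real pi * \<i>"
    by (rule tendsto_unique[OF trivial_limit_at_top_linorder])
  moreover have "f = (\<lambda>s. s powr (- of_real p) / (1 - s))"
    unfolding f_def by (intro ext) (metis minus_diff_eq minus_divide_left minus_divide_right)
  ultimately show ?thesis by simp
qed

lemma Gamma_lborel_integral:
  assumes "p > (1::real)"
  shows "has_bochner_integral lborel (\<lambda>t. indicator {0<..} t * (t powr (p - 1) * exp (-t))) (Gamma p)"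
proof (rule has_bochner_integral_nn_integral)
  have "indicator {0<..} t * (t powr (p - 1) * exp (-t)) = indicator {0..} t * t powr (p - 1) / exp t" for t :: real
    by (auto simp: indicator_def exp_minus divide_inverse)
  thus "(\<integral>\<^sup>+ t. ennreal (indicator {0<..} t * (t powr (p - 1) * exp (-t))) \<partial>lborel) = ennreal (Gamma p)"
    using Gamma_conv_nn_integral_real[of p] assms by simp
qed (use assms in \<open>auto intro: less_imp_le Gamma_real_pos\<close>)

text \<open>Both sides of the claim are multiplied by \<open>\<Gamma>(p)\<close>, which turns the left-hand side into the Laplace
  transform at \<open>1\<close> of \<open>\<eta> \<mapsto> \<integral> exp (\<eta> s) s\<^sup>-\<^sup>p ds\<close>; interchanging the integrals leaves the Cauchy kernel
  \<open>s\<^sup>-\<^sup>p / (1 - s)\<close>.\<close>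
lemma hankel_integral_ge2:
  assumes p: "p \<ge> 2"
  shows "hankel_integral p = 2 * of_real pi * \<i> * rGamma (of_real p)"
proof -
  define \<psi> where "\<psi> = (\<lambda>t. Complex (1/2) t powr (- of_real p) * \<i>)"
  \<comment> \<open>\<open>Complex (-1/2) t\<close> is \<open>s - 1\<close> for
    \<open>s = Complex (1/2) t\<close>: the weight \<open>exp (- \<eta>)\<close> of the Laplace
    transform is already included, and the negative real part makes the double integral absolutely
    convergent.\<close>
  define F where "F = (\<lambda>\<eta> t. indicator {0<..} \<eta> *\<^sub>R exp (of_real \<eta> * Complex (-1/2) t) * \<psi> t)"
  have int\<psi>: "integrable lborel \<psi>"
    unfolding \<psi>_def by (intro integrable_mult_left integrable_powr_line p)
  have [measurable]: "\<psi> \<in> borel_measurable borel" using borel_measurable_integrable[OF int\<psi>] by simp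
  have nF: "norm (F \<eta> t) = indicator {0<..} \<eta> * exp (- \<eta> / 2) * norm (\<psi> t)" for \<eta> t
    by (simp add: F_def norm_mult)
  have int_exp: "integrable lborel (\<lambda>\<eta>::real. indicator {0<..} \<eta> * exp (- \<eta> / 2))"
    using integrable_norm[OF integral_exp_half_line(2)[of "-1/2"]] by simp
  have "integrable (lborel \<Otimes>\<^sub>M lborel) (\<lambda>(\<eta>, t). F \<eta> t)"
  proof (rule lborel_pair.Fubini_integrable)
    show "(\<lambda>(\<eta>, t). F \<eta> t) \<in> borel_measurable (lborel \<Otimes>\<^sub>M lborel)"
      unfolding F_def Complex_eq by measurable
    show "integrable lborel (\<lambda>\<eta>. LINT t|lborel. norm (case (\<eta>, t) of (\<eta>, t) \<Rightarrow> F \<eta> t))"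
      unfolding prod.case nF using int_exp by simp
    show "AE \<eta> in lborel. integrable lborel (\<lambda>t. case (\<eta>, t) of (\<eta>, t) \<Rightarrow> F \<eta> t)"
    proof (intro AE_I2)
      fix \<eta> :: real
      have "continuous_on UNIV (\<lambda>t. indicator {0<..} \<eta> *\<^sub>R exp (of_real \<eta> * Complex (-1/2) t) :: complex)"
        by (intro continuous_intros continuous_line)
      hence "(\<lambda>t. indicator {0<..} \<eta> *\<^sub>R exp (of_real \<eta> * Complex (-1/2) t) :: complex) \<in> borel_measurable borel"
        by (rule borel_measurable_continuous_onI)
      hence "(\<lambda>t. F \<eta> t) \<in> borel_measurable lborel" unfolding F_def by measurable
      thus "integrable lborel (\<lambda>t. case (\<eta>, t) of (\<eta>, t) \<Rightarrow> F \<eta> t)"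
        unfolding prod.case
        by (intro Bochner_Integration.integrable_bound[OF integrable_mult_right[OF integrable_norm[OF int\<psi>], of "indicator {0<..} \<eta> * exp (- \<eta> / 2)"]])
           (auto simp: nF)
    qed
  qed
  from lborel_pair.Fubini_integral[OF this]
  have swap: "(LINT t|lborel. LINT \<eta>|lborel. F \<eta> t) = (LINT \<eta>|lborel. LINT t|lborel. F \<eta> t)" .
  have "(LINT \<eta>|lborel. F \<eta> t) = Complex (1/2) t powr (- of_real p) / (1 - Complex (1/2) t) * \<i>" for t
  proof -
    have "(LINT \<eta>|lborel. F \<eta> t) = - 1 / Complex (-1/2) t * \<psi> t"
      unfolding F_def by (subst integral_mult_left_zero, subst integral_exp_half_line(1)) auto
    also have "- 1 / Complex (-1/2) t = 1 / (1 - Complex (1/2) t)"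
    proof -
      have "1 - Complex (1/2) t = - Complex (-1/2) t" by (simp add: complex_eq_iff)
      thus ?thesis by simp
    qed
    finally show ?thesis by (simp add: \<psi>_def)
  qed
  hence "(LINT t|lborel. LINT \<eta>|lborel. F \<eta> t) = vertical_integral (1/2) (\<lambda>s. s powr (- of_real p) / (1 - s))"
    by (simp add: vertical_integral_def)
  also have "\<dots> = 2 * of_real pi * \<i>" by (rule vertical_Cauchy_kernel[OF p])
  finally have left: "(LINT t|lborel. LINT \<eta>|lborel. F \<eta> t) = 2 * of_real pi * \<i>" .
  have "(LINT t|lborel. F \<eta> t) = of_real (indicator {0<..} \<eta> * (\<eta> powr (p - 1) * exp (-\<eta>))) * hankel_integral p" for \<eta>
  proof (cases "\<eta> > 0")
    case True
    have "F \<eta> t = of_real (exp (-\<eta>)) * (exp (of_real \<eta> * Complex (1/2) t) * Complex (1/2) t powr (- of_real p) * \<i>)" for t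
    proof -
      have "of_real \<eta> * Complex (-1/2) t = of_real (- \<eta>) + of_real \<eta> * Complex (1/2) t"
        by (simp add: complex_eq_iff)
      hence "exp (of_real \<eta> * Complex (-1/2) t) = of_real (exp (-\<eta>)) * exp (of_real \<eta> * Complex (1/2) t)"
        by (simp only: exp_add exp_of_real)
      thus ?thesis using True by (simp add: F_def \<psi>_def)
    qed
    hence "(LINT t|lborel. F \<eta> t) = of_real (exp (-\<eta>)) * vertical_integral (1/2) (\<lambda>s. exp (of_real \<eta> * s) * s powr (- of_real p))"
      unfolding vertical_integral_def by (simp only: integral_mult_right_zero)
    also have "\<dots> = of_real (exp (-\<eta>)) * (of_real (\<eta> powr (p - 1)) * hankel_integral p)"
      using True p by (subst vertical_exp_powr_scale) auto
    finally show ?thesis using True by (simp add: mult_ac)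
  qed (simp add: F_def)
  hence "(LINT \<eta>|lborel. LINT t|lborel. F \<eta> t) =
           (LINT \<eta>|lborel. of_real (indicator {0<..} \<eta> * (\<eta> powr (p - 1) * exp (-\<eta>))) * hankel_integral p)"
    by (simp only:)
  also have "\<dots> = of_real (Gamma p) * hankel_integral p"
  proof -
    have "1 < p" using p by simp
    thus ?thesis
      by (simp only: integral_mult_left_zero integral_complex_of_real
            has_bochner_integral_integral_eq[OF Gamma_lborel_integral])
  qed
  finally have "of_real (Gamma p) * hankel_integral p = 2 * of_real pi * \<i>" using swap left by simp
  moreover have "Gamma p > 0" using p by (intro Gamma_real_pos) auto
  ultimately show ?thesis
    by (simp add: rGamma_inverse_Gamma Gamma_complex_of_real field_simps)
qed

text \<open>Both sides satisfy the same recurrence in \<open>p\<close>, so the formula descends from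
  \<open>p \<ge> 2\<close> in unit steps. Stated with the entire function \<open>rGamma\<close>, it
  also covers nonpositive integers \<open>p\<close>.\<close>

lemma hankel_integral_eq:
  "hankel_integral p = 2 * of_real pi * \<i> * rGamma (of_real p)"
proof -
  obtain n :: nat where "2 - p \<le> real n" using real_arch_simple by blast
  hence "p + real n \<ge> 2" by simp
  thus ?thesis
  proof (induction n arbitrary: p)
    case 0
    thus ?case using hankel_integral_ge2[of p] by simp
  next
    case (Suc n)
    have "hankel_integral (p + 1) = 2 * of_real pi * \<i> * rGamma (of_real p + 1)"
      using Suc.IH[of "p + 1"] Suc.prems by (simp add: add_ac)
    thus ?case using rGamma_plus1[of "of_real p :: complex"] hankel_integral_rec[of p] by simp
  qed
qed

section \<open>Scaling the wedge\<close>

lemma open_slit_half_plane: "open (slit_half_plane R)"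
  by (intro open_Diff open_halfspace_Re_lt closed_nonpos_Reals_complex)

lemma wedge_scale: "\<eta> > 0 \<Longrightarrow> wedge (1 / \<eta>) (v / \<eta>) = wedge 1 v / of_real \<eta>"
  by (simp add: wedge_def complex_eq_iff diff_divide_distrib abs_divide)

lemma wedge'_scale: "\<eta> > 0 \<Longrightarrow> wedge' (v / \<eta>) = wedge' v"
  by (simp add: wedge'_def sgn_divide)

text \<open>The condition \<open>\<eta> \<ge> 2\<close> puts the tip \<open>1 / \<eta>\<close> of
  the scaled wedge at most at 1/2, away from the pole at 1. The two conclusions describe the region
  in which \<open>f2_remainder\<close> holds.\<close>

lemma wedge_div_region:
  assumes "\<eta> \<ge> 2"
  shows "Re (wedge 1 v / of_real \<eta>) \<le> 1/2"
    and "- \<bar>Im (wedge 1 v / of_real \<eta>)\<bar> \<le> Re (wedge 1 v / of_real \<eta>)"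
proof -
  have "1 / \<eta> \<le> 1 / 2" using assms by (intro divide_left_mono) auto
  hence "Re (wedge (1 / \<eta>) u) \<le> 1/2" "- \<bar>Im (wedge (1 / \<eta>) u)\<bar> \<le> Re (wedge (1 / \<eta>) u)" for u
    unfolding wedge_def complex.sel using assms zero_le_divide_1_iff[of \<eta>] by linarith+
  moreover have "wedge 1 v / of_real \<eta> = wedge (1 / \<eta>) (v / \<eta>)" using assms by (simp add: wedge_scale)
  ultimately show "Re (wedge 1 v / of_real \<eta>) \<le> 1/2"
    "- \<bar>Im (wedge 1 v / of_real \<eta>)\<bar> \<le> Re (wedge 1 v / of_real \<eta>)" by simp_all
qed

text \<open>The factor \<open>w ^ n\<close> lowers the exponent of Hankel's integral from
  \<open>p\<close> to \<open>p - n\<close>; this is how a Taylor term of \<open>f2\<close> produces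
  \<open>1 / \<Gamma>(p - n)\<close>.\<close>

lemma wedge_power_integral:
  assumes "\<eta> > 0"
  shows "(LINT v|lborel. exp (wedge 1 v) * ((wedge 1 v / of_real \<eta>) ^ n * wedge 1 v powr (- of_real p)) * wedge' v) =
           2 * of_real pi * \<i> * rGamma (of_real (p - real n)) / of_real (\<eta> ^ n)" (is ?th1)
    and "integrable lborel (\<lambda>v. exp (wedge 1 v) * ((wedge 1 v / of_real \<eta>) ^ n * wedge 1 v powr (- of_real p)) * wedge' v)" (is ?th2)
proof -
  have "(wedge 1 v / of_real \<eta>) ^ n * wedge 1 v powr (- of_real p) =
          1 / of_real (\<eta> ^ n) * wedge 1 v powr (- of_real (p - real n))" for v
  proof -
    have "wedge 1 v \<noteq> 0" using norm_wedge_bounds(1)[of v] by auto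
    hence "wedge 1 v ^ n * wedge 1 v powr (- of_real p) = wedge 1 v powr (of_nat n + - of_real p)"
      by (simp only: powr_add) simp
    thus ?thesis by (simp add: power_divide)
  qed
  hence e: "exp (wedge 1 v) * ((wedge 1 v / of_real \<eta>) ^ n * wedge 1 v powr (- of_real p)) * wedge' v =
      1 / of_real (\<eta> ^ n) * (exp (wedge 1 v) * wedge 1 v powr (- of_real (p - real n)) * wedge' v)" for v
    by simp
  show ?th2 unfolding e by (intro integrable_mult_right integrable_hankel)
  show ?th1 unfolding e integral_mult_right_zero
    using hankel_integral_eq[of "p - real n"] by (simp add: hankel_integral_def)
qed

lemma summable_power_exp:
  fixes \<eta> :: real
  assumes "\<eta> > 0"
  shows "summable (\<lambda>n. (real n + 2) ^ m * exp (- \<eta> * real (Suc n)))"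
proof (rule summable_comparison_test_bigo[where g = "\<lambda>n. 1 / real (Suc n) ^ 2"])
  show "summable (\<lambda>n. norm (1 / real (Suc n) ^ 2))"
    using inverse_squares_sums by (simp add: sums_iff add_ac)
  show "(\<lambda>n. (real n + 2) ^ m * exp (- \<eta> * real (Suc n))) \<in> O(\<lambda>n. 1 / real (Suc n) ^ 2)"
    using assms by real_asymp
qed

subsection \<open>The asymptotic expansion\<close>

text \<open>The value 0 of the lower parameter would mean \<open>q = -1/2\<close>, which
  \<open>q \<ge> 0\<close> rules out; the negative integers correspond to the excluded
  half-integers.\<close>

lemma lower_parameter_not_nonpos_Int:
  assumes "q \<ge> (0::real)" "\<And>k::nat. q \<noteq> real k + 1/2"
  shows "of_real (- q - 1/2) \<notin> (\<int>\<^sub>\<le>\<^sub>0 :: complex set)"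
proof
  assume "of_real (- q - 1/2) \<in> (\<int>\<^sub>\<le>\<^sub>0 :: complex set)"
  hence "- q - 1/2 \<in> \<int>\<^sub>\<le>\<^sub>0" by (simp only: of_real_in_nonpos_Ints_iff)
  then obtain n where n: "- q - 1/2 = - real n" by (elim nonpos_Ints_cases')
  with assms(1) have "n \<noteq> 0" by auto
  then obtain k where "n = Suc k" by (cases n) auto
  with n have "q = real k + 1/2" by simp
  with assms(2) show False by blast
qed

context
  fixes q \<beta> :: real
  assumes \<beta>: "\<beta> > 0" and q: "q \<ge> 0" and q_half: "\<And>k::nat. q \<noteq> real k + 1/2"
begin

lemma lower_parameter_ok: "of_real (- q - 1/2) \<notin> (\<int>\<^sub>\<le>\<^sub>0 :: complex set)"
  using lower_parameter_not_nonpos_Int[OF q q_half] .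

lemma f2_holomorphic_on:
  assumes "open S" "S \<inter> \<int> \<subseteq> {0}"
  shows "f2 q \<beta> holomorphic_on S"
  unfolding f2_def[abs_def] using \<beta>
  by (intro holomorphic_intros pi_sin_holomorphic_on assms lower_parameter_ok) auto

lemma f2_holomorphic_slit: "f2 q \<beta> holomorphic_on slit_half_plane 1"
  by (intro f2_holomorphic_on open_slit_half_plane) (auto elim!: Ints_cases simp: complex_nonpos_Reals_iff)

lemma f2_holomorphic_ball: "f2 q \<beta> holomorphic_on ball 0 1"
  by (intro f2_holomorphic_on) (auto elim!: Ints_cases)

lemma a_coeff_sums:
  assumes "norm s < 1"
  shows "(\<lambda>n. a_coeff q \<beta> n * s ^ n) sums f2 q \<beta> s"
  using holomorphic_power_series[OF f2_holomorphic_ball, of s] assms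
  by (simp add: a_coeff_def fps_expansion_def)

lemma kummer_minus_half_bound:
  obtains C m where "C \<ge> 0" "\<And>z. Re z \<le> R \<Longrightarrow> norm (kummer (- 1/2) (of_real (- q - 1/2)) z) \<le> C * (1 + norm z) ^ m"
proof -
  obtain C m where C: "\<And>z. Re z \<le> R \<Longrightarrow> norm (kummer (of_real (1/2 - 1)) (of_real (- q - 1/2)) z) \<le> C * (1 + norm z) ^ m"
    using kummer_poly_bound_lower[of "1/2" "- q - 1/2" R] lower_parameter_ok by auto
  have "norm (kummer (- 1/2) (of_real (- q - 1/2)) z) \<le> \<bar>C\<bar> * (1 + norm z) ^ m" if "Re z \<le> R" for z
  proof -
    have "norm (kummer (- 1/2) (of_real (- q - 1/2)) z) \<le> C * (1 + norm z) ^ m" using C[OF that] by simp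
    also have "\<dots> \<le> \<bar>C\<bar> * (1 + norm z) ^ m" by (intro mult_right_mono) auto
    finally show ?thesis .
  qed
  thus ?thesis using that[of "\<bar>C\<bar>" m] by simp
qed

text \<open>Since \<open>- |Im s| \<le> Re s \<le> 1\<close>, the modulus of \<open>s\<close> is
  controlled by \<open>|Im s|\<close>, so the exponential decay of \<open>pi_sin\<close> in the
  height outweighs the polynomial growth of Kummer's function.\<close>

lemma f2_bounded_wedge:
  obtains C where "C \<ge> 0"
    "\<And>s. \<bar>Im s\<bar> \<ge> 1/2 \<Longrightarrow> Re s \<le> 1 \<Longrightarrow> - \<bar>Im s\<bar> \<le> Re s \<Longrightarrow> norm (f2 q \<beta> s) \<le> C"
proof -
  obtain C m where C: "C \<ge> 0" "\<And>z. Re z \<le> 2 / \<beta> \<Longrightarrow> norm (kummer (- 1/2) (of_real (- q - 1/2)) z) \<le> C * (1 + norm z) ^ m"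
    using kummer_minus_half_bound by metis
  obtain K where K: "\<And>v::real. exp (1 - \<bar>v\<bar>) * (2 + 2 * \<bar>v\<bar>) powr real (Suc m) \<le> K / (1 + v ^ 2)"
    using exp_weight_bound by blast
  define D where "D = 4 * pi * C * (1 + 2 / \<beta>) ^ m"
  have D: "D \<ge> 0" using C \<beta> by (simp add: D_def)
  have "norm (f2 q \<beta> s) \<le> D * \<bar>K\<bar>" if s: "\<bar>Im s\<bar> \<ge> 1/2" "Re s \<le> 1" "- \<bar>Im s\<bar> \<le> Re s" for s
  proof -
    \<comment> \<open>Chosen to match the weight in \<open>exp_weight_bound\<close>; for the same
      reason \<open>exp (- \<pi> |Im s|)\<close> is weakened below to
      \<open>exp (1 - |Im s|)\<close>.\<close>
    define u where "u = 2 + 2 * \<bar>Im s\<bar>"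
    have u: "u \<ge> 1" "norm s \<le> u" using cmod_le[of s] s by (auto simp: u_def)
    have "Re (2 * s / of_real \<beta>) \<le> 2 / \<beta>" using s \<beta> by (simp add: divide_right_mono)
    from C(2)[OF this]
    have "norm (kummer (- 1/2) (of_real (- q - 1/2)) (2 * s / of_real \<beta>)) \<le> C * (1 + 2 * norm s / \<beta>) ^ m"
      using \<beta> by (simp add: norm_divide norm_mult)
    also have "\<dots> \<le> C * ((1 + 2 / \<beta>) * u) ^ m"
    proof (intro mult_left_mono power_mono C)
      have "2 * norm s / \<beta> \<le> 2 / \<beta> * u" using u \<beta> by (simp add: divide_right_mono)
      thus "1 + 2 * norm s / \<beta> \<le> (1 + 2 / \<beta>) * u" using u by (simp add: ring_distribs)
    qed (use \<beta> in auto)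
    finally have k: "norm (kummer (- 1/2) (of_real (- q - 1/2)) (2 * s / of_real \<beta>)) \<le> C * ((1 + 2 / \<beta>) * u) ^ m" .
    have "norm (pi_sin s) \<le> 4 * pi * norm s * exp (- pi * \<bar>Im s\<bar>)" by (rule norm_pi_sin_le) (use s in auto)
    also have "\<dots> \<le> 4 * pi * u * exp (1 - \<bar>Im s\<bar>)"
    proof (intro mult_mono)
      have "1 * \<bar>Im s\<bar> \<le> pi * \<bar>Im s\<bar>" using pi_gt3 by (intro mult_right_mono) auto
      thus "exp (- pi * \<bar>Im s\<bar>) \<le> exp (1 - \<bar>Im s\<bar>)" by simp
    qed (use u in auto)
    finally have "norm (f2 q \<beta> s) \<le> (4 * pi * u * exp (1 - \<bar>Im s\<bar>)) * (C * ((1 + 2 / \<beta>) * u) ^ m)"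
      unfolding f2_def norm_mult using k u by (intro mult_mono) auto
    also have "\<dots> = D * (exp (1 - \<bar>Im s\<bar>) * u ^ Suc m)"
      by (simp add: D_def power_mult_distrib mult_ac)
    also have "u ^ Suc m = u powr real (Suc m)" using u by (intro powr_realpow[symmetric]) auto
    also have "D * (exp (1 - \<bar>Im s\<bar>) * u powr real (Suc m)) \<le> D * (K / (1 + (Im s) ^ 2))"
      unfolding u_def by (intro mult_left_mono K D)
    also have "\<dots> \<le> D * \<bar>K\<bar>"
    proof (intro mult_left_mono D)
      have "K / (1 + (Im s) ^ 2) \<le> \<bar>K\<bar> / (1 + (Im s) ^ 2)" by (intro divide_right_mono) auto
      also have "\<dots> \<le> \<bar>K\<bar> / 1" by (intro divide_left_mono) (auto simp: add_pos_nonneg)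
      finally show "K / (1 + (Im s) ^ 2) \<le> \<bar>K\<bar>" by simp
    qed
    finally show ?thesis .
  qed
  thus ?thesis using that[of "D * \<bar>K\<bar>"] D by simp
qed

text \<open>For \<open>|s| < 3/4\<close> the tail of the power series carries the factor
  \<open>s ^ N\<close>. For \<open>|s| \<ge> 3/4\<close> the lower powers, including the constant
  that bounds \<open>f2\<close>, are at most \<open>(4/3)^N |s|^N\<close>, because
  \<open>4/3 * |s| \<ge> 1\<close>.\<close>

lemma f2_remainder:
  obtains C where "C \<ge> 0"
    "\<And>s. Re s \<le> 1/2 \<Longrightarrow> - \<bar>Im s\<bar> \<le> Re s \<Longrightarrow>
       norm (f2 q \<beta> s - (\<Sum>n<N. a_coeff q \<beta> n * s ^ n)) \<le> C * norm s ^ N"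
proof -
  obtain B where B: "B \<ge> 0"
    "\<And>s. \<bar>Im s\<bar> \<ge> 1/2 \<Longrightarrow> Re s \<le> 1 \<Longrightarrow> - \<bar>Im s\<bar> \<le> Re s \<Longrightarrow> norm (f2 q \<beta> s) \<le> B"
    using f2_bounded_wedge by metis
  let ?a = "a_coeff q \<beta>"
  \<comment> \<open>Any radius strictly between 3/4 and 1 would do: convergence there gives absolute
    convergence at 3/4.\<close>
  have "summable (\<lambda>n. ?a n * (7/8) ^ n)"
    using a_coeff_sums[of "7/8"] by (simp add: sums_iff)
  hence "summable (\<lambda>n. norm (?a n * (3/4) ^ n))" by (rule powser_insidea) simp
  hence "summable (\<lambda>n. norm (?a (n + N) * (3/4) ^ (n + N)))" by (rule summable_ignore_initial_segment)
  hence "summable (\<lambda>n. (4/3) ^ N * norm (?a (n + N) * (3/4) ^ (n + N)))" by (rule summable_mult)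
  moreover have "(4/3) ^ N * norm (?a (n + N) * (3/4) ^ (n + N)) = norm (?a (n + N)) * (3/4) ^ n" for n
  proof -
    have e1: "(4/3) ^ N * (3/4) ^ N = (1::real)" by (simp flip: power_mult_distrib)
    have e2: "norm (?a (n + N) * (3/4) ^ (n + N)) = norm (?a (n + N)) * (3/4) ^ n * (3/4) ^ N"
      by (simp add: norm_mult norm_power power_add)
    show ?thesis unfolding e2 by (subst mult.left_commute) (simp only: e1 mult_1_right)
  qed
  ultimately have sm: "summable (\<lambda>n. norm (?a (n + N)) * (3/4) ^ n)" by simp
  define A1 where "A1 = (\<Sum>n. norm (?a (n + N)) * (3/4) ^ n)"
  define A2 where "A2 = (B + (\<Sum>n<N. norm (?a n))) * (4/3) ^ N"
  have A1: "A1 \<ge> 0" unfolding A1_def by (intro suminf_nonneg sm) auto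
  have A2: "A2 \<ge> 0" unfolding A2_def using B(1) by (intro mult_nonneg_nonneg add_nonneg_nonneg sum_nonneg) auto
  have "norm (f2 q \<beta> s - (\<Sum>n<N. ?a n * s ^ n)) \<le> (A1 + A2) * norm s ^ N"
    if s: "Re s \<le> 1/2" "- \<bar>Im s\<bar> \<le> Re s" for s
  proof (cases "norm s < 3/4")
    case True
    have "(\<lambda>n. ?a (n + N) * s ^ (n + N)) sums (f2 q \<beta> s - (\<Sum>n<N. ?a n * s ^ n))"
      using sums_split_initial_segment[OF a_coeff_sums[of s], of N] True by simp
    hence eq: "f2 q \<beta> s - (\<Sum>n<N. ?a n * s ^ n) = (\<Sum>n. ?a (n + N) * s ^ (n + N))" by (rule sums_unique)
    have le: "norm (?a (n + N) * s ^ (n + N)) \<le> norm (?a (n + N)) * (3/4) ^ n * norm s ^ N" for n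
    proof -
      have "norm (?a (n + N) * s ^ (n + N)) = norm (?a (n + N)) * norm s ^ n * norm s ^ N"
        by (simp add: norm_mult norm_power power_add)
      also have "\<dots> \<le> norm (?a (n + N)) * (3/4) ^ n * norm s ^ N"
        using True by (intro mult_right_mono mult_left_mono power_mono) auto
      finally show ?thesis .
    qed
    have "norm (f2 q \<beta> s - (\<Sum>n<N. ?a n * s ^ n)) \<le> (\<Sum>n. norm (?a (n + N)) * (3/4) ^ n * norm s ^ N)"
      unfolding eq by (rule norm_suminf_le[OF le summable_mult2[OF sm]])
    also have "\<dots> = A1 * norm s ^ N" unfolding A1_def by (rule suminf_mult2[OF sm, symmetric])
    also have "\<dots> \<le> (A1 + A2) * norm s ^ N" using A2 by (intro mult_right_mono) auto
    finally show ?thesis .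
  next
    case False
    \<comment> \<open>This explains the radius 3/4: if \<open>|Im s| < 1/2\<close>, the region also
      forces \<open>|Re s| \<le> 1/2\<close>, so \<open>|s|\<^sup>2\<close> is at most 1/2, which is
      less than 9/16.\<close>
    have Im: "\<bar>Im s\<bar> \<ge> 1/2"
    proof (rule ccontr)
      assume "\<not> ?thesis"
      hence *: "\<bar>Im s\<bar> < 1/2" "\<bar>Re s\<bar> \<le> 1/2" using s by auto
      have "norm s ^ 2 = \<bar>Re s\<bar> ^ 2 + \<bar>Im s\<bar> ^ 2" by (simp add: cmod_power2)
      also have "\<dots> \<le> (1/2) ^ 2 + (1/2) ^ 2" using * by (intro add_mono power_mono) auto
      also have "\<dots> < (3/4) ^ 2" by (simp add: power2_eq_square)
      finally have "norm s < 3/4" by (rule power_less_imp_less_base) simp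
      with False show False by simp
    qed
    have pw: "norm s ^ n \<le> (4/3) ^ N * norm s ^ N" if "n \<le> N" for n
    proof -
      have "norm s ^ n \<le> (4/3 * norm s) ^ n" by (intro power_mono) auto
      also have "\<dots> \<le> (4/3 * norm s) ^ N" using that False by (intro power_increasing) auto
      finally show ?thesis by (simp only: power_mult_distrib)
    qed
    have "norm (f2 q \<beta> s - (\<Sum>n<N. ?a n * s ^ n)) \<le> norm (f2 q \<beta> s) + (\<Sum>n<N. norm (?a n * s ^ n))"
      by (intro order_trans[OF norm_triangle_ineq4] add_mono norm_sum) auto
    also have "\<dots> \<le> B * ((4/3) ^ N * norm s ^ N) + (\<Sum>n<N. norm (?a n) * ((4/3) ^ N * norm s ^ N))"
    proof (intro add_mono sum_mono)
      have "norm (f2 q \<beta> s) \<le> B * norm s ^ 0" using B(2)[of s] Im s by simp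
      also have "\<dots> \<le> B * ((4/3) ^ N * norm s ^ N)" by (intro mult_left_mono pw B) auto
      finally show "norm (f2 q \<beta> s) \<le> B * ((4/3) ^ N * norm s ^ N)" .
      fix n assume "n \<in> {..<N}"
      thus "norm (?a n * s ^ n) \<le> norm (?a n) * ((4/3) ^ N * norm s ^ N)"
        unfolding norm_mult norm_power by (intro mult_left_mono pw) auto
    qed
    also have "\<dots> = A2 * norm s ^ N" by (simp only: A2_def sum_distrib_right[symmetric] distrib_right mult.assoc)
    also have "\<dots> \<le> (A1 + A2) * norm s ^ N" using A1 by (intro mult_right_mono) auto
    finally show ?thesis .
  qed
  thus ?thesis using that[of "A1 + A2"] A1 A2 by simp
qed

lemma continuous_f2_wedge:
  assumes "\<eta> > 1"
  shows "continuous_on UNIV (\<lambda>v. f2 q \<beta> (wedge 1 v / of_real \<eta>))"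
proof (rule continuous_on_compose2[OF holomorphic_on_imp_continuous_on[OF f2_holomorphic_slit]])
  show "continuous_on UNIV (\<lambda>v. wedge 1 v / of_real \<eta>)"
    using assms by (intro continuous_intros continuous_wedge) auto
  show "(\<lambda>v. wedge 1 v / of_real \<eta>) ` UNIV \<subseteq> slit_half_plane 1"
    using assms wedge_in_slit[of "1 / \<eta>" 1] by (auto simp: wedge_scale[symmetric] simp del: Diff_iff)
qed

lemma integrable_f2_wedge:
  assumes "\<eta> \<ge> 2"
  shows "integrable lborel (\<lambda>v. exp (wedge 1 v) * (f2 q \<beta> (wedge 1 v / of_real \<eta>) * wedge 1 v powr (- of_real r)) * wedge' v)"
proof -
  \<comment> \<open>With \<open>N = 0\<close> the sum is empty, and the remainder estimate is a
    bound for \<open>f2\<close> on the whole region, including the neighbourhood of 0.\<close>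
  obtain C where C: "C \<ge> 0"
    "\<And>s. Re s \<le> 1/2 \<Longrightarrow> - \<bar>Im s\<bar> \<le> Re s \<Longrightarrow> norm (f2 q \<beta> s - (\<Sum>n<0. a_coeff q \<beta> n * s ^ n)) \<le> C * norm s ^ 0"
    using f2_remainder[of 0] by metis
  show ?thesis
  proof (rule integrable_exp_wedge[where C = C and k = "\<bar>r\<bar>"])
    show "continuous_on UNIV (\<lambda>v. f2 q \<beta> (wedge 1 v / of_real \<eta>) * wedge 1 v powr (- of_real r))"
      using assms by (intro continuous_on_mult continuous_f2_wedge continuous_wedge_powr) auto
    fix v
    have "norm (f2 q \<beta> (wedge 1 v / of_real \<eta>)) \<le> C"
      using C(2)[OF wedge_div_region[OF assms]] by simp
    thus "norm (f2 q \<beta> (wedge 1 v / of_real \<eta>) * wedge 1 v powr (- of_real r)) \<le> C * (2 + 2 * \<bar>v\<bar>) powr \<bar>r\<bar>"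
      unfolding norm_mult norm_powr_minus_of_real
      using norm_wedge_powr_le[of v "-r"] C(1) by (intro mult_mono) auto
  qed
qed

text \<open>The tip of the wedge is placed at \<open>1 / \<eta>\<close> so that the substitution
  \<open>s = w / \<eta>\<close> leads to a contour independent of \<eta>: the exponential becomes
  \<open>exp w\<close>, and \<eta> survives only in the argument of \<open>f2\<close> and in a power
  in front.\<close>

lemma F2_eq_wedge_integral:
  assumes \<eta>: "\<eta> \<ge> 2" and c: "0 < c" "c < 1"
  shows "F2 c q \<eta> \<beta> = 1 / (2 * of_real pi * \<i>) * of_real (\<eta> powr (q + 3/2)) *
    (LINT v|lborel. exp (wedge 1 v) * (f2 q \<beta> (wedge 1 v / of_real \<eta>) * wedge 1 v powr (- of_real (q + 5/2))) * wedge' v)"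
proof -
  define p where "p = q + 5/2"
  have p: "p \<ge> 2" using q by (simp add: p_def)
  define g where "g = (\<lambda>s. exp (of_real \<eta> * s) * (f2 q \<beta> s * s powr (- of_real p)))"
  define \<Phi> where "\<Phi> = (\<lambda>v. exp (wedge 1 v) * (f2 q \<beta> (wedge 1 v / of_real \<eta>) * wedge 1 v powr (- of_real p)) * wedge' v)"
  obtain C where C: "C \<ge> 0"
    "\<And>s. \<bar>Im s\<bar> \<ge> 1/2 \<Longrightarrow> Re s \<le> 1 \<Longrightarrow> - \<bar>Im s\<bar> \<le> Re s \<Longrightarrow> norm (f2 q \<beta> s) \<le> C"
    using f2_bounded_wedge by metis
  have geq: "exp (of_real \<eta> * s) * f2 q \<beta> s / s powr of_real p = g s" for s
    by (simp add: g_def powr_minus divide_inverse)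
  have ghol: "g holomorphic_on slit_half_plane 1"
    unfolding g_def by (intro holomorphic_intros f2_holomorphic_slit) auto
  have y: "0 < 1 / \<eta>" "1 / \<eta> < 1" using \<eta> by auto
  \<comment> \<open>The factor \<open>\<eta> powr p\<close> is the positive scale pulled out of the
    principal power; with the Jacobian \<open>1 / \<eta>\<close> it becomes
    \<open>\<eta> powr (q + 3/2)\<close>.\<close>
  have scale: "g (wedge (1 / \<eta>) (0 + 1 / \<eta> * v)) * wedge' (0 + 1 / \<eta> * v) = of_real (\<eta> powr p) * \<Phi> v" for v
  proof -
    have w: "wedge (1 / \<eta>) (0 + 1 / \<eta> * v) = wedge 1 v / of_real \<eta>" "wedge' (0 + 1 / \<eta> * v) = wedge' v"
      using \<eta> wedge_scale[of \<eta> v] wedge'_scale[of \<eta> v] by simp_all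
    have "wedge 1 v powr (- of_real p) = (of_real \<eta> * (wedge 1 v / of_real \<eta>)) powr (- of_real p)"
      using \<eta> by simp
    also have "\<dots> = of_real (\<eta> powr (- p)) * (wedge 1 v / of_real \<eta>) powr (- of_real p)"
      using \<eta> powr_of_real[of \<eta> "-p"] by (subst powr_times_real_left) auto
    finally have "of_real (\<eta> powr p) * wedge 1 v powr (- of_real p) =
        of_real (\<eta> powr p * \<eta> powr (- p)) * (wedge 1 v / of_real \<eta>) powr (- of_real p)" by simp
    also have "\<eta> powr p * \<eta> powr (- p) = 1" using \<eta> by (simp flip: powr_add)
    finally have e: "(wedge 1 v / of_real \<eta>) powr (- of_real p) = of_real (\<eta> powr p) * wedge 1 v powr (- of_real p)"
      by simp
    show ?thesis unfolding w g_def e \<Phi>_def using \<eta> by simp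
  qed
  have int_wedge: "integrable lborel (\<lambda>v. g (wedge (1 / \<eta>) v) * wedge' v)"
  proof -
    have "integrable lborel (\<lambda>v. of_real (\<eta> powr p) * \<Phi> v)"
      unfolding \<Phi>_def by (intro integrable_mult_right integrable_f2_wedge \<eta>)
    thus ?thesis
      using lborel_integrable_real_affine_iff[of "1 / \<eta>" "\<lambda>v. g (wedge (1 / \<eta>) v) * wedge' v" 0] \<eta>
      by (simp only: scale) simp
  qed
  have int_line: "integrable lborel (\<lambda>t. g (Complex c t) * \<i>)"
  proof (rule integrable_line)
    have "continuous_on UNIV (\<lambda>t. g (Complex c t))"
      by (rule continuous_on_Complex_line[OF holomorphic_on_imp_continuous_on[OF ghol]]) (intro line_in_slit c)
    thus "continuous_on UNIV (\<lambda>t. g (Complex c t) * \<i>)" by (rule continuous_on_mult_right)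
    fix t :: real assume t: "\<bar>t\<bar> \<ge> 1/2"
    have "norm (g (Complex c t) * \<i>) = exp (\<eta> * c) * (norm (f2 q \<beta> (Complex c t)) * norm (Complex c t powr (- of_real p)))"
      by (simp add: g_def norm_mult)
    also have "\<dots> \<le> exp (\<eta> * c) * (C * (5 * 2 powr p / (1 + t ^ 2)))"
      using c t C(1) by (intro mult_left_mono mult_mono C(2) norm_line_powr_le p) auto
    finally show "norm (g (Complex c t) * \<i>) \<le> (exp (\<eta> * c) * C * 5 * 2 powr p) / (1 + t ^ 2)"
      by (simp add: mult_ac)
  qed
  have "vertical_integral c g = (LINT v|lborel. g (wedge (1 / \<eta>) v) * wedge' v)"
  proof (rule line_to_wedge[symmetric, where R = 1 and D = "exp (\<eta> * max c (1 / \<eta>)) * C"])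
    fix s :: complex assume s: "\<bar>Im s\<bar> \<ge> 1" "Re s \<le> max c (1 / \<eta>)" "- \<bar>Im s\<bar> \<le> Re s"
    have n: "norm s \<ge> \<bar>Im s\<bar>" by (rule abs_Im_le_cmod)
    have "Re s \<le> 1" using s c y by linarith
    hence f: "norm (f2 q \<beta> s) \<le> C" using s by (intro C(2)) auto
    have pw: "norm (s powr (- of_real p)) \<le> 1 / norm s ^ 2"
      using s n by (intro powr_minus_le_inverse_square p) auto
    have "1 / norm s ^ 2 \<le> 1 / \<bar>Im s\<bar> ^ 2" using s n by (intro divide_left_mono power_mono mult_pos_pos) auto
    with pw have pw': "norm (s powr (- of_real p)) \<le> 1 / \<bar>Im s\<bar> ^ 2" by linarith
    have "norm (g s) = exp (\<eta> * Re s) * (norm (f2 q \<beta> s) * norm (s powr (- of_real p)))"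
      by (simp add: g_def norm_mult)
    also have "\<dots> \<le> exp (\<eta> * max c (1 / \<eta>)) * (C * (1 / \<bar>Im s\<bar> ^ 2))"
      using s \<eta> C(1) f pw' by (intro mult_mono) auto
    finally show "norm (g s) \<le> exp (\<eta> * max c (1 / \<eta>)) * C / \<bar>Im s\<bar> ^ 2" by simp
  qed (use c y ghol int_wedge int_line in auto)
  also have "\<dots> = \<bar>1 / \<eta>\<bar> *\<^sub>R (LINT v|lborel. g (wedge (1 / \<eta>) (0 + 1 / \<eta> * v)) * wedge' (0 + 1 / \<eta> * v))"
    using \<eta> by (intro lborel_integral_real_affine) auto
  also have "\<dots> = of_real (\<eta> powr p / \<eta>) * (LINT v|lborel. \<Phi> v)"
    unfolding scale using \<eta> by (simp add: scaleR_conv_of_real)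
  also have "\<eta> powr p / \<eta> = \<eta> powr (q + 3/2)"
  proof -
    have "p = q + 3/2 + 1" by (simp add: p_def)
    hence "\<eta> powr p = \<eta> powr (q + 3/2 + 1)" by (simp only:)
    also have "\<dots> = \<eta> powr (q + 3/2) * \<eta>" using \<eta> by (subst powr_add) auto
    finally show ?thesis using \<eta> by simp
  qed
  finally show ?thesis
    unfolding F2_def p_def[symmetric] geq by (simp add: \<Phi>_def)
qed

text \<open>On the scaled wedge the Taylor remainder of \<open>f2\<close> is at most
  \<open>C |w|^N / \<eta>^N\<close>. The power of \<eta> leaves the integral, and what remains is
  bounded by a convergent integral that does not depend on \<eta>.\<close>

lemma F2_expansion:
  assumes c: "0 < c" "c < 1"
  shows "(\<lambda>\<eta>. F2 c q \<eta> \<beta> - of_real (\<eta> powr (q + 3/2))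
                  * (\<Sum>n<N. 1 / of_real (Gamma (q + 5/2 - real n)) * (a_coeff q \<beta> n / of_real (\<eta> ^ n))))
          \<in> O[at_top](\<lambda>\<eta>. of_real (\<eta> powr (q + 3/2 - real N)))"
proof -
  define p where "p = q + 5/2"
  obtain C where C: "C \<ge> 0"
    "\<And>s. Re s \<le> 1/2 \<Longrightarrow> - \<bar>Im s\<bar> \<le> Re s \<Longrightarrow>
       norm (f2 q \<beta> s - (\<Sum>n<N. a_coeff q \<beta> n * s ^ n)) \<le> C * norm s ^ N"
    using f2_remainder[of N] by metis
  \<comment> \<open>A majorant of \<open>|exp w| |w|^(N - p)\<close> on the wedge; the absolute
    value of the exponent covers both \<open>N < p\<close> and \<open>N > p\<close>.\<close>
  define W where "W = (\<lambda>v::real. exp (1 - \<bar>v\<bar>) * (2 + 2 * \<bar>v\<bar>) powr \<bar>real N - p\<bar>)"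
  define J where "J = (LINT v|lborel. W v)"
  have intW: "integrable lborel W" unfolding W_def by (rule integrable_exp_powr_weight)
  have "norm (F2 c q \<eta> \<beta> - of_real (\<eta> powr (q + 3/2))
          * (\<Sum>n<N. 1 / of_real (Gamma (q + 5/2 - real n)) * (a_coeff q \<beta> n / of_real (\<eta> ^ n))))
        \<le> (C * J / pi) * norm (of_real (\<eta> powr (q + 3/2 - real N)) :: complex)" if \<eta>: "\<eta> \<ge> 2" for \<eta>
  proof -
    define w where "w = wedge 1"
    define T where "T = (\<lambda>n v. exp (w v) * ((w v / of_real \<eta>) ^ n * w v powr (- of_real p)) * wedge' v)"
    define \<Phi> where "\<Phi> = (\<lambda>v. exp (w v) * (f2 q \<beta> (w v / of_real \<eta>) * w v powr (- of_real p)) * wedge' v)"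
    define R where "R = (\<lambda>v. \<Phi> v - (\<Sum>n<N. a_coeff q \<beta> n * T n v))"
    have intT: "integrable lborel (T n)" "(LINT v|lborel. T n v) = 2 * of_real pi * \<i> * rGamma (of_real (p - real n)) / of_real (\<eta> ^ n)" for n
      unfolding T_def w_def using \<eta> wedge_power_integral[of \<eta> n p] by auto
    have int\<Phi>: "integrable lborel \<Phi>"
      unfolding \<Phi>_def w_def by (rule integrable_f2_wedge[OF \<eta>])
    have "(LINT v|lborel. R v) = (LINT v|lborel. \<Phi> v) - (\<Sum>n<N. a_coeff q \<beta> n * (LINT v|lborel. T n v))"
      unfolding R_def using int\<Phi> intT(1) by simp
    also have "\<dots> = (LINT v|lborel. \<Phi> v) - 2 * of_real pi * \<i> *
        (\<Sum>n<N. 1 / of_real (Gamma (q + 5/2 - real n)) * (a_coeff q \<beta> n / of_real (\<eta> ^ n)))"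
    proof -
      have rG: "rGamma (of_real x) = 1 / complex_of_real (Gamma x)" for x
        by (simp add: rGamma_inverse_Gamma Gamma_complex_of_real divide_inverse)
      have "a * (k * r / e) = k * (r * (a / e))" for a k r e :: complex by simp
      thus ?thesis unfolding intT(2) sum_distrib_left rG p_def by (simp only:)
    qed
    finally have IR: "(LINT v|lborel. R v) = (LINT v|lborel. \<Phi> v) - 2 * of_real pi * \<i> *
        (\<Sum>n<N. 1 / of_real (Gamma (q + 5/2 - real n)) * (a_coeff q \<beta> n / of_real (\<eta> ^ n)))" .
    have eqF: "F2 c q \<eta> \<beta> - of_real (\<eta> powr (q + 3/2))
          * (\<Sum>n<N. 1 / of_real (Gamma (q + 5/2 - real n)) * (a_coeff q \<beta> n / of_real (\<eta> ^ n))) =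
        1 / (2 * of_real pi * \<i>) * of_real (\<eta> powr (q + 3/2)) * (LINT v|lborel. R v)"
    proof -
      have "k * P * I - P * S = k * P * (I - K * S)" if "k * K = 1" for k K P I S :: complex
      proof -
        have "k * P * (I - K * S) = k * P * I - (k * K) * (P * S)" by (simp add: algebra_simps)
        thus ?thesis using that by simp
      qed
      note alg = this[of "1 / (2 * of_real pi * \<i>)" "2 * of_real pi * \<i>"]
      show ?thesis
        unfolding F2_eq_wedge_integral[OF \<eta> c, folded p_def w_def, folded \<Phi>_def] IR
        by (rule alg) simp
    qed
    \<comment> \<open>The 2 bounds the modulus of \<open>wedge'\<close>; the rest is the remainder
      constant \<open>C\<close> and the factor \<open>1 / \<eta> ^ N\<close>.\<close>
    have "norm (LINT v|lborel. R v) \<le> (LINT v|lborel. 2 * C / \<eta> ^ N * W v)"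
    proof (rule Bochner_Integration.integral_norm_bound_integral)
      show "integrable lborel R"
        unfolding R_def using int\<Phi> intT(1) by auto
      show "integrable lborel (\<lambda>v. 2 * C / \<eta> ^ N * W v)" by (intro integrable_mult_right intW)
      fix v
      have "R v = exp (w v) * ((f2 q \<beta> (w v / of_real \<eta>) - (\<Sum>n<N. a_coeff q \<beta> n * (w v / of_real \<eta>) ^ n)) * w v powr (- of_real p)) * wedge' v"
      proof -
        have "(\<Sum>n<N. a_coeff q \<beta> n * T n v) =
            exp (w v) * ((\<Sum>n<N. a_coeff q \<beta> n * (w v / of_real \<eta>) ^ n) * w v powr (- of_real p)) * wedge' v"
          unfolding T_def sum_distrib_left sum_distrib_right by (intro sum.cong refl) (simp only: mult_ac)
        thus ?thesis by (simp only: R_def \<Phi>_def left_diff_distrib right_diff_distrib)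
      qed
      also have "norm \<dots> \<le> exp (1 - \<bar>v\<bar>) * ((C * norm (w v / of_real \<eta>) ^ N) * norm (w v) powr (- p)) * 2"
        unfolding norm_mult norm_powr_minus_of_real unfolding w_def norm_exp_wedge
        using C(1) by (intro mult_mono norm_wedge'_le C(2) wedge_div_region[OF \<eta>]) auto
      also have "\<dots> = 2 * C / \<eta> ^ N * (exp (1 - \<bar>v\<bar>) * (norm (w v) ^ N * norm (w v) powr (-p)))"
        using \<eta> by (simp add: norm_divide power_divide)
      also have "norm (w v) ^ N * norm (w v) powr (-p) = norm (w v) powr (real N - p)"
      proof -
        have "norm (w v) > 0" using norm_wedge_bounds(1)[of v] unfolding w_def by linarith
        thus ?thesis using powr_add[of "norm (w v)" "real N" "-p"] powr_realpow[of "norm (w v)" N] by simp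
      qed
      also have "2 * C / \<eta> ^ N * (exp (1 - \<bar>v\<bar>) * norm (w v) powr (real N - p)) \<le> 2 * C / \<eta> ^ N * W v"
        unfolding W_def w_def using C(1) \<eta> by (intro mult_left_mono norm_wedge_powr_le) auto
      finally show "norm (R v) \<le> 2 * C / \<eta> ^ N * W v" .
    qed
    also have "(LINT v|lborel. 2 * C / \<eta> ^ N * W v) = 2 * C / \<eta> ^ N * J"
      unfolding J_def by (rule integral_mult_right_zero)
    finally have IB: "norm (LINT v|lborel. R v) \<le> 2 * C / \<eta> ^ N * J" .
    have "norm (F2 c q \<eta> \<beta> - of_real (\<eta> powr (q + 3/2))
          * (\<Sum>n<N. 1 / of_real (Gamma (q + 5/2 - real n)) * (a_coeff q \<beta> n / of_real (\<eta> ^ n)))) =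
        1 / (2 * pi) * \<eta> powr (q + 3/2) * norm (LINT v|lborel. R v)"
      using eqF by (simp add: norm_mult norm_divide)
    also have "\<dots> \<le> 1 / (2 * pi) * \<eta> powr (q + 3/2) * (2 * C / \<eta> ^ N * J)"
      by (intro mult_left_mono IB) auto
    also have "1 / (2 * pi) * \<eta> powr (q + 3/2) * (2 * C / \<eta> ^ N * J) = (C * J / pi) * (\<eta> powr (q + 3/2) / \<eta> ^ N)"
      by simp
    also have "\<eta> powr (q + 3/2) / \<eta> ^ N = \<eta> powr (q + 3/2 - real N)"
      using \<eta> powr_realpow[of \<eta> N] powr_diff[of \<eta> "q + 3/2" "real N"] by simp
    finally show ?thesis by simp
  qed
  thus ?thesis
    by (intro bigoI[where c = "C * J / pi"] eventually_mono[OF eventually_ge_at_top[of 2]]) auto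
qed

text \<open>\<open>C\<close> and \<open>m\<close> are independent of \<eta>, so one bound yields
  both the summability for each positive \<eta> and the decay of \<open>E\<close> as \<eta>
  grows.\<close>

lemma exp_term_bound:
  obtains C m where "C \<ge> 0" "\<And>\<eta> n. norm (exp_term q \<beta> \<eta> (Suc n)) \<le> C * (real n + 2) ^ m * exp (- \<eta> * real (Suc n))"
proof -
  obtain C m where C: "C \<ge> 0" "\<And>z. Re z \<le> 0 \<Longrightarrow> norm (kummer (- 1/2) (of_real (- q - 1/2)) z) \<le> C * (1 + norm z) ^ m"
    using kummer_minus_half_bound by metis
  have "norm (exp_term q \<beta> \<eta> (Suc n)) \<le> C * (1 + 2 / \<beta>) ^ m * (real n + 2) ^ m * exp (- \<eta> * real (Suc n))" for \<eta> n
  proof -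
    let ?z = "of_real (- 2 * real (Suc n) / \<beta>) :: complex"
    have z: "Re ?z \<le> 0" "norm ?z = 2 / \<beta> * real (Suc n)"
      unfolding norm_of_real using \<beta> by (simp_all add: abs_mult abs_divide divide_nonpos_pos)
    have "norm (kummer (- 1/2) (of_real (- q - 1/2)) ?z) \<le> C * (1 + 2 / \<beta> * real (Suc n)) ^ m"
      using C(2)[OF z(1)] unfolding z(2) .
    also have "\<dots> \<le> C * ((1 + 2 / \<beta>) * (real n + 2)) ^ m"
    proof (intro mult_left_mono power_mono C)
      have *: "2 / \<beta> * real (Suc n) \<le> 2 / \<beta> * (real n + 2)" using \<beta> by (intro mult_left_mono) auto
      show "1 + 2 / \<beta> * real (Suc n) \<le> (1 + 2 / \<beta>) * (real n + 2)"
        unfolding ring_distribs(2) by (rule add_mono[OF _ *]) simp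
    qed (use \<beta> in auto)
    finally have k: "norm (kummer (- 1/2) (of_real (- q - 1/2)) ?z) \<le> C * ((1 + 2 / \<beta>) * (real n + 2)) ^ m" .
    have "1 \<le> real (Suc n) powr (q + 3/2)" using q by (intro ge_one_powr_ge_zero) auto
    hence "exp (- real (Suc n) * \<eta>) / real (Suc n) powr (q + 3/2) \<le> exp (- real (Suc n) * \<eta>) / 1"
      by (intro divide_left_mono) auto
    moreover have "- real (Suc n) * \<eta> = - \<eta> * real (Suc n)" by (simp add: algebra_simps)
    ultimately have e: "exp (- real (Suc n) * \<eta>) / real (Suc n) powr (q + 3/2) \<le> exp (- \<eta> * real (Suc n))"
      by (simp only: div_by_1)
    have "norm (exp_term q \<beta> \<eta> (Suc n)) =
        (exp (- real (Suc n) * \<eta>) / real (Suc n) powr (q + 3/2)) * norm (kummer (- 1/2) (of_real (- q - 1/2)) ?z)"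
      unfolding exp_term_def norm_mult norm_power norm_of_real by simp
    also have "\<dots> \<le> exp (- \<eta> * real (Suc n)) * (C * ((1 + 2 / \<beta>) * (real n + 2)) ^ m)"
      by (intro mult_mono e k) auto
    also have "\<dots> = C * (1 + 2 / \<beta>) ^ m * (real n + 2) ^ m * exp (- \<eta> * real (Suc n))"
      by (simp only: power_mult_distrib mult_ac)
    finally show ?thesis .
  qed
  thus ?thesis using that[of "C * (1 + 2 / \<beta>) ^ m" m] C(1) \<beta> by simp
qed

lemma summable_exp_term:
  assumes "\<eta> > 0"
  shows "summable (\<lambda>n. exp_term q \<beta> \<eta> (Suc n))"
proof -
  obtain C m where C: "\<And>\<eta> n. norm (exp_term q \<beta> \<eta> (Suc n)) \<le> C * (real n + 2) ^ m * exp (- \<eta> * real (Suc n))"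
    using exp_term_bound by metis
  have "summable (\<lambda>n. C * ((real n + 2) ^ m * exp (- \<eta> * real (Suc n))))"
    by (intro summable_mult summable_power_exp assms)
  thus ?thesis
    by (rule summable_comparison_test'[where N = 0]) (rule C[unfolded mult.assoc])
qed

text \<open>Every term of the series contains at least one factor \<open>exp (- \<eta>)\<close>, so
  \<open>E\<close> is exponentially small and fits into the error term for each
  \<open>N\<close>.\<close>

lemma E_bigo: "E q \<beta> \<in> O[at_top](\<lambda>\<eta>. of_real (\<eta> powr x))"
proof -
  obtain C m where C: "C \<ge> 0" "\<And>\<eta> n. norm (exp_term q \<beta> \<eta> (Suc n)) \<le> C * (real n + 2) ^ m * exp (- \<eta> * real (Suc n))"
    using exp_term_bound by metis
  define S where "S = (\<Sum>n. (real n + 2) ^ m * exp (- 1 * real (Suc n)))"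
  have sm: "summable (\<lambda>n. (real n + 2) ^ m * exp (- 1 * real (Suc n)))" by (rule summable_power_exp) simp
  have "norm (E q \<beta> \<eta>) \<le> (C * S * exp 1) * norm (of_real (exp (- \<eta>)) :: complex)" if \<eta>: "\<eta> \<ge> 1" for \<eta>
  proof -
    have le: "norm (exp_term q \<beta> \<eta> (Suc n)) \<le> C * exp (1 - \<eta>) * ((real n + 2) ^ m * exp (- 1 * real (Suc n)))" for n
    proof -
      \<comment> \<open>For \<open>\<eta> \<ge> 1\<close> this splits the exponent: one factor
        \<open>exp (1 - \<eta>)\<close> common to all terms is pulled out, leaving the convergent
        series at \<open>\<eta> = 1\<close>.\<close>
      have "(\<eta> - 1) * 1 \<le> (\<eta> - 1) * real (Suc n)" using \<eta> by (intro mult_left_mono) auto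
      hence "- \<eta> * real (Suc n) \<le> (1 - \<eta>) + - 1 * real (Suc n)" by (simp only: left_diff_distrib)
      hence "exp (- \<eta> * real (Suc n)) \<le> exp (1 - \<eta>) * exp (- 1 * real (Suc n))"
        by (simp only: exp_add[symmetric] exp_le_cancel_iff)
      hence "C * (real n + 2) ^ m * exp (- \<eta> * real (Suc n)) \<le> C * (real n + 2) ^ m * (exp (1 - \<eta>) * exp (- 1 * real (Suc n)))"
        using C(1) by (intro mult_left_mono) auto
      thus ?thesis using C(2)[of \<eta> n] by (simp only: mult_ac)
    qed
    have "norm (\<Sum>n. exp_term q \<beta> \<eta> (Suc n)) \<le> (\<Sum>n. C * exp (1 - \<eta>) * ((real n + 2) ^ m * exp (- 1 * real (Suc n))))"
      by (rule norm_suminf_le[OF le summable_mult[OF sm]])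
    also have "\<dots> = C * exp (1 - \<eta>) * S" unfolding S_def by (rule suminf_mult[OF sm])
    finally have s: "norm (\<Sum>n. exp_term q \<beta> \<eta> (Suc n)) \<le> C * exp (1 - \<eta>) * S" .
    have "norm (E q \<beta> \<eta>) = \<bar>sin (pi * q)\<bar> * norm (\<Sum>n. exp_term q \<beta> \<eta> (Suc n))"
      by (simp only: E_def norm_mult norm_of_real)
    also have "\<dots> \<le> 1 * (C * exp (1 - \<eta>) * S)" by (intro mult_mono s) auto
    also have "exp (1 - \<eta>) = exp 1 * norm (of_real (exp (- \<eta>)) :: complex)"
      by (simp only: norm_of_real abs_exp_cancel exp_add[symmetric]) simp
    finally show ?thesis by (simp only: mult_ac mult_1)
  qed
  hence "E q \<beta> \<in> O[at_top](\<lambda>\<eta>. of_real (exp (- \<eta>)))"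
    by (intro bigoI[where c = "C * S * exp 1"] eventually_mono[OF eventually_ge_at_top[of 1]]) auto
  also have "(\<lambda>\<eta>. of_real (exp (- \<eta>)) :: complex) \<in> O[at_top](\<lambda>\<eta>. of_real (\<eta> powr x))"
    unfolding landau_o.big.of_real_iff by real_asymp
  finally show ?thesis .
qed

section \<open>The first coefficients\<close>

lemma f2_fps:
  "fps_expansion (f2 q \<beta>) 0 = Abs_fps tau * Abs_fps (\<lambda>k. (2 / of_real \<beta>) ^ k * fps_nth (kummer_fps (- 1/2) (of_real (- q - 1/2))) k)"
proof -
  have "f2 q \<beta> has_fps_expansion fps_expansion (f2 q \<beta>) 0"
    using f2_holomorphic_ball by (intro has_fps_expansion_fps_expansion[of "ball 0 1"]) auto
  moreover have "f2 q \<beta> = (\<lambda>s. pi_sin s * kummer (- 1/2) (of_real (- q - 1/2)) (2 / of_real \<beta> * s))"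
    by (simp add: f2_def fun_eq_iff)
  hence "f2 q \<beta> has_fps_expansion Abs_fps tau * Abs_fps (\<lambda>k. (2 / of_real \<beta>) ^ k * fps_nth (kummer_fps (- 1/2) (of_real (- q - 1/2))) k)"
    by (simp only:) (intro fps_expansion_intros pi_sin_has_fps_expansion kummer_has_fps_expansion lower_parameter_ok)
  ultimately show ?thesis by (rule fps_expansion_unique_complex)
qed

lemma a_coeff_eq:
  "a_coeff q \<beta> n = (\<Sum>i=0..n. tau i * ((2 / of_real \<beta>) ^ (n - i) * fps_nth (kummer_fps (- 1/2) (of_real (- q - 1/2))) (n - i)))"
  by (simp add: a_coeff_def f2_fps fps_mult_nth)

lemma a_coeff_values:
  "a_coeff q \<beta> 0 = 1"
  "a_coeff q \<beta> 1 = of_real (2 / (\<beta> * (1 + 2 * q)))"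
  "a_coeff q \<beta> 2 = (tau 2 * of_real (\<beta>\<^sup>2 * (4 * q\<^sup>2 - 1)) - 2) / of_real (\<beta>\<^sup>2 * (4 * q\<^sup>2 - 1))"
  "a_coeff q \<beta> 3 = 2 * ((of_real (\<beta>\<^sup>2) * tau 2 * of_real ((2 * q - 1) * (2 * q - 3)) + 2)
                            / of_real (\<beta> ^ 3 * (4 * q\<^sup>2 - 1) * (2 * q - 3)))"
proof -
  let ?k = "\<lambda>j. (2 / of_real \<beta>) ^ j * fps_nth (kummer_fps (- 1/2) (of_real (- q - 1/2))) j"
  \<comment> \<open>The zeros of the denominators are the excluded half-integers 1/2 and 3/2 and the
    negative number -1/2.\<close>
  have ne: "2 * q - 1 \<noteq> 0" "2 * q - 3 \<noteq> 0" "2 * q + 1 \<noteq> 0" "4 * q\<^sup>2 - 1 \<noteq> 0"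
  proof -
    show *: "2 * q - 1 \<noteq> 0" "2 * q - 3 \<noteq> 0" "2 * q + 1 \<noteq> 0"
      using q_half[of 0] q_half[of 1] q by auto
    have "4 * q\<^sup>2 - 1 = (2 * q - 1) * (2 * q + 1)" by (simp add: algebra_simps power2_eq_square)
    thus "4 * q\<^sup>2 - 1 \<noteq> 0" using * by simp
  qed
  have k: "?k j = of_real ((2 / \<beta>) ^ j * (pochhammer (- 1/2) j / (pochhammer (- q - 1/2) j * fact j)))" for j
  proof -
    have half: "(- 1/2 :: complex) = of_real (- 1/2)" by simp
    show ?thesis unfolding half kummer_fps_def fps_nth_Abs_fps pochhammer_of_real by simp
  qed
  have k0: "?k 0 = 1" by (simp add: kummer_fps_def)
  have k1: "?k 1 = of_real (2 / (\<beta> * (1 + 2 * q)))"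
  proof -
    have "(2 / \<beta>) ^ 1 * (pochhammer (- 1/2) 1 / (pochhammer (- q - 1/2) 1 * fact 1)) = 2 / (\<beta> * (1 + 2 * q))"
      using \<beta> ne by (simp add: divide_simps)
    thus ?thesis unfolding k by (simp only:)
  qed
  have k2: "?k 2 = of_real (- 2 / (\<beta>\<^sup>2 * (4 * q\<^sup>2 - 1)))"
  proof -
    have p: "pochhammer (- q - 1/2) 2 = (4 * q\<^sup>2 - 1) / 4" "pochhammer (- 1/2) 2 = (- 1/4 :: real)"
      by (simp_all add: numeral_2_eq_2 pochhammer_Suc algebra_simps)
    have "(2 / \<beta>) ^ 2 * (- 1/4 / (D / 4 * fact 2)) = - 2 / (\<beta>\<^sup>2 * D)" for D :: real
      by (simp add: power_divide fact_numeral)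
    thus ?thesis unfolding k p by (simp only:)
  qed
  have k3: "?k 3 = of_real (4 / (\<beta> ^ 3 * (4 * q\<^sup>2 - 1) * (2 * q - 3)))"
  proof -
    have p: "pochhammer (- q - 1/2) 3 = - (4 * q\<^sup>2 - 1) * (2 * q - 3) / 8" "pochhammer (- 1/2) 3 = (- 3/8 :: real)"
      by (simp_all add: numeral_3_eq_3 pochhammer_Suc algebra_simps power2_eq_square)
    have "(2 / \<beta>) ^ 3 * (- 3/8 / (- D * e / 8 * fact 3)) = 4 / (\<beta> ^ 3 * D * e)" for D e :: real
      by (simp add: power_divide fact_numeral)
    thus ?thesis unfolding k p by (simp only:)
  qed
  \<comment> \<open>As the odd coefficients of \<open>pi_sin\<close> vanish, the Cauchy products for
    \<open>a_coeff\<close> at 2 and at 3 reduce to two terms each.\<close>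
  have t: "tau 0 = 1" "tau (Suc 0) = 0" "tau 3 = 0" by (simp_all add: tau_0 tau_odd)
  show "a_coeff q \<beta> 0 = 1" using k0 t by (simp add: a_coeff_eq)
  show "a_coeff q \<beta> 1 = of_real (2 / (\<beta> * (1 + 2 * q)))"
    using k0 k1 t by (simp add: a_coeff_eq)
  have "a_coeff q \<beta> 2 = ?k 2 + tau 2 * ?k 0"
    using t by (simp add: a_coeff_eq numeral_2_eq_2)
  also have "\<dots> = (tau 2 * of_real (\<beta>\<^sup>2 * (4 * q\<^sup>2 - 1)) - 2) / of_real (\<beta>\<^sup>2 * (4 * q\<^sup>2 - 1))"
  proof -
    have alg: "of_real (- 2 / d) + tau 2 * 1 = (tau 2 * of_real d - 2) / of_real d" if "d \<noteq> 0" for d :: real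
      using that by (simp add: field_simps)
    show ?thesis unfolding k2 k0 by (rule alg) (use \<beta> ne in simp)
  qed
  finally show "a_coeff q \<beta> 2 = (tau 2 * of_real (\<beta>\<^sup>2 * (4 * q\<^sup>2 - 1)) - 2) / of_real (\<beta>\<^sup>2 * (4 * q\<^sup>2 - 1))" .
  have "a_coeff q \<beta> 3 = ?k 3 + tau 2 * ?k 1"
    using t by (simp add: a_coeff_eq numeral_3_eq_3 numeral_2_eq_2)
  also have "\<dots> = 2 * ((of_real (\<beta>\<^sup>2) * tau 2 * of_real ((2 * q - 1) * (2 * q - 3)) + 2)
                            / of_real (\<beta> ^ 3 * (4 * q\<^sup>2 - 1) * (2 * q - 3)))"
  proof -
    have "2 / (\<beta> * (1 + 2 * q)) = 2 * (\<beta>\<^sup>2 * ((2 * q - 1) * (2 * q - 3))) / (\<beta> ^ 3 * (4 * q\<^sup>2 - 1) * (2 * q - 3))"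
    proof -
      have d: "\<beta> ^ 3 * (4 * q\<^sup>2 - 1) * (2 * q - 3) = (\<beta> * (1 + 2 * q)) * (\<beta>\<^sup>2 * ((2 * q - 1) * (2 * q - 3)))"
        by (simp add: power2_eq_square power3_eq_cube algebra_simps)
      have alg: "2 / x = 2 * y / (x * y)" if "y \<noteq> 0" for x y :: real using that by simp
      show ?thesis unfolding d by (rule alg) (use \<beta> ne in simp)
    qed
    hence k1': "?k 1 = of_real (2 * (\<beta>\<^sup>2 * ((2 * q - 1) * (2 * q - 3))) / (\<beta> ^ 3 * (4 * q\<^sup>2 - 1) * (2 * q - 3)))"
      unfolding k1 by (simp only:)
    have "of_real (4 / d) + tau 2 * of_real (2 * (b * e) / d) = 2 * ((of_real b * tau 2 * of_real e + 2) / of_real d)" for b d e :: real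
      by (simp add: add_divide_distrib distrib_left mult_ac)
    thus ?thesis unfolding k3 k1' .
  qed
  finally show "a_coeff q \<beta> 3 = 2 * ((of_real (\<beta>\<^sup>2) * tau 2 * of_real ((2 * q - 1) * (2 * q - 3)) + 2)
                            / of_real (\<beta> ^ 3 * (4 * q\<^sup>2 - 1) * (2 * q - 3)))" .
qed

end

theorem lemma3p2:
  fixes q \<beta> c :: real
  assumes "\<beta> > 0" and "q \<ge> 0" and "\<And>k::nat. q \<noteq> real k + 1/2"
    and "0 < c" and "c < 1"
  shows
    "(\<forall>\<eta>>0. (\<lambda>n. (-1) ^ n * of_real (exp (- real n * \<eta>))
          * kummer (of_real (q + 1)) (of_real (q + 5/2)) (of_real (- 2 * real n / \<beta>)))
        sums F1 c q \<eta> \<beta>)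
     \<and> (\<forall>\<eta>>0. summable (\<lambda>n. exp_term q \<beta> \<eta> (Suc n)))
     \<and> (\<forall>N::nat.
          (\<lambda>\<eta>. F2 c q \<eta> \<beta>
             - (of_real (\<eta> powr (q + 3/2))
                  * (\<Sum>n<N. 1 / of_real (Gamma (q + 5/2 - real n)) * (a_coeff q \<beta> n / of_real (\<eta> ^ n)))
                + E q \<beta> \<eta>))
          \<in> O[at_top](\<lambda>\<eta>. of_real (\<eta> powr (q + 3/2 - real N))))
     \<and> (\<forall>s. norm s < 1 \<longrightarrow> (\<lambda>n. a_coeff q \<beta> n * s ^ n) sums f2 q \<beta> s)
     \<and> a_coeff q \<beta> 0 = 1
     \<and> a_coeff q \<beta> 1 = of_real (2 / (\<beta> * (1 + 2 * q)))
     \<and> a_coeff q \<beta> 2 = (tau 2 * of_real (\<beta>\<^sup>2 * (4 * q\<^sup>2 - 1)) - 2) / of_real (\<beta>\<^sup>2 * (4 * q\<^sup>2 - 1))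
     \<and> a_coeff q \<beta> 3 = 2 * ((of_real (\<beta>\<^sup>2) * tau 2 * of_real ((2 * q - 1) * (2 * q - 3)) + 2)
                            / of_real (\<beta> ^ 3 * (4 * q\<^sup>2 - 1) * (2 * q - 3)))"
proof (intro conjI allI impI)
  fix N :: nat
  show "(\<lambda>\<eta>. F2 c q \<eta> \<beta>
             - (of_real (\<eta> powr (q + 3/2))
                  * (\<Sum>n<N. 1 / of_real (Gamma (q + 5/2 - real n)) * (a_coeff q \<beta> n / of_real (\<eta> ^ n)))
                + E q \<beta> \<eta>))
          \<in> O[at_top](\<lambda>\<eta>. of_real (\<eta> powr (q + 3/2 - real N)))"
    \<comment> \<open>Regrouping to \<open>(F2 - sum) - E\<close> exhibits the difference of two
      functions that are each of the required order.\<close>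
    unfolding diff_diff_eq[symmetric]
    by (intro sum_in_bigo F2_expansion E_bigo assms)
qed (intro F1_sums summable_exp_term a_coeff_sums a_coeff_values assms; assumption)+

end
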